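(* Let $\nu>1$ be an integer. Then: (a) The graded vector space $\bigoplus_{n\ge 0}\mathrm{scf}(\mathcal N_n(\nu))$, equipped with the product $\mathbf m$ and the coproduct $\blacktriangle$, has a Hopf algebra structure. (b) The linear map $\mathrm{ch}_\nu:\bigoplus_{n\ge 0}\mathrm{scf}(\mathcal N_n(\nu))\to \mathrm{QSym}$ is an isomorphism of Hopf algebras.
   Context: Notation: $[k]=\{1,\dots,k\}$ for $k\ge1$ and $[k]=\emptyset$ for $k\le 0$. A composition $\alpha=(\alpha_1,\dots,\alpha_l)$ of $n$ is a finite sequence of positive integers with sum $n$; for $n\ge 1$, $I=\{s_1<\dots<s_i\}\subseteq[n-1]$ corresponds to the composition $\mathrm{comp}(I)=(s_1,s_2-s_1,\dots,s_i-s_{i-1},n-s_i)$ of $n$; for $n=0$, $\mathrm{comp}(\emptyset)$ is the empty composition. $\mathrm{QSym}$ is the Hopf algebra of quasisymmetric functions over $\mathbb C$ with its usual product and coproduct; it has basis the monomial quasisymmetric functions $M_\alpha=\sum_{i_1<\dots<i_l}x_{i_1}^{\alpha_1}\cdots x_{i_l}^{\alpha_l}$, with $\triangle M_\alpha=\sum_{\beta\cdot\gamma=\alpha}M_\beta\otimes M_\gamma$ (deconcatenation), and basis the fundamental quasisymmetric functions $L_{\mathrm{comp}(I)}=\sum_{I\subseteq J\subseteq [n-1]}M_{\mathrm{comp}(J)}$. Let $C_\nu$ be a cyclic group of order $\nu$, written additively. For $n\ge0$ let $Q_n(\nu)=\bigoplus_{i\in[n-1]}C_\nu$ (trivial if $n\le1$),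 with elements $g=(g_i)_{i\in[n-1]}$ and identity $\mathbf 0$; $\mathrm{cf}(Q_n(\nu))$ is the space of complex (class) functions on $Q_n(\nu)$. $\mathrm{scf}(\mathcal N_n(\nu))\subseteq \mathrm{cf}(Q_n(\nu))$ is the space of functions constant on each superclass $\mathrm{cl}_I(\nu)=\{g: g_i\neq0\iff i\in I\}$, $I\subseteq[n-1]$. (It is the supercharacter function space of the normal lattice supercharacter theory of $Q_n(\nu)$ attached to the lattice of subgroups $Q_I(\nu)=\{g: g_i=0 \text{ for } i\notin I\}$.) For $n=0,1$ it is one-dimensional, spanned by $\mathbb 1_0$, $\mathbb 1_1$ respectively. For $I\subseteq[n-1]$, the supercharacter $\chi^I(\nu)$ is the sum of all irreducible characters of $Q_n(\nu)$ whose restriction to the $i$-th factor is trivial exactly when $i\in I$, and $\dot\chi^I(\nu)=\chi^I(\nu)/\chi^I(\nu)(\mathbf 0)$. Let $\bar r=(\mathbb{reg}-\mathbb 1)/(\nu-1)$ be the function on $C_\nu$, where $\mathbb{reg}$ is the regular character and $\mathbb 1$ the trivial one; so $\bar r(0)=1$, $\bar r(g)=-1/(\nu-1)$ for $g\ne0$, and $\dot\chi^I(\nu)(g)=\prod_{i\in[n-1]\setminus I}\bar r(g_i)$. The $\dot\chi^I(\nu)$ form a basis of $\mathrm{scf}(\mathcal N_n(\nu))$. Product. For $A\subseteq[N]$ put $A^{\mathrm c}=[N]\setminus A$, $\mathsf e(A)=\{i\in[N-1]: i\in A, i+1\notin A\}$, $\overline{\mathsf e}(A)=\mathsf e(A)\sqcup\mathsf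 e(A^{\mathrm c})$. Let $\phi\in\mathrm{cf}(Q_m(\nu))$, $\psi\in\mathrm{cf}(Q_n(\nu))$ and let $A\subseteq[m+n]$ with $|A|=n$. If $m=0$ or $n=0$, $\mathbf m_A(\phi,\psi)$ is the scalar product (identifying $\mathbb C\mathbb 1_0$ with $\mathbb C$). Otherwise write $A^{\mathrm c}=\{b_1<\dots<b_m\}$, $A=\{a_1<\dots<a_n\}$, and for $h\in\bigoplus_{i\in[m+n]}C_\nu$ put $$\mathbf s_A(\phi,\psi)(h)=\phi(h_{b_1},\dots,h_{b_{m-1}})\,\bar r(h_{b_m})\,\psi(h_{a_1},\dots,h_{a_{n-1}})\,\bar r(h_{a_n}).$$ For $g\in Q_{m+n}(\nu)$ define $$\mathbf m_A(\phi,\psi)(g)=\Big(\prod_{i\in\mathsf e(A^{\mathrm c})}\bar r(g_i)\Big)\,\mathbf s_A(\phi,\psi)(g^A),$$ where $g^A_i=g_i$ for $i\in[m+n-1]\setminus\overline{\mathsf e}(A)$ and $g^A_i=0$ for all other $i\in[m+n]$. Then $\mathbf m=\sum_{A\subseteq[m+n],|A|=n}\mathbf m_A$, extended bilinearly. Coproduct. For $\phi\in\mathrm{cf}(Q_n(\nu))$: $\blacktriangle_0(\phi)=\mathbb 1_0\otimes\phi$, $\blacktriangle_n(\phi)=\phi\otimes\mathbb 1_0$, and for $1\le k\le n-1$, $\blacktriangle_k(\phi)\in\mathrm{cf}(Q_k(\nu))\otimes\mathrm{cf}(Q_{n-k}(\nu))$ is the element corresponding to the function $(x,y)\mapsto\phi(x_1,\dots,x_{k-1},0,y_1,\dots,y_{n-k-1})$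 on $Q_k(\nu)\times Q_{n-k}(\nu)$. Then $\blacktriangle=\sum_{k=0}^n\blacktriangle_k$, extended linearly. Both $\mathbf m$ and $\blacktriangle$ restrict to $\bigoplus_{n\ge 0}\mathrm{scf}(\mathcal N_n(\nu))$. The map $\mathrm{ch}_\nu$ is the linear isomorphism with $\mathrm{ch}_\nu(\dot\chi^I(\nu))=L_{\mathrm{comp}(I)}$ for all $n\ge0$, $I\subseteq[n-1]$. *)

theory Defs
  imports
    "HOL-Library.Function_Algebras"
    "HOL-Library.Poly_Mapping"
    "HOL-Algebra.Elementary_Groups"
    "HOL-Algebra.Product_Groups"
    "Jordan_Normal_Form.Matrix"
begin

section \<open>Spaces of complex-valued functions and their tensor products\<close>

definition fscale :: "complex \<Rightarrow> ('x \<Rightarrow> complex) \<Rightarrow> ('x \<Rightarrow> complex)" where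
  "fscale c f = (\<lambda>x. c * f x)"

interpretation fs: vector_space "fscale :: complex \<Rightarrow> ('x \<Rightarrow> complex) \<Rightarrow> ('x \<Rightarrow> complex)"
  by unfold_locales (auto simp: fscale_def fun_eq_iff algebra_simps)

definition linear_on :: "('x \<Rightarrow> complex) set \<Rightarrow> (('x \<Rightarrow> complex) \<Rightarrow> ('y \<Rightarrow> complex)) \<Rightarrow> bool" where
  "linear_on V f \<longleftrightarrow>
     (\<forall>v\<in>V. \<forall>w\<in>V. f (v + w) = f v + f w) \<and>
     (\<forall>v\<in>V. \<forall>c. f (fscale c v) = fscale c (f v))"

definition linear_form_on :: "('x \<Rightarrow> complex) set \<Rightarrow> (('x \<Rightarrow> complex) \<Rightarrow> complex) \<Rightarrow> bool" where
  "linear_form_on V f \<longleftrightarrow>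
     (\<forall>v\<in>V. \<forall>w\<in>V. f (v + w) = f v + f w) \<and>
     (\<forall>v\<in>V. \<forall>c. f (fscale c v) = c * f v)"

definition bilinear_on ::
  "('x \<Rightarrow> complex) set \<Rightarrow> ('y \<Rightarrow> complex) set \<Rightarrow>
   (('x \<Rightarrow> complex) \<Rightarrow> ('y \<Rightarrow> complex) \<Rightarrow> ('z \<Rightarrow> complex)) \<Rightarrow> bool" where
  "bilinear_on V W B \<longleftrightarrow>
     (\<forall>v\<in>V. linear_on W (B v)) \<and> (\<forall>w\<in>W. linear_on V (\<lambda>v. B v w))"

text \<open>The linear map on the span of the family \<open>b\<close> (indexed by \<open>K\<close>) that sends each \<open>b k\<close>
  to \<open>w k\<close>.  It is meaningful whenever every linear relation among the \<open>b k\<close> also holds among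
  the \<open>w k\<close>, in particular when \<open>b\<close> is a basis.\<close>

definition lin_ext ::
  "'k set \<Rightarrow> ('k \<Rightarrow> ('x \<Rightarrow> complex)) \<Rightarrow> ('k \<Rightarrow> ('y \<Rightarrow> complex)) \<Rightarrow>
   ('x \<Rightarrow> complex) \<Rightarrow> ('y \<Rightarrow> complex)" where
  "lin_ext K b w v =
     (THE u. \<exists>S c. finite S \<and> S \<subseteq> K \<and> v = (\<Sum>k\<in>S. fscale (c k) (b k)) \<and>
                   u = (\<Sum>k\<in>S. fscale (c k) (w k)))"

text \<open>The tensor product of spaces \<open>V\<close> and \<open>W\<close> of functions on \<open>X\<close> and \<open>Y\<close> is realised as the
  space of functions on \<open>X \<times> Y\<close> spanned by the products \<open>v(x) w(y)\<close>.  The lemma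
  \<open>tensor_lift_universal\<close> below is its universal property.\<close>

definition pure :: "('x \<Rightarrow> complex) \<Rightarrow> ('y \<Rightarrow> complex) \<Rightarrow> ('x \<times> 'y \<Rightarrow> complex)"
    (infixr \<open>\<otimes>\<^sub>t\<close> 75) where
  "v \<otimes>\<^sub>t w = (\<lambda>(x, y). v x * w y)"

definition tensor ::
  "('x \<Rightarrow> complex) set \<Rightarrow> ('y \<Rightarrow> complex) set \<Rightarrow> ('x \<times> 'y \<Rightarrow> complex) set" where
  "tensor V W = fs.span {v \<otimes>\<^sub>t w | v w. v \<in> V \<and> w \<in> W}"

text \<open>The linear map on the tensor product induced by a bilinear map \<open>B\<close>.\<close>

definition tensor_lift ::
  "('x \<Rightarrow> complex) set \<Rightarrow> ('y \<Rightarrow> complex) set \<Rightarrow>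
   (('x \<Rightarrow> complex) \<Rightarrow> ('y \<Rightarrow> complex) \<Rightarrow> ('z \<Rightarrow> complex)) \<Rightarrow>
   ('x \<times> 'y \<Rightarrow> complex) \<Rightarrow> ('z \<Rightarrow> complex)" where
  "tensor_lift V W B = lin_ext (V \<times> W) (\<lambda>(v, w). v \<otimes>\<^sub>t w) (\<lambda>(v, w). B v w)"

definition tensor_map ::
  "('x \<Rightarrow> complex) set \<Rightarrow> ('y \<Rightarrow> complex) set \<Rightarrow>
   (('x \<Rightarrow> complex) \<Rightarrow> ('x' \<Rightarrow> complex)) \<Rightarrow> (('y \<Rightarrow> complex) \<Rightarrow> ('y' \<Rightarrow> complex)) \<Rightarrow>
   ('x \<times> 'y \<Rightarrow> complex) \<Rightarrow> ('x' \<times> 'y' \<Rightarrow> complex)" where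
  "tensor_map V W f g = tensor_lift V W (\<lambda>v w. f v \<otimes>\<^sub>t g w)"

definition reassoc :: "(('x \<times> 'y) \<times> 'z \<Rightarrow> complex) \<Rightarrow> ('x \<times> ('y \<times> 'z) \<Rightarrow> complex)" where
  "reassoc t = (\<lambda>(x, (y, z)). t ((x, y), z))"

lemma sum_fun_apply: "(\<Sum>i\<in>S. f i) x = (\<Sum>i\<in>S. f i x)"
  for f :: "'i \<Rightarrow> 'x \<Rightarrow> complex"
  by (induction S rule: infinite_finite_induct) auto

lemma linear_on_sum:
  assumes "fs.subspace V" "linear_on V f" "finite S" "\<And>i. i \<in> S \<Longrightarrow> v i \<in> V"
  shows "f (\<Sum>i\<in>S. fscale (c i) (v i)) = (\<Sum>i\<in>S. fscale (c i) (f (v i)))"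
  using assms(3,4)
proof (induction S rule: finite_induct)
  case empty
  have "f (fscale 0 0) = fscale 0 (f 0)"
    using assms(1,2) fs.subspace_0 unfolding linear_on_def by blast
  then show ?case by (simp only: fs.scale_zero_left sum.empty)
next
  case (insert i S)
  have "(\<Sum>i\<in>S. fscale (c i) (v i)) \<in> V"
    using insert.prems by (intro fs.subspace_sum[OF assms(1)] fs.subspace_scale[OF assms(1)]) auto
  moreover have "fscale (c i) (v i) \<in> V"
    using insert.prems by (intro fs.subspace_scale[OF assms(1)]) auto
  ultimately have "f (fscale (c i) (v i) + (\<Sum>i\<in>S. fscale (c i) (v i)))
      = fscale (c i) (f (v i)) + f (\<Sum>i\<in>S. fscale (c i) (v i))"
    using insert.prems assms(2) unfolding linear_on_def by force
  then show ?case
    using insert by (simp only: sum.insert insert_iff simp_thms)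
qed

lemma tensor_relation:
  assumes V: "fs.subspace V" and W: "fs.subspace W" and B: "bilinear_on V W B"
    and "finite S" "\<And>i. i \<in> S \<Longrightarrow> v i \<in> V" "\<And>i. i \<in> S \<Longrightarrow> w i \<in> W"
    and "\<And>x y. (\<Sum>i\<in>S. v i x * w i y) = 0"
  shows "(\<Sum>i\<in>S. B (v i) (w i)) = 0"
  using assms(4-)
proof (induction "card S" arbitrary: S w)
  case 0
  then show ?case by simp
next
  case (Suc n)
  have BW: "linear_on W (B a)" if "a \<in> V" for a using B that by (simp add: bilinear_on_def)
  have BV: "linear_on V (\<lambda>a. B a b)" if "b \<in> W" for b using B that by (simp add: bilinear_on_def)
  have B0: "B a 0 = 0" if "a \<in> V" for a
    using linear_on_sum[OF W BW[OF that], of "{}"] by simp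
  show ?case
  proof (cases "\<forall>i\<in>S. w i = 0")
    case True
    then show ?thesis using B0 Suc.prems by simp
  next
    case False
    then obtain j y0 where j: "j \<in> S" and y0: "w j y0 \<noteq> 0" by (auto simp: fun_eq_iff)
    define r where "r i = w i y0 / w j y0" for i
    define S' where "S' = S - {j}"
    have S: "S = insert j S'" "j \<notin> S'" "finite S'" using j Suc.prems by (auto simp: S'_def)
    have vj: "v j = (\<Sum>i\<in>S'. fscale (- r i) (v i))"
    proof
      fix x
      have "v j x * w j y0 + (\<Sum>i\<in>S'. v i x * w i y0) = 0"
        using Suc.prems(4)[of x y0] S by simp
      then have "v j x = - (\<Sum>i\<in>S'. v i x * w i y0) / w j y0"
        using y0 by (simp add: field_simps add_eq_0_iff)
      then show "v j x = (\<Sum>i\<in>S'. fscale (- r i) (v i)) x"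
        by (simp add: sum_fun_apply fscale_def r_def sum_divide_distrib sum_negf mult.commute)
    qed
    define w' where "w' i = w i + fscale (- r i) (w j)" for i
    have w'W: "w' i \<in> W" if "i \<in> S'" for i
      unfolding w'_def using that Suc.prems(3) S
      by (intro fs.subspace_add[OF W] fs.subspace_scale[OF W]) auto
    have "(\<Sum>i\<in>S'. v i x * w' i y) = 0" for x y
    proof -
      have "(\<Sum>i\<in>S'. v i x * w' i y)
          = (\<Sum>i\<in>S'. v i x * w i y) + (\<Sum>i\<in>S'. fscale (- r i) (v i)) x * w j y"
        unfolding sum_fun_apply sum_distrib_right sum.distrib[symmetric]
        by (rule sum.cong) (simp_all only: w'_def fscale_def plus_fun_apply, simp add: algebra_simps)
      also have "(\<Sum>i\<in>S'. fscale (- r i) (v i)) x = v j x"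
        using vj by (rule fun_cong[OF sym])
      also have "(\<Sum>i\<in>S'. v i x * w i y) + v j x * w j y = 0"
        using Suc.prems(4)[of x y] S by (simp add: add.commute)
      finally show ?thesis .
    qed
    moreover have "n = card S'" using Suc(2) S by simp
    ultimately have "0 = (\<Sum>i\<in>S'. B (v i) (w' i))"
      using Suc.hyps(1)[of S' w'] Suc.prems(2) w'W S by auto
    also have "\<dots> = (\<Sum>i\<in>S'. B (v i) (w i) + fscale (- r i) (B (v i) (w j)))"
    proof (rule sum.cong)
      fix i assume i: "i \<in> S'"
      then have "v i \<in> V" "w i \<in> W" "w j \<in> W" using Suc.prems S by auto
      then show "B (v i) (w' i) = B (v i) (w i) + fscale (- r i) (B (v i) (w j))"
        using BW[of "v i"] fs.subspace_scale[OF W] unfolding w'_def linear_on_def by metis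
    qed simp
    also have "\<dots> = (\<Sum>i\<in>S'. B (v i) (w i)) + B (v j) (w j)"
    proof -
      have "B (\<Sum>i\<in>S'. fscale (- r i) (v i)) (w j) = (\<Sum>i\<in>S'. fscale (- r i) (B (v i) (w j)))"
        using Suc.prems S by (intro linear_on_sum[OF V BV]) auto
      then show ?thesis by (simp only: sum.distrib vj[symmetric])
    qed
    also have "\<dots> = (\<Sum>i\<in>S. B (v i) (w i))" using S by (simp add: add.commute)
    finally show ?thesis by simp
  qed
qed

lemma tensor_span:
  assumes V: "fs.subspace V" and t: "t \<in> tensor V W"
  shows "\<exists>S c. finite S \<and> S \<subseteq> V \<times> W \<and> t = (\<Sum>k\<in>S. fscale (c k) (case k of (v, w) \<Rightarrow> v \<otimes>\<^sub>t w))"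
proof -
  have "{v \<otimes>\<^sub>t w | v w. v \<in> V \<and> w \<in> W} = (\<lambda>(v, w). v \<otimes>\<^sub>t w) ` (V \<times> W)" by auto
  then have "t \<in> fs.span ((\<lambda>(v, w). v \<otimes>\<^sub>t w) ` (V \<times> W))"
    using t unfolding tensor_def by (simp only:)
  then obtain T r where T: "finite T" "T \<subseteq> (\<lambda>(v, w). v \<otimes>\<^sub>t w) ` (V \<times> W)"
      "t = (\<Sum>a\<in>T. fscale (r a) a)"
    unfolding fs.span_explicit mem_Collect_eq by (elim exE conjE)
  from T(2)[unfolded subset_image_inj] obtain S where S: "S \<subseteq> V \<times> W" "inj_on (\<lambda>(v, w). v \<otimes>\<^sub>t w) S"
      "T = (\<lambda>(v, w). v \<otimes>\<^sub>t w) ` S"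
    by (elim exE conjE)
  have "t = (\<Sum>k\<in>S. fscale (r (case k of (v, w) \<Rightarrow> v \<otimes>\<^sub>t w)) (case k of (v, w) \<Rightarrow> v \<otimes>\<^sub>t w))"
    unfolding T(3) S(3) sum.reindex[OF S(2)] comp_def ..
  moreover have "finite S" by (rule finite_imageD[OF T(1)[unfolded S(3)] S(2)])
  ultimately show ?thesis using S(1)
    by (intro exI[of _ S] exI[of _ "\<lambda>k. r (case k of (v, w) \<Rightarrow> v \<otimes>\<^sub>t w)"] conjI)
qed

lemma tensor_lift_eq:
  assumes V: "fs.subspace V" and W: "fs.subspace W" and B: "bilinear_on V W B"
    and S: "finite S" "S \<subseteq> V \<times> W"
  shows "tensor_lift V W B (\<Sum>k\<in>S. fscale (c k) (case k of (v, w) \<Rightarrow> v \<otimes>\<^sub>t w))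
       = (\<Sum>k\<in>S. fscale (c k) (case k of (v, w) \<Rightarrow> B v w))"
proof -
  have *: "(\<Sum>k\<in>S'. fscale (c' k) (case k of (v, w) \<Rightarrow> B v w))
         = (\<Sum>k\<in>S. fscale (c k) (case k of (v, w) \<Rightarrow> B v w))"
    if S': "finite S'" "S' \<subseteq> V \<times> W"
      and eq: "(\<Sum>k\<in>S. fscale (c k) (case k of (v, w) \<Rightarrow> v \<otimes>\<^sub>t w))
             = (\<Sum>k\<in>S'. fscale (c' k) (case k of (v, w) \<Rightarrow> v \<otimes>\<^sub>t w))" for S' c'
  proof -
    define T where "T = S \<union> S'"
    define d where "d k = (if k \<in> S then c k else 0) - (if k \<in> S' then c' k else 0)" for k
    have T: "finite T" "T \<subseteq> V \<times> W" using S S' by (auto simp: T_def)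
    have red: "(\<Sum>k\<in>T. fscale (d k) (h k)) = (\<Sum>k\<in>S. fscale (c k) (h k)) - (\<Sum>k\<in>S'. fscale (c' k) (h k))"
      for h :: "_ \<Rightarrow> 'z \<Rightarrow> complex"
    proof -
      have "(\<Sum>k\<in>T. fscale (d k) (h k)) = (\<Sum>k\<in>T. if k \<in> S then fscale (c k) (h k) else 0)
              - (\<Sum>k\<in>T. if k \<in> S' then fscale (c' k) (h k) else 0)"
        unfolding sum_subtractf[symmetric]
        by (intro sum.cong) (auto simp: d_def fs.scale_left_diff_distrib)
      also have "(\<Sum>k\<in>T. if k \<in> S then fscale (c k) (h k) else 0) = (\<Sum>k\<in>S. fscale (c k) (h k))"
        using T by (simp add: sum.If_cases T_def Int_absorb1)
      also have "(\<Sum>k\<in>T. if k \<in> S' then fscale (c' k) (h k) else 0) = (\<Sum>k\<in>S'. fscale (c' k) (h k))"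
        using T by (simp add: sum.If_cases T_def Int_absorb1)
      finally show ?thesis .
    qed
    have "(\<Sum>k\<in>T. fscale (d k) (fst k) x * snd k y) = 0" for x y
    proof -
      have "(\<Sum>k\<in>T. d k * (fst k x * snd k y)) =
            (\<Sum>k\<in>S. c k * (fst k x * snd k y)) - (\<Sum>k\<in>S'. c' k * (fst k x * snd k y))"
        using fun_cong[OF red[of "\<lambda>k _. fst k x * snd k y"], of undefined]
        by (simp add: sum_fun_apply fscale_def)
      also have "\<dots> = 0"
        using fun_cong[OF eq, of "(x, y)"]
        by (simp add: sum_fun_apply fscale_def case_prod_unfold pure_def)
      finally show ?thesis by (simp add: fscale_def mult.assoc)
    qed
    then have "(\<Sum>k\<in>T. B (fscale (d k) (fst k)) (snd k)) = 0"
      using T by (intro tensor_relation[OF V W B]) (auto intro!: fs.subspace_scale[OF V])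
    also have "(\<Sum>k\<in>T. B (fscale (d k) (fst k)) (snd k)) = (\<Sum>k\<in>T. fscale (d k) (case k of (v, w) \<Rightarrow> B v w))"
      using T B by (intro sum.cong) (auto simp: bilinear_on_def linear_on_def)
    finally show ?thesis
      unfolding red[of "\<lambda>k. case k of (v, w) \<Rightarrow> B v w"] right_minus_eq by (rule sym)
  qed
  show ?thesis
    unfolding tensor_lift_def lin_ext_def
  proof (rule the_equality, goal_cases)
    case 1
    show ?case using S by (intro exI[of _ S] exI[of _ c]) simp
  next
    case (2 u)
    then obtain S' c' where "finite S'" "S' \<subseteq> V \<times> W"
      and "(\<Sum>k\<in>S. fscale (c k) (case k of (v, w) \<Rightarrow> v \<otimes>\<^sub>t w))
         = (\<Sum>k\<in>S'. fscale (c' k) (case k of (v, w) \<Rightarrow> v \<otimes>\<^sub>t w))"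
      and u: "u = (\<Sum>k\<in>S'. fscale (c' k) (case k of (v, w) \<Rightarrow> B v w))"
      by (elim exE conjE)
    then show ?case unfolding u by (intro *)
  qed
qed

lemma tensor_lift_universal:
  assumes V: "fs.subspace V" and W: "fs.subspace W" and B: "bilinear_on V W B"
  shows "linear_on (tensor V W) (tensor_lift V W B)"
    and "\<lbrakk>v \<in> V; w \<in> W\<rbrakk> \<Longrightarrow> tensor_lift V W B (v \<otimes>\<^sub>t w) = B v w"
proof -
  let ?p = "\<lambda>k. case k of (v, w) \<Rightarrow> v \<otimes>\<^sub>t w" and ?b = "\<lambda>k. case k of (v, w) \<Rightarrow> B v w"
  have ext: "\<exists>c. t = (\<Sum>k\<in>T. fscale (c k) (?p k))"
    if "t = (\<Sum>k\<in>S. fscale (c k) (?p k))" "S \<subseteq> T" "finite T" for t S T c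
  proof -
    have "(\<Sum>k\<in>S. fscale (c k) (?p k)) = (\<Sum>k\<in>T. fscale (if k \<in> S then c k else 0) (?p k))"
      using that by (intro sum.mono_neutral_cong_left) auto
    then show ?thesis using that(1) by (intro exI[of _ "\<lambda>k. if k \<in> S then c k else 0"]) simp
  qed
  show "linear_on (tensor V W) (tensor_lift V W B)"
    unfolding linear_on_def
  proof (intro conjI ballI allI)
    fix s t assume st: "s \<in> tensor V W" "t \<in> tensor V W"
    obtain S c where S: "finite S" "S \<subseteq> V \<times> W" "s = (\<Sum>k\<in>S. fscale (c k) (?p k))"
      using tensor_span[OF V st(1)] by (elim exE conjE)
    obtain T d where T: "finite T" "T \<subseteq> V \<times> W" "t = (\<Sum>k\<in>T. fscale (d k) (?p k))"
      using tensor_span[OF V st(2)] by (elim exE conjE)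
    define U where "U = S \<union> T"
    have U: "finite U" "U \<subseteq> V \<times> W" using S T by (auto simp: U_def)
    obtain c' where s: "s = (\<Sum>k\<in>U. fscale (c' k) (?p k))"
      using ext[OF S(3) _ U(1)] unfolding U_def by blast
    obtain d' where t: "t = (\<Sum>k\<in>U. fscale (d' k) (?p k))"
      using ext[OF T(3) _ U(1)] unfolding U_def by blast
    have "s + t = (\<Sum>k\<in>U. fscale (c' k + d' k) (?p k))"
      unfolding s t by (simp add: sum.distrib fs.scale_left_distrib)
    then have "tensor_lift V W B (s + t) = (\<Sum>k\<in>U. fscale (c' k + d' k) (?b k))"
      using tensor_lift_eq[OF V W B U] by simp
    also have "\<dots> = tensor_lift V W B s + tensor_lift V W B t"
      unfolding s t tensor_lift_eq[OF V W B U] by (simp add: sum.distrib fs.scale_left_distrib)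
    finally show "tensor_lift V W B (s + t) = tensor_lift V W B s + tensor_lift V W B t" .
  next
    fix s r assume s: "s \<in> tensor V W"
    obtain S c where S: "finite S" "S \<subseteq> V \<times> W" and s: "s = (\<Sum>k\<in>S. fscale (c k) (?p k))"
      using tensor_span[OF V s] by (elim exE conjE)
    have "fscale r s = (\<Sum>k\<in>S. fscale (r * c k) (?p k))"
      unfolding s by (simp add: fs.scale_sum_right)
    then have "tensor_lift V W B (fscale r s) = (\<Sum>k\<in>S. fscale (r * c k) (?b k))"
      using tensor_lift_eq[OF V W B S] by simp
    also have "\<dots> = fscale r (tensor_lift V W B s)"
      unfolding s tensor_lift_eq[OF V W B S] by (simp add: fs.scale_sum_right)
    finally show "tensor_lift V W B (fscale r s) = fscale r (tensor_lift V W B s)" .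
  qed
  show "tensor_lift V W B (v \<otimes>\<^sub>t w) = B v w" if "v \<in> V" "w \<in> W"
    using tensor_lift_eq[OF V W B, of "{(v, w)}" "\<lambda>_. 1"] that by simp
qed


section \<open>Hopf algebras\<close>

text \<open>Multiplications are given as bilinear maps on \<open>V \<times> V\<close>.\<close>

locale algebra_on =
  fixes V :: "('x \<Rightarrow> complex) set"
    and mul :: "('x \<Rightarrow> complex) \<Rightarrow> ('x \<Rightarrow> complex) \<Rightarrow> ('x \<Rightarrow> complex)"
    and one :: "'x \<Rightarrow> complex"
  assumes subspace: "fs.subspace V"
    and mul_closed: "\<lbrakk>a \<in> V; b \<in> V\<rbrakk> \<Longrightarrow> mul a b \<in> V"
    and mul_bilinear: "bilinear_on V V mul"
    and mul_assoc: "\<lbrakk>a \<in> V; b \<in> V; c \<in> V\<rbrakk> \<Longrightarrow> mul (mul a b) c = mul a (mul b c)"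
    and one_closed: "one \<in> V"
    and one_left: "a \<in> V \<Longrightarrow> mul one a = a"
    and one_right: "a \<in> V \<Longrightarrow> mul a one = a"

locale coalgebra_on =
  fixes V :: "('x \<Rightarrow> complex) set"
    and comul :: "('x \<Rightarrow> complex) \<Rightarrow> ('x \<times> 'x \<Rightarrow> complex)"
    and counit :: "('x \<Rightarrow> complex) \<Rightarrow> complex"
  assumes subspace: "fs.subspace V"
    and comul_closed: "a \<in> V \<Longrightarrow> comul a \<in> tensor V V"
    and comul_linear: "linear_on V comul"
    and counit_linear: "linear_form_on V counit"
    and coassoc: "a \<in> V \<Longrightarrow>
      reassoc (tensor_map V V comul id (comul a)) = tensor_map V V id comul (comul a)"
    and counit_left: "a \<in> V \<Longrightarrow> tensor_lift V V (\<lambda>v w. fscale (counit v) w) (comul a) = a"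
    and counit_right: "a \<in> V \<Longrightarrow> tensor_lift V V (\<lambda>v w. fscale (counit w) v) (comul a) = a"

text \<open>The product \<open>(a \<otimes> b)(c \<otimes> d) = ac \<otimes> bd\<close> on the tensor square.\<close>

definition tensor_mul ::
  "('x \<Rightarrow> complex) set \<Rightarrow> (('x \<Rightarrow> complex) \<Rightarrow> ('x \<Rightarrow> complex) \<Rightarrow> ('x \<Rightarrow> complex)) \<Rightarrow>
   ('x \<times> 'x \<Rightarrow> complex) \<Rightarrow> ('x \<times> 'x \<Rightarrow> complex) \<Rightarrow> ('x \<times> 'x \<Rightarrow> complex)" where
  "tensor_mul V mul s t =
     tensor_lift V V (\<lambda>a b. tensor_lift V V (\<lambda>c d. mul a c \<otimes>\<^sub>t mul b d) t) s"

locale bialgebra_on = algebra_on V mul one + coalgebra_on V comul counit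
  for V :: "('x \<Rightarrow> complex) set" and mul one comul counit +
  assumes comul_mul: "\<lbrakk>a \<in> V; b \<in> V\<rbrakk> \<Longrightarrow> comul (mul a b) = tensor_mul V mul (comul a) (comul b)"
    and comul_one: "comul one = one \<otimes>\<^sub>t one"
    and counit_mul: "\<lbrakk>a \<in> V; b \<in> V\<rbrakk> \<Longrightarrow> counit (mul a b) = counit a * counit b"
    and counit_one: "counit one = 1"

locale hopf_algebra_on = bialgebra_on V mul one comul counit
  for V :: "('x \<Rightarrow> complex) set" and mul one comul counit +
  fixes antipode :: "('x \<Rightarrow> complex) \<Rightarrow> ('x \<Rightarrow> complex)"
  assumes antipode_closed: "a \<in> V \<Longrightarrow> antipode a \<in> V"
    and antipode_linear: "linear_on V antipode"
    and antipode_left: "a \<in> V \<Longrightarrow>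
      tensor_lift V V (\<lambda>v w. mul (antipode v) w) (comul a) = fscale (counit a) one"
    and antipode_right: "a \<in> V \<Longrightarrow>
      tensor_lift V V (\<lambda>v w. mul v (antipode w)) (comul a) = fscale (counit a) one"

locale hopf_iso_on =
  src: hopf_algebra_on V mul one comul counit antipode +
  dst: hopf_algebra_on V' mul' one' comul' counit' antipode'
  for V :: "('x \<Rightarrow> complex) set" and mul one comul counit antipode
    and V' :: "('y \<Rightarrow> complex) set" and mul' one' comul' counit' antipode' +
  fixes f :: "('x \<Rightarrow> complex) \<Rightarrow> ('y \<Rightarrow> complex)"
  assumes f_linear: "linear_on V f"
    and f_bij: "bij_betw f V V'"
    and f_mul: "\<lbrakk>a \<in> V; b \<in> V\<rbrakk> \<Longrightarrow> f (mul a b) = mul' (f a) (f b)"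
    and f_one: "f one = one'"
    and f_comul: "a \<in> V \<Longrightarrow> tensor_map V V f f (comul a) = comul' (f a)"
    and f_counit: "a \<in> V \<Longrightarrow> counit' (f a) = counit a"
    and f_antipode: "a \<in> V \<Longrightarrow> f (antipode a) = antipode' (f a)"


section \<open>Quasisymmetric functions\<close>

text \<open>A monomial in the variables \<open>x\<^sub>0, x\<^sub>1, \<dots>\<close> is its exponent vector of type
  \<open>nat \<Rightarrow>\<^sub>0 nat\<close>; a formal power series is the function giving its coefficients.\<close>

type_synonym series = "(nat \<Rightarrow>\<^sub>0 nat) \<Rightarrow> complex"

definition compositions :: "nat list set" where
  "compositions = {\<alpha>. \<forall>a\<in>set \<alpha>. 0 < a}"

text \<open>\<open>monomial is \<alpha>\<close> is \<open>x\<^bsub>is(1)\<^esub>\<^bsup>\<alpha>(1)\<^esup> \<cdots> x\<^bsub>is(l)\<^esub>\<^bsup>\<alpha>(l)\<^esup>\<close>.\<close>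

definition monomial :: "nat list \<Rightarrow> nat list \<Rightarrow> (nat \<Rightarrow>\<^sub>0 nat)" where
  "monomial is \<alpha> = (\<Sum>j<length \<alpha>. Poly_Mapping.single (is ! j) (\<alpha> ! j))"

definition incr_seqs :: "nat \<Rightarrow> nat list set" where
  "incr_seqs l = {is. length is = l \<and> sorted_wrt (<) is}"

definition total_degree :: "(nat \<Rightarrow>\<^sub>0 nat) \<Rightarrow> nat" where
  "total_degree m = (\<Sum>i\<in>Poly_Mapping.keys m. Poly_Mapping.lookup m i)"

definition QSym :: "series set" where
  "QSym = {f. (\<exists>d. \<forall>m. f m \<noteq> 0 \<longrightarrow> total_degree m \<le> d) \<and>
     (\<forall>\<alpha>\<in>compositions. \<forall>is\<in>incr_seqs (length \<alpha>). \<forall>js\<in>incr_seqs (length \<alpha>).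
        f (monomial is \<alpha>) = f (monomial js \<alpha>))}"

definition qsym_mult :: "series \<Rightarrow> series \<Rightarrow> series" where
  "qsym_mult f g = (\<lambda>m. \<Sum>(a, b)\<in>{(a, b). a + b = m}. f a * g b)"

definition qsym_M :: "nat list \<Rightarrow> series" where
  "qsym_M \<alpha> = (\<lambda>m. of_nat (card {is \<in> incr_seqs (length \<alpha>). monomial is \<alpha> = m}))"

definition qsym_comult :: "series \<Rightarrow> ((nat \<Rightarrow>\<^sub>0 nat) \<times> (nat \<Rightarrow>\<^sub>0 nat) \<Rightarrow> complex)" where
  "qsym_comult = lin_ext compositions qsym_M
     (\<lambda>\<alpha>. \<Sum>(\<beta>, \<gamma>)\<in>{(\<beta>, \<gamma>). \<beta> @ \<gamma> = \<alpha>}. qsym_M \<beta> \<otimes>\<^sub>t qsym_M \<gamma>)"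

definition comp_of :: "nat \<Rightarrow> nat set \<Rightarrow> nat list" where
  "comp_of n I = (if n = 0 then [] else
     (let s = sorted_list_of_set I in map2 (-) (s @ [n]) (0 # s)))"

text \<open>\<open>qsym_L n I\<close> is the fundamental quasisymmetric function of \<open>comp_of n I\<close>.\<close>

definition qsym_L :: "nat \<Rightarrow> nat set \<Rightarrow> series" where
  "qsym_L n I = (\<Sum>J\<in>{J. I \<subseteq> J \<and> J \<subseteq> {1..<n}}. qsym_M (comp_of n J))"


section \<open>Characters of finite groups\<close>

definition is_representation ::
  "('a, 'm) monoid_scheme \<Rightarrow> nat \<Rightarrow> ('a \<Rightarrow> complex mat) \<Rightarrow> bool" where
  "is_representation G d \<rho> \<longleftrightarrow>
     (\<forall>g\<in>carrier G. \<rho> g \<in> carrier_mat d d) \<and> \<rho> \<one>\<^bsub>G\<^esub> = 1\<^sub>m d \<and>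
     (\<forall>g\<in>carrier G. \<forall>h\<in>carrier G. \<rho> (g \<otimes>\<^bsub>G\<^esub> h) = \<rho> g * \<rho> h)"

definition invariant_subspace ::
  "('a, 'm) monoid_scheme \<Rightarrow> nat \<Rightarrow> ('a \<Rightarrow> complex mat) \<Rightarrow> complex vec set \<Rightarrow> bool" where
  "invariant_subspace G d \<rho> U \<longleftrightarrow>
     U \<subseteq> carrier_vec d \<and> 0\<^sub>v d \<in> U \<and> (\<forall>u\<in>U. \<forall>v\<in>U. u + v \<in> U) \<and> (\<forall>c. \<forall>u\<in>U. c \<cdot>\<^sub>v u \<in> U) \<and>
     (\<forall>g\<in>carrier G. \<forall>u\<in>U. \<rho> g *\<^sub>v u \<in> U)"

definition is_irreducible ::
  "('a, 'm) monoid_scheme \<Rightarrow> nat \<Rightarrow> ('a \<Rightarrow> complex mat) \<Rightarrow> bool" where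
  "is_irreducible G d \<rho> \<longleftrightarrow> is_representation G d \<rho> \<and> 0 < d \<and>
     (\<forall>U. invariant_subspace G d \<rho> U \<longrightarrow> U = {0\<^sub>v d} \<or> U = carrier_vec d)"

text \<open>Functions on a group are extended by 0 outside its carrier, so that equality of functions
  is equality on the group.\<close>

definition irr_chars :: "('a, 'm) monoid_scheme \<Rightarrow> ('a \<Rightarrow> complex) set" where
  "irr_chars G = {(\<lambda>g. if g \<in> carrier G then \<Sum>i<d. \<rho> g $$ (i, i) else 0) | d \<rho>. is_irreducible G d \<rho>}"

text \<open>The value of the regular character is the number of basis elements of the group algebra
  fixed by left multiplication.\<close>

definition reg_char :: "('a, 'm) monoid_scheme \<Rightarrow> 'a \<Rightarrow> complex" where
  "reg_char G g = of_nat (card {x \<in> carrier G. g \<otimes>\<^bsub>G\<^esub> x = x})"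


section \<open>Supercharacters of the groups \<open>Q\<^sub>n\<close>\<close>

text \<open>\<open>C\<close> is a cyclic group, in the multiplicative notation of \<open>HOL-Algebra\<close>: the condition
  \<open>g\<^sub>i = 0\<close> becomes \<open>g i = \<one>\<^bsub>C\<^esub>\<close>.\<close>

definition Q_group :: "('c, 'm) monoid_scheme \<Rightarrow> nat \<Rightarrow> (nat \<Rightarrow> 'c) monoid" where
  "Q_group C n = sum_group {1..<n} (\<lambda>_. C)"

definition cf :: "('c, 'm) monoid_scheme \<Rightarrow> nat \<Rightarrow> ((nat \<Rightarrow> 'c) \<Rightarrow> complex) set" where
  "cf C n = {\<phi>. \<forall>g. g \<notin> carrier (Q_group C n) \<longrightarrow> \<phi> g = 0}"

definition superclass :: "('c, 'm) monoid_scheme \<Rightarrow> nat \<Rightarrow> nat set \<Rightarrow> (nat \<Rightarrow> 'c) set" where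
  "superclass C n I = {g \<in> carrier (Q_group C n). \<forall>i\<in>{1..<n}. g i \<noteq> \<one>\<^bsub>C\<^esub> \<longleftrightarrow> i \<in> I}"

definition scf :: "('c, 'm) monoid_scheme \<Rightarrow> nat \<Rightarrow> ((nat \<Rightarrow> 'c) \<Rightarrow> complex) set" where
  "scf C n = {\<phi> \<in> cf C n. \<forall>I. I \<subseteq> {1..<n} \<longrightarrow>
     (\<forall>g\<in>superclass C n I. \<forall>h\<in>superclass C n I. \<phi> g = \<phi> h)}"

definition trivial_on_factor ::
  "('c, 'm) monoid_scheme \<Rightarrow> nat \<Rightarrow> nat \<Rightarrow> ((nat \<Rightarrow> 'c) \<Rightarrow> complex) \<Rightarrow> bool" where
  "trivial_on_factor C n i \<chi> \<longleftrightarrow>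
     (\<forall>g\<in>carrier (Q_group C n). (\<forall>j\<in>{1..<n} - {i}. g j = \<one>\<^bsub>C\<^esub>) \<longrightarrow> \<chi> g = 1)"

definition superchar ::
  "('c, 'm) monoid_scheme \<Rightarrow> nat \<Rightarrow> nat set \<Rightarrow> (nat \<Rightarrow> 'c) \<Rightarrow> complex" where
  "superchar C n I =
     (\<Sum>\<chi>\<in>{\<chi> \<in> irr_chars (Q_group C n). \<forall>i\<in>{1..<n}. trivial_on_factor C n i \<chi> \<longleftrightarrow> i \<in> I}. \<chi>)"

definition superchar_dot ::
  "('c, 'm) monoid_scheme \<Rightarrow> nat \<Rightarrow> nat set \<Rightarrow> (nat \<Rightarrow> 'c) \<Rightarrow> complex" where
  "superchar_dot C n I = (\<lambda>g. superchar C n I g / superchar C n I \<one>\<^bsub>Q_group C n\<^esub>)"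

definition rbar :: "('c, 'm) monoid_scheme \<Rightarrow> 'c \<Rightarrow> complex" where
  "rbar C x = (reg_char C x - 1) / (of_nat (order C) - 1)"


section \<open>The graded space and its operations\<close>

text \<open>An element of a direct sum of the \<open>cf C n\<close> is a function \<open>F\<close> on the disjoint union of the
  groups \<open>Q_group C n\<close>, with component \<open>\<lambda>g. F (n, g)\<close> in degree \<open>n\<close>.\<close>

definition component :: "(nat \<times> 'g \<Rightarrow> complex) \<Rightarrow> nat \<Rightarrow> 'g \<Rightarrow> complex" where
  "component F n = (\<lambda>g. F (n, g))"

definition in_degree :: "nat \<Rightarrow> ('g \<Rightarrow> complex) \<Rightarrow> (nat \<times> 'g \<Rightarrow> complex)" where
  "in_degree n \<phi> = (\<lambda>(k, g). if k = n then \<phi> g else 0)"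

definition SCF :: "('c, 'm) monoid_scheme \<Rightarrow> (nat \<times> (nat \<Rightarrow> 'c) \<Rightarrow> complex) set" where
  "SCF C = {F. (\<forall>n. component F n \<in> scf C n) \<and> finite {n. component F n \<noteq> 0}}"

definition edge :: "nat \<Rightarrow> nat set \<Rightarrow> nat set" where
  "edge N A = {i \<in> {1..<N}. i \<in> A \<and> Suc i \<notin> A}"

definition edges :: "nat \<Rightarrow> nat set \<Rightarrow> nat set" where
  "edges N A = edge N A \<union> edge N ({1..N} - A)"

text \<open>\<open>nth_elem A i\<close> is the \<open>i\<close>-th smallest element of \<open>A\<close>, counting from 1.\<close>

definition nth_elem :: "nat set \<Rightarrow> nat \<Rightarrow> nat" where
  "nth_elem A i = sorted_list_of_set A ! (i - 1)"

definition s_op ::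
  "('c, 'm) monoid_scheme \<Rightarrow> nat \<Rightarrow> nat \<Rightarrow> nat set \<Rightarrow> ((nat \<Rightarrow> 'c) \<Rightarrow> complex) \<Rightarrow>
   ((nat \<Rightarrow> 'c) \<Rightarrow> complex) \<Rightarrow> (nat \<Rightarrow> 'c) \<Rightarrow> complex" where
  "s_op C m n A \<phi> \<psi> h =
     (let b = nth_elem ({1..m+n} - A); a = nth_elem A in
      \<phi> (\<lambda>i\<in>{1..<m}. h (b i)) * rbar C (h (b m)) *
      \<psi> (\<lambda>i\<in>{1..<n}. h (a i)) * rbar C (h (a n)))"

definition m_op ::
  "('c, 'm) monoid_scheme \<Rightarrow> nat \<Rightarrow> nat \<Rightarrow> nat set \<Rightarrow> ((nat \<Rightarrow> 'c) \<Rightarrow> complex) \<Rightarrow>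
   ((nat \<Rightarrow> 'c) \<Rightarrow> complex) \<Rightarrow> (nat \<Rightarrow> 'c) \<Rightarrow> complex" where
  "m_op C m n A \<phi> \<psi> g =
     (if g \<notin> carrier (Q_group C (m + n)) then 0
      else if m = 0 then \<phi> \<one>\<^bsub>Q_group C 0\<^esub> * \<psi> g
      else if n = 0 then \<phi> g * \<psi> \<one>\<^bsub>Q_group C 0\<^esub>
      else (\<Prod>i\<in>edge (m + n) ({1..m+n} - A). rbar C (g i)) *
        s_op C m n A \<phi> \<psi>
          (\<lambda>i\<in>{1..m+n}. if i \<in> {1..<m+n} - edges (m + n) A then g i else \<one>\<^bsub>C\<^esub>))"

definition scf_mult ::
  "('c, 'm) monoid_scheme \<Rightarrow> (nat \<times> (nat \<Rightarrow> 'c) \<Rightarrow> complex) \<Rightarrow>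
   (nat \<times> (nat \<Rightarrow> 'c) \<Rightarrow> complex) \<Rightarrow> (nat \<times> (nat \<Rightarrow> 'c) \<Rightarrow> complex)" where
  "scf_mult C F G = (\<lambda>(N, g). \<Sum>(m, n)\<in>{(m, n). m + n = N}.
     \<Sum>A\<in>{A. A \<subseteq> {1..m+n} \<and> card A = n}. m_op C m n A (component F m) (component G n) g)"

text \<open>\<open>delta_op C k l \<phi>\<close>, for \<open>\<phi>\<close> of degree \<open>k + l\<close>, is the component of the coproduct of \<open>\<phi>\<close>
  in degree \<open>(k, l)\<close>, as a function of a pair of group elements.\<close>

definition delta_op ::
  "('c, 'm) monoid_scheme \<Rightarrow> nat \<Rightarrow> nat \<Rightarrow> ((nat \<Rightarrow> 'c) \<Rightarrow> complex) \<Rightarrow>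
   (nat \<Rightarrow> 'c) \<Rightarrow> (nat \<Rightarrow> 'c) \<Rightarrow> complex" where
  "delta_op C k l \<phi> x y =
     (if x \<notin> carrier (Q_group C k) \<or> y \<notin> carrier (Q_group C l) then 0
      else if k = 0 then \<phi> y
      else if l = 0 then \<phi> x
      else \<phi> (\<lambda>i\<in>{1..<k+l}. if i < k then x i else if i = k then \<one>\<^bsub>C\<^esub> else y (i - k)))"

definition scf_comult ::
  "('c, 'm) monoid_scheme \<Rightarrow> (nat \<times> (nat \<Rightarrow> 'c) \<Rightarrow> complex) \<Rightarrow>
   ((nat \<times> (nat \<Rightarrow> 'c)) \<times> (nat \<times> (nat \<Rightarrow> 'c)) \<Rightarrow> complex)" where
  "scf_comult C F = (\<lambda>((k, x), (l, y)). delta_op C k l (component F (k + l)) x y)"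

definition ch :: "('c, 'm) monoid_scheme \<Rightarrow> (nat \<times> (nat \<Rightarrow> 'c) \<Rightarrow> complex) \<Rightarrow> series" where
  "ch C = lin_ext {(n, I). I \<subseteq> {1..<n}}
     (\<lambda>(n, I). in_degree n (superchar_dot C n I)) (\<lambda>(n, I). qsym_L n I)"

end

theory Submission
  imports Defs "HOL-Library.Multiset" "HOL-Algebra.Multiplicative_Group"
    "Jordan_Normal_Form.Spectral_Radius"
begin

text \<open>
  The normalised supercharacter \<open>\<chi>\<^sup>I\<close> of \<open>Q\<^sub>n\<close> is the product of \<open>rbar (g i)\<close> over the
  positions \<open>i\<close> outside \<open>I\<close> (\<open>superchar_dot_eq\<close>), and \<open>rbar\<close> is 1 at the identity.  Both operations
  therefore send these functions to sums of functions of the same kind.  Inserting an identity element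
  between two blocks of coordinates splits the product in two, which gives the coproduct
  \<open>\<Sum>k. \<chi>\<^bsup>I \<inter> [k-1]\<^esup> \<otimes> \<chi>\<^bsup>I - k\<^esup>\<close> (\<open>scf_comult_superchar\<close>).  The summand of the product that belongs to the
  set of positions \<open>A\<close> is \<open>\<chi>\<^sup>K\<close>, where \<open>K\<close> is the descent set of the shuffle that places a word with
  descent set \<open>J\<close> in the positions \<open>A\<close> and a word of smaller letters with descent set \<open>I\<close> in the
  others (\<open>m_op_superchar\<close>).  These are the rules for the fundamental quasisymmetric functions
  \<open>L\<^sub>I\<close> (\<open>qsym_L_mult\<close>, \<open>qsym_L_comult\<close>), so the map \<open>\<chi>\<^sup>I \<mapsto> L\<^sub>I\<close> respects product and coproduct.  It maps a
  basis to a basis, hence is bijective, and the unit, counit and antipode of the quasisymmetric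
  functions can be carried back along it (\<open>hopf_transport\<close>).  This yields both parts at once.

  It remains to see three things.

  First, the quasisymmetric functions form a Hopf algebra.  The value of such a function at a monomial
  depends only on the sequence of nonzero exponents of the monomial.  In these terms the coproduct
  evaluates \<open>f\<close> at the concatenation of two sequences (\<open>qsym_comult_eq\<close>), which makes coassociativity
  the associativity of concatenation.  A factorisation of a monomial is a way of writing its
  exponents as sums of two rows, and a row over a concatenation is a pair of rows; this gives
  compatibility with the product (\<open>qsym_comult_mult\<close>).  The antipode is found by recursion on the length
  of a composition: one recursion produces a left and another a right convolution inverse of the
  identity, and these agree (\<open>left_antipode_eq_right\<close>).

  Second, the product rule for the \<open>L\<^sub>I\<close>.  A monomial is a weakly increasing word \<open>w\<close>, and \<open>L\<^sub>I\<close> is the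
  sum of those of length \<open>n\<close> that increase strictly at the positions in \<open>I\<close> (\<open>qsym_L_word\<close>).  A
  factorisation of \<open>w\<close> is a two-colouring of its letters up to permuting equal letters, and
  putting equal letters of the first colour first selects one colouring
  (\<open>bij_betw_colourings\<close>).  The two factors increase at \<open>I\<close> and \<open>J\<close> exactly if \<open>w\<close> increases at the
  descents of the corresponding shuffle (\<open>shuffle_descents_ascents\<close>).

  Third, the supercharacters.  Irreducible characters of an abelian group are one-dimensional
  (\<open>irr_chars_comm_group\<close>), those of a direct sum are products of characters of the summands
  (\<open>bij_betw_prod_char\<close>), and the nontrivial characters of a cyclic group add up to the regular
  character minus 1 (\<open>sum_cyclic_chars\<close>).  That the \<open>\<chi>\<^sup>I\<close> form a basis (\<open>indep_superchar\<close>,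
  \<open>span_superchar\<close>) follows since \<open>rbar\<close> takes one value at the identity and a different one elsewhere,
  so that the indicator of the identity is affine in \<open>rbar\<close>.
\<close>

text \<open>The name \<open>order\<close> denotes the order of a group here, not that of a root of a polynomial.\<close>

hide_const (open) Polynomial.order

section \<open>Linear maps given on a basis\<close>

lemma linear_on_subset: "linear_on V f \<Longrightarrow> W \<subseteq> V \<Longrightarrow> linear_on W f"
  unfolding linear_on_def by (simp add: subset_iff)

lemma linear_on_id: "linear_on V (\<lambda>v. v)" "linear_on V id"
  by (simp_all add: linear_on_def)

lemma linear_on_comp:
  assumes "linear_on V f" "linear_on W g" "\<And>v. v \<in> V \<Longrightarrow> f v \<in> W"
  shows "linear_on V (\<lambda>v. g (f v))"
  using assms unfolding linear_on_def by simp

lemma linear_on_zero: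
  assumes "linear_on V f" "0 \<in> V"
  shows "f 0 = 0"
proof -
  have "f (fscale 0 0) = fscale 0 (f 0)" using assms unfolding linear_on_def by blast
  then show ?thesis by (simp only: fs.scale_zero_left)
qed

lemma linear_on_span_eqI:
  assumes "linear_on (fs.span B) f" "linear_on (fs.span B) g" "\<And>b. b \<in> B \<Longrightarrow> f b = g b"
    and "v \<in> fs.span B"
  shows "f v = g v"
proof -
  have "v \<in> fs.span B \<and> f v = g v"
    using assms(4)
  proof (induction rule: fs.span_induct_alt)
    case base
    show ?case
      by (simp only: linear_on_zero[OF assms(1) fs.span_zero] linear_on_zero[OF assms(2) fs.span_zero]
          fs.span_zero simp_thms)
  next
    case (step c x y)
    have x: "x \<in> fs.span B" using step fs.span_base by blast
    then have cx: "fscale c x \<in> fs.span B" by (rule fs.span_scale)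
    have "f (fscale c x + y) = fscale c (f x) + f y" "g (fscale c x + y) = fscale c (g x) + g y"
      using assms(1,2) x cx step unfolding linear_on_def by simp_all
    moreover have "fscale c x + y \<in> fs.span B" using cx step by (intro fs.span_add) auto
    ultimately show ?case using step assms(3) by metis
  qed
  then show ?thesis ..
qed

lemma linear_on_span_closed:
  assumes "linear_on (fs.span B) f" "fs.subspace W" "\<And>b. b \<in> B \<Longrightarrow> f b \<in> W" "v \<in> fs.span B"
  shows "f v \<in> W"
proof -
  have "v \<in> fs.span B \<and> f v \<in> W"
    using assms(4)
  proof (induction rule: fs.span_induct_alt)
    case base
    show ?case
      by (simp only: linear_on_zero[OF assms(1) fs.span_zero] fs.span_zero fs.subspace_0[OF assms(2)]
          simp_thms)
  next
    case (step c x y)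
    have x: "x \<in> fs.span B" using step fs.span_base by blast
    then have cx: "fscale c x \<in> fs.span B" by (rule fs.span_scale)
    have "f (fscale c x + y) = fscale c (f x) + f y"
      using assms(1) x cx step unfolding linear_on_def by simp
    moreover have "fscale c (f x) + f y \<in> W"
      by (rule fs.subspace_add[OF assms(2) fs.subspace_scale[OF assms(2) assms(3)]]) (use step in auto)
    moreover have "fscale c x + y \<in> fs.span B" using cx step by (intro fs.span_add) auto
    ultimately show ?case by metis
  qed
  then show ?thesis ..
qed

text \<open>Independence of an indexed family, repetitions counting as relations: this is the condition
  under which \<open>lin_ext\<close> is well defined for arbitrary prescribed values.\<close>

definition indep_family :: "'k set \<Rightarrow> ('k \<Rightarrow> 'x \<Rightarrow> complex) \<Rightarrow> bool" where
  "indep_family K b \<longleftrightarrow> (\<forall>S c. finite S \<longrightarrow> S \<subseteq> K \<longrightarrow>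
     (\<Sum>k\<in>S. fscale (c k) (b k)) = 0 \<longrightarrow> (\<forall>k\<in>S. c k = 0))"

lemma sum_extend_zero:
  assumes "S \<subseteq> T" "finite T"
  shows "(\<Sum>k\<in>S. fscale (c k) (b k)) = (\<Sum>k\<in>T. fscale (if k \<in> S then c k else 0) (b k))"
  using assms by (intro sum.mono_neutral_cong_left) auto

lemma span_family:
  assumes "v \<in> fs.span (b ` K)"
  obtains S c where "finite S" "S \<subseteq> K" "v = (\<Sum>k\<in>S. fscale (c k) (b k))"
proof -
  obtain T r where T: "finite T" "T \<subseteq> b ` K" "v = (\<Sum>a\<in>T. fscale (r a) a)"
    using assms unfolding fs.span_explicit mem_Collect_eq by (elim exE conjE)
  from T(2)[unfolded subset_image_inj] obtain S where S: "S \<subseteq> K" "inj_on b S" "T = b ` S"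
    by (elim exE conjE)
  have v: "v = (\<Sum>k\<in>S. fscale (r (b k)) (b k))"
    unfolding T(3) S(3) sum.reindex[OF S(2)] comp_def ..
  have "finite S" by (rule finite_imageD[OF T(1)[unfolded S(3)] S(2)])
  then show thesis using S(1) v by (rule that)
qed

lemma indep_family_unique:
  assumes K: "indep_family K b" and S: "finite S" "S \<subseteq> K" and T: "finite T" "T \<subseteq> K"
    and eq: "(\<Sum>k\<in>S. fscale (c k) (b k)) = (\<Sum>k\<in>T. fscale (d k) (b k))"
  shows "(\<Sum>k\<in>S. fscale (c k) (w k)) = (\<Sum>k\<in>T. fscale (d k) (w k))"
proof -
  define U where "U = S \<union> T"
  have U: "finite U" "U \<subseteq> K" "S \<subseteq> U" "T \<subseteq> U" using S T by (auto simp: U_def)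
  define c' where "c' k = (if k \<in> S then c k else 0)" for k
  define d' where "d' k = (if k \<in> T then d k else 0)" for k
  have "(\<Sum>k\<in>U. fscale (c' k - d' k) (b k)) = 0"
    using eq unfolding sum_extend_zero[OF U(3,1)] sum_extend_zero[OF U(4,1)] c'_def d'_def
    by (simp add: fs.scale_left_diff_distrib sum_subtractf)
  then have "\<forall>k\<in>U. c' k - d' k = 0" by (rule K[unfolded indep_family_def, THEN spec, THEN spec, THEN mp, THEN mp, THEN mp, OF U(1,2)])
  then have "(\<Sum>k\<in>U. fscale (c' k) (w k)) = (\<Sum>k\<in>U. fscale (d' k) (w k))" by (intro sum.cong) auto
  then show ?thesis
    unfolding sum_extend_zero[OF U(3,1)] sum_extend_zero[OF U(4,1)] c'_def d'_def .
qed

lemma lin_ext_eq: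
  assumes "indep_family K b" "finite S" "S \<subseteq> K"
  shows "lin_ext K b w (\<Sum>k\<in>S. fscale (c k) (b k)) = (\<Sum>k\<in>S. fscale (c k) (w k))"
  unfolding lin_ext_def
proof (rule the_equality, goal_cases)
  case 1
  show ?case by (intro exI[of _ S] exI[of _ c] conjI assms refl)
next
  case (2 u)
  then obtain T d where T: "finite T" "T \<subseteq> K"
      "(\<Sum>k\<in>S. fscale (c k) (b k)) = (\<Sum>k\<in>T. fscale (d k) (b k))"
      "u = (\<Sum>k\<in>T. fscale (d k) (w k))"
    by (elim exE conjE)
  show ?case unfolding T(4) by (rule indep_family_unique[OF assms T(1,2,3), symmetric])
qed

lemma lin_ext_basis:
  assumes "indep_family K b" "k \<in> K"
  shows "lin_ext K b w (b k) = w k"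
  using lin_ext_eq[OF assms(1), of "{k}" w "\<lambda>_. 1"] assms(2) by simp

lemma lin_ext_linear:
  assumes K: "indep_family K b"
  shows "linear_on (fs.span (b ` K)) (lin_ext K b w)"
  unfolding linear_on_def
proof (intro conjI ballI allI)
  fix u v assume "u \<in> fs.span (b ` K)" "v \<in> fs.span (b ` K)"
  obtain S c where S: "finite S" "S \<subseteq> K" "u = (\<Sum>k\<in>S. fscale (c k) (b k))"
    by (rule span_family[OF \<open>u \<in> _\<close>])
  obtain T d where T: "finite T" "T \<subseteq> K" "v = (\<Sum>k\<in>T. fscale (d k) (b k))"
    by (rule span_family[OF \<open>v \<in> _\<close>])
  define U where "U = S \<union> T"
  have U: "finite U" "U \<subseteq> K" "S \<subseteq> U" "T \<subseteq> U" using S T by (auto simp: U_def)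
  note u = S(3)[unfolded sum_extend_zero[OF U(3,1)]]
  note v = T(3)[unfolded sum_extend_zero[OF U(4,1)]]
  have uv: "u + v = (\<Sum>k\<in>U. fscale ((if k \<in> S then c k else 0) + (if k \<in> T then d k else 0)) (b k))"
    unfolding u v by (simp only: sum.distrib fs.scale_left_distrib)
  show "lin_ext K b w (u + v) = lin_ext K b w u + lin_ext K b w v"
    unfolding uv lin_ext_eq[OF K U(1,2)]
    unfolding u v lin_ext_eq[OF K U(1,2)] by (simp only: sum.distrib fs.scale_left_distrib)
next
  fix v r assume "v \<in> fs.span (b ` K)"
  then obtain S c where S: "finite S" "S \<subseteq> K" "v = (\<Sum>k\<in>S. fscale (c k) (b k))"
    by (rule span_family)
  have rv: "fscale r v = (\<Sum>k\<in>S. fscale (r * c k) (b k))"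
    unfolding S(3) by (simp add: fs.scale_sum_right)
  show "lin_ext K b w (fscale r v) = fscale r (lin_ext K b w v)"
    unfolding rv lin_ext_eq[OF K S(1,2)]
    unfolding S(3) lin_ext_eq[OF K S(1,2)] by (simp add: fs.scale_sum_right)
qed

text \<open>The linear extensions in both directions are mutually inverse because they are so on the
  two bases.\<close>

lemma lin_ext_bij:
  assumes b: "indep_family K b" and w: "indep_family K w"
  shows "bij_betw (lin_ext K b w) (fs.span (b ` K)) (fs.span (w ` K))"
proof -
  have closed: "lin_ext K b' w' v \<in> fs.span (w' ` K)"
    if "indep_family K b'" "v \<in> fs.span (b' ` K)"
    for b' :: "_ \<Rightarrow> 'y1 \<Rightarrow> complex" and w' :: "_ \<Rightarrow> 'y2 \<Rightarrow> complex" and v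
    by (rule linear_on_span_closed[OF lin_ext_linear[OF that(1)] fs.subspace_span _ that(2)])
      (auto simp: lin_ext_basis[OF that(1)] intro: fs.span_base)
  have inverse: "lin_ext K w' b' (lin_ext K b' w' v) = v"
    if "indep_family K b'" "indep_family K w'" "v \<in> fs.span (b' ` K)"
    for b' :: "_ \<Rightarrow> 'y1 \<Rightarrow> complex" and w' :: "_ \<Rightarrow> 'y2 \<Rightarrow> complex" and v
  proof (rule linear_on_span_eqI[OF _ linear_on_id(1) _ that(3)])
    show "linear_on (fs.span (b' ` K)) (\<lambda>v. lin_ext K w' b' (lin_ext K b' w' v))"
      by (rule linear_on_comp[OF lin_ext_linear[OF that(1)] lin_ext_linear[OF that(2)] closed[OF that(1)]])
  qed (auto simp: lin_ext_basis[OF that(1)] lin_ext_basis[OF that(2)])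
  show ?thesis
    by (rule bij_betw_byWitness[where f' = "lin_ext K w b"])
      (auto simp: inverse b w intro: closed)
qed

section \<open>Maps between tensor products\<close>

lemma subspace_tensor: "fs.subspace (tensor V W)"
  unfolding tensor_def by (rule fs.subspace_span)

lemma pure_in_tensor: "v \<in> V \<Longrightarrow> w \<in> W \<Longrightarrow> v \<otimes>\<^sub>t w \<in> tensor V W"
  unfolding tensor_def by (rule fs.span_base) blast

lemma tensor_eqI:
  assumes "t \<in> tensor V W" "linear_on (tensor V W) f" "linear_on (tensor V W) g"
    and "\<And>v w. v \<in> V \<Longrightarrow> w \<in> W \<Longrightarrow> f (v \<otimes>\<^sub>t w) = g (v \<otimes>\<^sub>t w)"
  shows "f t = g t"
  by (rule linear_on_span_eqI[OF assms(2,3)[unfolded tensor_def] _ assms(1)[unfolded tensor_def]])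
    (clarify, rule assms(4))

lemma tensor_closedI:
  assumes "t \<in> tensor V W" "linear_on (tensor V W) f" "fs.subspace U"
    and "\<And>v w. v \<in> V \<Longrightarrow> w \<in> W \<Longrightarrow> f (v \<otimes>\<^sub>t w) \<in> U"
  shows "f t \<in> U"
  by (rule linear_on_span_closed[OF assms(2)[unfolded tensor_def] assms(3) _ assms(1)[unfolded tensor_def]])
    (clarify, rule assms(4))

lemma linear_on_pure: "linear_on V f \<Longrightarrow> linear_on V (\<lambda>v. f v \<otimes>\<^sub>t w)" "linear_on V f \<Longrightarrow> linear_on V (\<lambda>v. w' \<otimes>\<^sub>t f v)"
  unfolding linear_on_def pure_def fscale_def fun_eq_iff by (simp_all add: algebra_simps)

lemma bilinear_on_pure:
  assumes "linear_on V f" "linear_on W g"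
  shows "bilinear_on V W (\<lambda>v w. f v \<otimes>\<^sub>t g w)"
  unfolding bilinear_on_def using assms by (auto intro: linear_on_pure)

lemma tensor_map_linear:
  assumes "fs.subspace V" "fs.subspace W" "linear_on V f" "linear_on W g"
  shows "linear_on (tensor V W) (tensor_map V W f g)"
  unfolding tensor_map_def
  by (rule tensor_lift_universal(1)[OF assms(1,2) bilinear_on_pure[OF assms(3,4)]])

lemma tensor_map_pure:
  assumes "fs.subspace V" "fs.subspace W" "linear_on V f" "linear_on W g" "v \<in> V" "w \<in> W"
  shows "tensor_map V W f g (v \<otimes>\<^sub>t w) = f v \<otimes>\<^sub>t g w"
  unfolding tensor_map_def
  by (rule tensor_lift_universal(2)[OF assms(1,2) bilinear_on_pure[OF assms(3,4)] assms(5,6)])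

lemma tensor_map_closed:
  assumes "fs.subspace V" "fs.subspace W" "linear_on V f" "linear_on W g"
    and "\<And>v. v \<in> V \<Longrightarrow> f v \<in> V'" "\<And>w. w \<in> W \<Longrightarrow> g w \<in> W'" "t \<in> tensor V W"
  shows "tensor_map V W f g t \<in> tensor V' W'"
  using assms(7) tensor_map_linear[OF assms(1-4)] subspace_tensor
  by (rule tensor_closedI) (simp add: tensor_map_pure[OF assms(1-4)] pure_in_tensor assms(5,6))

text \<open>Both sides are linear in the tensor, so it is enough to compare them on pure tensors.\<close>

lemma tensor_lift_map:
  assumes V: "fs.subspace V" and W: "fs.subspace W" and f: "linear_on V f" and g: "linear_on W g"
    and V': "fs.subspace V'" and W': "fs.subspace W'" and B: "bilinear_on V' W' B"
    and "\<And>v. v \<in> V \<Longrightarrow> f v \<in> V'" "\<And>w. w \<in> W \<Longrightarrow> g w \<in> W'" "t \<in> tensor V W"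
  shows "tensor_lift V' W' B (tensor_map V W f g t) = tensor_lift V W (\<lambda>v w. B (f v) (g w)) t"
proof (rule tensor_eqI[OF assms(10)])
  have B': "bilinear_on V W (\<lambda>v w. B (f v) (g w))"
    unfolding bilinear_on_def
  proof (intro conjI ballI)
    show "linear_on W (\<lambda>w. B (f v) (g w))" if "v \<in> V" for v
      using B that assms(8,9) unfolding bilinear_on_def by (intro linear_on_comp[OF g]) auto
    show "linear_on V (\<lambda>v. B (f v) (g w))" if "w \<in> W" for w
      using B that assms(8,9) unfolding bilinear_on_def
      by (intro linear_on_comp[OF f, of V' "\<lambda>v. B v (g w)"]) auto
  qed
  show "linear_on (tensor V W) (tensor_lift V W (\<lambda>v w. B (f v) (g w)))"
    by (rule tensor_lift_universal(1)[OF V W B'])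
  show "linear_on (tensor V W) (\<lambda>t. tensor_lift V' W' B (tensor_map V W f g t))"
    by (rule linear_on_comp[OF tensor_map_linear[OF V W f g] tensor_lift_universal(1)[OF V' W' B]])
      (rule tensor_map_closed[OF V W f g assms(8,9)])
  show "tensor_lift V' W' B (tensor_map V W f g (v \<otimes>\<^sub>t w)) =
      tensor_lift V W (\<lambda>v w. B (f v) (g w)) (v \<otimes>\<^sub>t w)" if "v \<in> V" "w \<in> W" for v w
    using that assms(8,9) by (simp add: tensor_map_pure[OF V W f g]
        tensor_lift_universal(2)[OF V' W' B] tensor_lift_universal(2)[OF V W B'])
qed

lemma tensor_map_comp:
  assumes "fs.subspace V" "fs.subspace W" "linear_on V f" "linear_on W g"
    and "fs.subspace V'" "fs.subspace W'" "linear_on V' f'" "linear_on W' g'"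
    and "\<And>v. v \<in> V \<Longrightarrow> f v \<in> V'" "\<And>w. w \<in> W \<Longrightarrow> g w \<in> W'" "t \<in> tensor V W"
  shows "tensor_map V' W' f' g' (tensor_map V W f g t)
       = tensor_map V W (\<lambda>v. f' (f v)) (\<lambda>w. g' (g w)) t"
  using tensor_lift_map[OF assms(1-6) bilinear_on_pure[OF assms(7,8)] assms(9-11)]
  by (simp add: tensor_map_def)

lemma linear_tensor_lift:
  assumes V: "fs.subspace V" and W: "fs.subspace W" and B: "bilinear_on V W B"
    and "\<And>v w. v \<in> V \<Longrightarrow> w \<in> W \<Longrightarrow> B v w \<in> U" "linear_on U h" "fs.subspace U" "t \<in> tensor V W"
  shows "h (tensor_lift V W B t) = tensor_lift V W (\<lambda>v w. h (B v w)) t"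
proof (rule tensor_eqI[OF assms(7)])
  have B': "bilinear_on V W (\<lambda>v w. h (B v w))"
    using B assms(4) unfolding bilinear_on_def
    by (auto intro!: linear_on_comp[OF _ assms(5)])
  show "linear_on (tensor V W) (tensor_lift V W (\<lambda>v w. h (B v w)))"
    by (rule tensor_lift_universal(1)[OF V W B'])
  show "linear_on (tensor V W) (\<lambda>t. h (tensor_lift V W B t))"
  proof (rule linear_on_comp[OF tensor_lift_universal(1)[OF V W B] assms(5)])
    show "tensor_lift V W B t \<in> U" if "t \<in> tensor V W" for t
      using that tensor_lift_universal(1)[OF V W B] assms(6)
      by (rule tensor_closedI) (simp add: tensor_lift_universal(2)[OF V W B] assms(4))
  qed
  show "h (tensor_lift V W B (v \<otimes>\<^sub>t w)) = tensor_lift V W (\<lambda>v w. h (B v w)) (v \<otimes>\<^sub>t w)"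
    if "v \<in> V" "w \<in> W" for v w
    using that by (simp add: tensor_lift_universal(2)[OF V W B] tensor_lift_universal(2)[OF V W B'])
qed

lemma tensor_map_id:
  assumes "fs.subspace V" "fs.subspace W" "\<And>v. v \<in> V \<Longrightarrow> f v = v" "\<And>w. w \<in> W \<Longrightarrow> g w = w"
    and "t \<in> tensor V W"
  shows "tensor_map V W f g t = t"
proof (rule tensor_eqI[OF assms(5) _ linear_on_id(1)])
  have f: "linear_on V f" and g: "linear_on W g"
    using assms(1-4) unfolding linear_on_def by (metis fs.subspace_add fs.subspace_scale)+
  show "linear_on (tensor V W) (tensor_map V W f g)"
    by (rule tensor_map_linear[OF assms(1,2) f g])
  show "tensor_map V W f g (v \<otimes>\<^sub>t w) = v \<otimes>\<^sub>t w" if "v \<in> V" "w \<in> W" for v w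
    using that assms(3,4) by (simp add: tensor_map_pure[OF assms(1,2) f g])
qed

section \<open>Products on tensor squares\<close>

lemma linear_on_add:
  assumes "linear_on V f" "linear_on V g"
  shows "linear_on V (\<lambda>v. f v + g v)"
  using assms unfolding linear_on_def by (simp add: fs.scale_right_distrib del: plus_fun_apply)

lemma linear_on_scale:
  assumes "linear_on V f"
  shows "linear_on V (\<lambda>v. fscale c (f v))"
  using assms unfolding linear_on_def
  by (simp add: fs.scale_right_distrib mult.commute del: plus_fun_apply)

lemma pure_add:
  "(u + u') \<otimes>\<^sub>t v = u \<otimes>\<^sub>t v + u' \<otimes>\<^sub>t v" "u \<otimes>\<^sub>t (v + v') = u \<otimes>\<^sub>t v + u \<otimes>\<^sub>t v'"
  and pure_scale: "fscale r u \<otimes>\<^sub>t v = fscale r (u \<otimes>\<^sub>t v)" "u \<otimes>\<^sub>t fscale r v = fscale r (u \<otimes>\<^sub>t v)"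
  unfolding pure_def fscale_def by (auto simp: fun_eq_iff algebra_simps)

text \<open>The inner lift in the definition of \<open>tensor_mul\<close> depends bilinearly on the pair of
  outer arguments; without this the outer lift would have no meaning.\<close>

lemma tensor_mul_bilinear:
  assumes V: "fs.subspace V" and mul: "bilinear_on V V mul" and t: "t \<in> tensor V V"
  shows "bilinear_on V V (\<lambda>a b. tensor_lift V V (\<lambda>c d. mul a c \<otimes>\<^sub>t mul b d) t)"
proof -
  have lin1: "linear_on V (mul a)" if "a \<in> V" for a
    using mul that by (simp add: bilinear_on_def)
  have add: "mul (a + a') c = mul a c + mul a' c" and scale: "mul (fscale r a) c = fscale r (mul a c)"
    if "a \<in> V" "a' \<in> V" "c \<in> V" for a a' c r
    using mul that unfolding bilinear_on_def linear_on_def by blast+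
  have B: "bilinear_on V V (\<lambda>c d. mul a c \<otimes>\<^sub>t mul b d)" if "a \<in> V" "b \<in> V" for a b
    by (rule bilinear_on_pure[OF lin1[OF that(1)] lin1[OF that(2)]])
  note lift = tensor_lift_universal[OF V V B]
  show ?thesis
    unfolding bilinear_on_def linear_on_def
  proof (intro conjI ballI allI)
    fix a b b' assume ab: "a \<in> V" "b \<in> V" "b' \<in> V"
    have bb: "b + b' \<in> V" using ab V by (simp only: fs.subspace_add)
    show "tensor_lift V V (\<lambda>c d. mul a c \<otimes>\<^sub>t mul (b + b') d) t
        = tensor_lift V V (\<lambda>c d. mul a c \<otimes>\<^sub>t mul b d) t + tensor_lift V V (\<lambda>c d. mul a c \<otimes>\<^sub>t mul b' d) t"
      by (rule tensor_eqI[OF t lift(1)[OF ab(1) bb] linear_on_add[OF lift(1)[OF ab(1,2)] lift(1)[OF ab(1,3)]]])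
        (simp only: lift(2)[OF ab(1) bb] lift(2)[OF ab(1,2)] lift(2)[OF ab(1,3)] add[OF ab(2,3)] pure_add)
  next
    fix a b r assume ab: "a \<in> V" "b \<in> V"
    have rb: "fscale r b \<in> V" using ab V by (simp only: fs.subspace_scale)
    show "tensor_lift V V (\<lambda>c d. mul a c \<otimes>\<^sub>t mul (fscale r b) d) t
        = fscale r (tensor_lift V V (\<lambda>c d. mul a c \<otimes>\<^sub>t mul b d) t)"
      by (rule tensor_eqI[OF t lift(1)[OF ab(1) rb] linear_on_scale[OF lift(1)[OF ab]]])
        (simp only: lift(2)[OF ab(1) rb] lift(2)[OF ab] scale[OF ab(2,2)] pure_scale)
  next
    fix b a a' assume ab: "b \<in> V" "a \<in> V" "a' \<in> V"
    have aa: "a + a' \<in> V" using ab V by (simp only: fs.subspace_add)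
    show "tensor_lift V V (\<lambda>c d. mul (a + a') c \<otimes>\<^sub>t mul b d) t
        = tensor_lift V V (\<lambda>c d. mul a c \<otimes>\<^sub>t mul b d) t + tensor_lift V V (\<lambda>c d. mul a' c \<otimes>\<^sub>t mul b d) t"
      by (rule tensor_eqI[OF t lift(1)[OF aa ab(1)] linear_on_add[OF lift(1)[OF ab(2,1)] lift(1)[OF ab(3,1)]]])
        (simp only: lift(2)[OF aa ab(1)] lift(2)[OF ab(2,1)] lift(2)[OF ab(3,1)] add[OF ab(2,3)] pure_add)
  next
    fix b a r assume ab: "b \<in> V" "a \<in> V"
    have ra: "fscale r a \<in> V" using ab V by (simp only: fs.subspace_scale)
    show "tensor_lift V V (\<lambda>c d. mul (fscale r a) c \<otimes>\<^sub>t mul b d) t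
        = fscale r (tensor_lift V V (\<lambda>c d. mul a c \<otimes>\<^sub>t mul b d) t)"
      by (rule tensor_eqI[OF t lift(1)[OF ra ab(1)] linear_on_scale[OF lift(1)[OF ab(2,1)]]])
        (simp only: lift(2)[OF ra ab(1)] lift(2)[OF ab(2,1)] scale[OF ab(2,2)] pure_scale)
  qed
qed

text \<open>The product of the tensor square is the only bilinear map with the right values on pairs
  of pure tensors; composing with \<open>h\<close> lets this identify images of products as well.\<close>

lemma tensor_mul_unique:
  assumes V: "fs.subspace V" and mul: "bilinear_on V V mul"
    and closed: "\<And>a b. a \<in> V \<Longrightarrow> b \<in> V \<Longrightarrow> mul a b \<in> V"
    and s: "s \<in> tensor V V" and t: "t \<in> tensor V V"
    and P1: "linear_on (tensor V V) (\<lambda>s. P s t)"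
    and P2: "\<And>a b. a \<in> V \<Longrightarrow> b \<in> V \<Longrightarrow> linear_on (tensor V V) (P (a \<otimes>\<^sub>t b))"
    and P: "\<And>a b c d. \<lbrakk>a \<in> V; b \<in> V; c \<in> V; d \<in> V\<rbrakk> \<Longrightarrow>
      P (a \<otimes>\<^sub>t b) (c \<otimes>\<^sub>t d) = h (mul a c \<otimes>\<^sub>t mul b d)"
    and h: "linear_on (tensor V V) h"
  shows "h (tensor_mul V mul s t) = P s t"
proof -
  let ?in = "\<lambda>a b. tensor_lift V V (\<lambda>c d. mul a c \<otimes>\<^sub>t mul b d)"
  have lin1: "linear_on V (mul a)" if "a \<in> V" for a
    using mul that by (simp add: bilinear_on_def)
  have B: "bilinear_on V V (\<lambda>c d. mul a c \<otimes>\<^sub>t mul b d)" if "a \<in> V" "b \<in> V" for a b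
    by (rule bilinear_on_pure[OF lin1[OF that(1)] lin1[OF that(2)]])
  note lift = tensor_lift_universal[OF V V B]
  note bil = tensor_mul_bilinear[OF V mul t]
  have inner_closed: "?in a b t \<in> tensor V V" if "a \<in> V" "b \<in> V" for a b
    by (rule tensor_closedI[OF t lift(1)[OF that] subspace_tensor])
      (simp only: lift(2)[OF that] pure_in_tensor closed that)
  have inner: "h (?in a b t) = P (a \<otimes>\<^sub>t b) t" if ab: "a \<in> V" "b \<in> V" for a b
  proof (rule tensor_eqI[OF t _ P2[OF ab]])
    show "linear_on (tensor V V) (\<lambda>t. h (?in a b t))"
      by (rule linear_on_comp[OF lift(1)[OF ab] h], rule tensor_closedI[OF _ lift(1)[OF ab] subspace_tensor])
        (simp_all only: lift(2)[OF ab] pure_in_tensor closed ab)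
  qed (simp only: lift(2)[OF ab] P ab)
  have "h (tensor_mul V mul s t) = tensor_lift V V (\<lambda>a b. h (?in a b t)) s"
    unfolding tensor_mul_def
    by (rule linear_tensor_lift[OF V V bil inner_closed h subspace_tensor s])
  also have "\<dots> = P s t"
  proof (rule tensor_eqI[OF s _ P1])
    have "bilinear_on V V (\<lambda>a b. h (?in a b t))"
      using bil inner_closed unfolding bilinear_on_def by (auto intro!: linear_on_comp[OF _ h])
    note lift' = tensor_lift_universal[OF V V this]
    show "linear_on (tensor V V) (tensor_lift V V (\<lambda>a b. h (?in a b t)))"
      by (rule lift'(1))
    show "tensor_lift V V (\<lambda>a b. h (?in a b t)) (v \<otimes>\<^sub>t w) = P (v \<otimes>\<^sub>t w) t" if "v \<in> V" "w \<in> V" for v w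
      using lift'(2)[OF that] inner[OF that] by simp
  qed
  finally show ?thesis .
qed

lemma tensor_mul_pure:
  assumes V: "fs.subspace V" and mul: "bilinear_on V V mul"
    and ab: "a \<in> V" "b \<in> V" and t: "t \<in> tensor V V"
  shows "tensor_mul V mul (a \<otimes>\<^sub>t b) t = tensor_lift V V (\<lambda>c d. mul a c \<otimes>\<^sub>t mul b d) t"
  unfolding tensor_mul_def
  by (rule tensor_lift_universal(2)[OF V V tensor_mul_bilinear[OF V mul t] ab])

lemma tensor_mul_closed:
  assumes V: "fs.subspace V" and mul: "bilinear_on V V mul"
    and closed: "\<And>a b. a \<in> V \<Longrightarrow> b \<in> V \<Longrightarrow> mul a b \<in> V"
    and s: "s \<in> tensor V V" and t: "t \<in> tensor V V"
  shows "tensor_mul V mul s t \<in> tensor V V"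
proof -
  have B: "bilinear_on V V (\<lambda>c d. mul a c \<otimes>\<^sub>t mul b d)" if "a \<in> V" "b \<in> V" for a b
    using mul that by (intro bilinear_on_pure) (simp_all add: bilinear_on_def)
  note lift = tensor_lift_universal[OF V V B]
  have lin: "linear_on (tensor V V) (\<lambda>s. tensor_mul V mul s t)"
    unfolding tensor_mul_def
    by (rule tensor_lift_universal(1)[OF V V tensor_mul_bilinear[OF V mul t]])
  show ?thesis
  proof (rule tensor_closedI[OF s lin subspace_tensor])
    fix a b assume ab: "a \<in> V" "b \<in> V"
    show "tensor_mul V mul (a \<otimes>\<^sub>t b) t \<in> tensor V V"
      unfolding tensor_mul_pure[OF V mul ab t]
      by (rule tensor_closedI[OF t lift(1)[OF ab] subspace_tensor])
        (simp only: lift(2)[OF ab] pure_in_tensor closed ab)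
  qed
qed

section \<open>Reassociating tensor products\<close>

lemma linear_on_reassoc: "linear_on V reassoc"
  unfolding linear_on_def reassoc_def fscale_def by (auto simp: fun_eq_iff)

lemma reassoc_pure: "reassoc ((a \<otimes>\<^sub>t b) \<otimes>\<^sub>t c) = a \<otimes>\<^sub>t (b \<otimes>\<^sub>t c)"
  by (auto simp: reassoc_def pure_def fun_eq_iff mult.assoc)

lemma linear_on_cong:
  assumes "fs.subspace V" "linear_on V g" "\<And>v. v \<in> V \<Longrightarrow> f v = g v"
  shows "linear_on V f"
  using assms(2) unfolding linear_on_def
  by (auto simp only: assms(3) fs.subspace_add[OF assms(1)] fs.subspace_scale[OF assms(1)] intro!: ballI)

lemma tensor_map_cong:
  assumes "fs.subspace V" "fs.subspace W" "linear_on V f" "linear_on W g" "linear_on V f'" "linear_on W g'"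
    and "\<And>v. v \<in> V \<Longrightarrow> f v = f' v" "\<And>w. w \<in> W \<Longrightarrow> g w = g' w" "t \<in> tensor V W"
  shows "tensor_map V W f g t = tensor_map V W f' g' t"
  by (rule tensor_eqI[OF assms(9) tensor_map_linear[OF assms(1-4)] tensor_map_linear[OF assms(1,2,5,6)]])
    (simp only: tensor_map_pure[OF assms(1-4)] tensor_map_pure[OF assms(1,2,5,6)] assms(7,8))

text \<open>This supplies injectivity on tensor squares and cubes when a bijection is transported.\<close>

lemma tensor_map_left_inverse:
  assumes "fs.subspace V" "fs.subspace W" "linear_on V f" "linear_on W g"
    and "fs.subspace V'" "fs.subspace W'" "linear_on V' f'" "linear_on W' g'"
    and "\<And>v. v \<in> V \<Longrightarrow> f v \<in> V'" "\<And>w. w \<in> W \<Longrightarrow> g w \<in> W'"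
    and "\<And>v. v \<in> V \<Longrightarrow> f' (f v) = v" "\<And>w. w \<in> W \<Longrightarrow> g' (g w) = w" "t \<in> tensor V W"
  shows "tensor_map V' W' f' g' (tensor_map V W f g t) = t"
  by (rule trans[OF tensor_map_comp[OF assms(1-10,13)] tensor_map_id[OF assms(1,2,11,12,13)]])

text \<open>A triple tensor is reduced to pure tensors in two stages, for the outer and then for the
  inner tensor product.\<close>

lemma reassoc_closed:
  assumes "t \<in> tensor (tensor U V) W"
  shows "reassoc t \<in> tensor U (tensor V W)"
proof (rule tensor_closedI[OF assms linear_on_reassoc subspace_tensor])
  fix s c assume s: "s \<in> tensor U V" and c: "c \<in> W"
  show "reassoc (s \<otimes>\<^sub>t c) \<in> tensor U (tensor V W)"
    by (rule tensor_closedI[OF s linear_on_comp[OF linear_on_pure(1)[OF linear_on_id(1)] linear_on_reassoc[of UNIV] UNIV_I] subspace_tensor])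
      (simp only: reassoc_pure pure_in_tensor c)
qed

lemma tensor_map_reassoc:
  assumes U: "fs.subspace U" and V: "fs.subspace V" and W: "fs.subspace W"
    and f: "linear_on U f" and g: "linear_on V g" and h: "linear_on W h"
    and t: "t \<in> tensor (tensor U V) W"
  shows "tensor_map U (tensor V W) f (tensor_map V W g h) (reassoc t)
       = reassoc (tensor_map (tensor U V) W (tensor_map U V f g) h t)"
proof (rule tensor_eqI[OF t])
  note gh = tensor_map_linear[OF V W g h] and fg = tensor_map_linear[OF U V f g]
  note R = tensor_map_linear[OF U subspace_tensor f gh] and L = tensor_map_linear[OF subspace_tensor W fg h]
  show L': "linear_on (tensor (tensor U V) W) (\<lambda>t. reassoc (tensor_map (tensor U V) W (tensor_map U V f g) h t))"
    by (rule linear_on_comp[OF L linear_on_reassoc[of UNIV] UNIV_I])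
  show R': "linear_on (tensor (tensor U V) W) (\<lambda>t. tensor_map U (tensor V W) f (tensor_map V W g h) (reassoc t))"
    by (rule linear_on_comp[OF linear_on_reassoc R reassoc_closed])
  fix s c assume s: "s \<in> tensor U V" and c: "c \<in> W"
  have pc: "linear_on (tensor U V) (\<lambda>s. s \<otimes>\<^sub>t c)" by (rule linear_on_pure(1)[OF linear_on_id(1)])
  show "tensor_map U (tensor V W) f (tensor_map V W g h) (reassoc (s \<otimes>\<^sub>t c)) =
        reassoc (tensor_map (tensor U V) W (tensor_map U V f g) h (s \<otimes>\<^sub>t c))"
  proof (rule tensor_eqI[OF s linear_on_comp[OF pc R'] linear_on_comp[OF pc L']])
    fix a b assume ab: "a \<in> U" "b \<in> V"
    note bc = pure_in_tensor[OF ab(2) c] and abt = pure_in_tensor[OF ab]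
    show "tensor_map U (tensor V W) f (tensor_map V W g h) (reassoc ((a \<otimes>\<^sub>t b) \<otimes>\<^sub>t c)) =
        reassoc (tensor_map (tensor U V) W (tensor_map U V f g) h ((a \<otimes>\<^sub>t b) \<otimes>\<^sub>t c))"
      unfolding reassoc_pure tensor_map_pure[OF U subspace_tensor f gh ab(1) bc]
        tensor_map_pure[OF subspace_tensor W fg h abt c] tensor_map_pure[OF V W g h ab(2) c]
        tensor_map_pure[OF U V f g ab] ..
  qed (rule pure_in_tensor[OF _ c], assumption)+
qed

section \<open>Transporting a Hopf algebra structure\<close>

lemma bilinear_counit:
  assumes "linear_form_on U e"
  shows "bilinear_on U U (\<lambda>v w. fscale (e v) w)" "bilinear_on U U (\<lambda>v w. fscale (e w) v)"
  using assms unfolding bilinear_on_def linear_on_def linear_form_on_def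
  by (simp_all add: fs.scale_left_distrib fs.scale_right_distrib mult.commute del: plus_fun_apply)

lemma bilinear_antipode:
  assumes m: "bilinear_on U U m" and S: "linear_on U S" and closed: "\<And>v. v \<in> U \<Longrightarrow> S v \<in> U"
  shows "bilinear_on U U (\<lambda>v w. m (S v) w)" "bilinear_on U U (\<lambda>v w. m v (S w))"
proof -
  have 1: "linear_on U (m v)" "linear_on U (\<lambda>v. m v w)" if "v \<in> U" "w \<in> U" for v w
    using m that by (simp_all add: bilinear_on_def)
  have 2: "linear_on U (\<lambda>v. m (S v) w)" if "w \<in> U" for w
    by (rule linear_on_comp[OF S, of U "\<lambda>v. m v w"]) (use 1 that closed in blast)+
  have 3: "linear_on U (\<lambda>w. m v (S w))" if "v \<in> U" for v
    by (rule linear_on_comp[OF S, of U "m v"]) (use 1 that closed in blast)+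
  show "bilinear_on U U (\<lambda>v w. m (S v) w)" "bilinear_on U U (\<lambda>v w. m v (S w))"
    unfolding bilinear_on_def using 1 2 3 closed by auto
qed

text \<open>Every axiom is an identity between linear expressions.  Applying \<open>f\<close>, \<open>f \<otimes> f\<close> or \<open>f \<otimes> (f \<otimes> f)\<close>,
  all of them injective, turns it into the corresponding identity in the target.\<close>

theorem hopf_transport:
  assumes H: "hopf_algebra_on V' mul' one' comul' counit' antipode'"
    and V: "fs.subspace V" and f: "linear_on V f" and bij: "bij_betw f V V'"
    and mul: "bilinear_on V V mul" and closed: "\<And>a b. \<lbrakk>a \<in> V; b \<in> V\<rbrakk> \<Longrightarrow> mul a b \<in> V"
    and f_mul: "\<And>a b. \<lbrakk>a \<in> V; b \<in> V\<rbrakk> \<Longrightarrow> f (mul a b) = mul' (f a) (f b)"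
    and comul: "linear_on V comul" and comul_closed: "\<And>a. a \<in> V \<Longrightarrow> comul a \<in> tensor V V"
    and f_comul: "\<And>a. a \<in> V \<Longrightarrow> tensor_map V V f f (comul a) = comul' (f a)"
  shows "\<exists>one counit antipode. hopf_iso_on V mul one comul counit antipode
    V' mul' one' comul' counit' antipode' f"
proof -
  interpret H: hopf_algebra_on V' mul' one' comul' counit' antipode' by (rule H)
  note V' = H.subspace
  define g where "g = the_inv_into V f"
  have inj: "inj_on f V" and fV: "f a \<in> V'" if "a \<in> V" for a using bij that by (auto simp: bij_betw_def)
  have gf: "g (f a) = a" if "a \<in> V" for a
    unfolding g_def by (rule the_inv_into_f_f[OF inj[OF that] that])
  have fg: "f (g b) = b" and gV: "g b \<in> V" if "b \<in> V'" for b
    using bij that unfolding g_def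
    by (auto simp: bij_betw_def f_the_inv_into_f intro: the_inv_into_into)
  have inj': "a = b" if "a \<in> V" "b \<in> V" "f a = f b" for a b
    using gf that by metis
  have f_add: "f (a + b) = f a + f b" if "a \<in> V" "b \<in> V" for a b
    using f that unfolding linear_on_def by blast
  have f_scale: "f (fscale r a) = fscale r (f a)" if "a \<in> V" for a r
    using f that unfolding linear_on_def by blast
  have g: "linear_on V' g"
    unfolding linear_on_def
  proof (intro conjI ballI allI)
    show "g (a + b) = g a + g b" if "a \<in> V'" "b \<in> V'" for a b
      by (rule inj') (use that V V' in \<open>simp_all only: gV fg f_add fs.subspace_add\<close>)
    show "g (fscale r a) = fscale r (g a)" if "a \<in> V'" for a r
      by (rule inj') (use that V V' in \<open>simp_all only: gV fg f_scale[OF gV] fs.subspace_scale\<close>)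
  qed
  define one where "one = g one'"
  define counit where "counit v = counit' (f v)" for v
  define antipode where "antipode v = g (antipode' (f v))" for v
  have f_one: "f one = one'" and one: "one \<in> V"
    unfolding one_def by (rule fg gV, rule H.one_closed)+
  have f_antipode: "f (antipode a) = antipode' (f a)" and antipode: "antipode a \<in> V" if "a \<in> V" for a
    unfolding antipode_def by (rule fg gV, rule H.antipode_closed, rule fV[OF that])+
  have antipode_lin: "linear_on V antipode"
    unfolding antipode_def
    by (rule linear_on_comp[OF linear_on_comp[OF f H.antipode_linear fV] g H.antipode_closed[OF fV]])

  note T = subspace_tensor
  let ?F = "tensor_map V V f f" and ?G = "tensor_map V' V' g g"
  note F = tensor_map_linear[OF V V f f] and G = tensor_map_linear[OF V' V' g g]
  note F_pure = tensor_map_pure[OF V V f f]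
  have F_closed: "?F t \<in> tensor V' V'" if "t \<in> tensor V V" for t
    by (rule tensor_map_closed[OF V V f f fV fV that])
  have GF: "?G (?F t) = t" if "t \<in> tensor V V" for t
    by (rule tensor_map_left_inverse[where f = f and g = f and f' = g and g' = g,
          OF V V f f V' V' g g fV fV gf gf that])
  have injF: "s = t" if "s \<in> tensor V V" "t \<in> tensor V V" "?F s = ?F t" for s t
    using GF that by metis
  let ?F3 = "tensor_map V (tensor V V) f ?F"
  have GF3: "tensor_map V' (tensor V' V') g ?G (?F3 t) = t" if "t \<in> tensor V (tensor V V)" for t
    by (rule tensor_map_left_inverse[where f = f and g = "?F" and f' = g and g' = "?G",
          OF V T f F V' T g G fV F_closed gf GF that])
  have injF3: "s = t" if "s \<in> tensor V (tensor V V)" "t \<in> tensor V (tensor V V)" "?F3 s = ?F3 t" for s t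
    using GF3 that by metis

  \<comment> \<open>A bilinear expression evaluated on the coproduct is carried to the one on the other side;
    this covers the counit and the antipode axioms.\<close>
  have lift_F: "f (tensor_lift V V B (comul a)) = tensor_lift V' V' B' (comul' (f a))"
    if "a \<in> V" "bilinear_on V V B" "bilinear_on V' V' B'"
      "\<And>v w. \<lbrakk>v \<in> V; w \<in> V\<rbrakk> \<Longrightarrow> B v w \<in> V" "\<And>v w. \<lbrakk>v \<in> V; w \<in> V\<rbrakk> \<Longrightarrow> f (B v w) = B' (f v) (f w)" for a B B'
  proof -
    note ca = comul_closed[OF that(1)]
    have fB: "bilinear_on V V (\<lambda>v w. f (B v w))"
      using that(2,4) unfolding bilinear_on_def by (auto intro!: linear_on_comp[OF _ f])
    note lift' = tensor_lift_universal[OF V' V' that(3)]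
    have "f (tensor_lift V V B (comul a)) = tensor_lift V V (\<lambda>v w. f (B v w)) (comul a)"
      by (rule linear_tensor_lift[OF V V that(2,4) f V ca])
    also have "\<dots> = tensor_lift V' V' B' (?F (comul a))"
    proof (rule tensor_eqI[OF ca tensor_lift_universal(1)[OF V V fB]
            linear_on_comp[OF F lift'(1) F_closed]])
      fix v w assume vw: "v \<in> V" "w \<in> V"
      show "tensor_lift V V (\<lambda>v w. f (B v w)) (v \<otimes>\<^sub>t w) = tensor_lift V' V' B' (?F (v \<otimes>\<^sub>t w))"
        unfolding tensor_lift_universal(2)[OF V V fB vw] F_pure[OF vw] lift'(2)[OF fV[OF vw(1)] fV[OF vw(2)]]
        by (rule that(5)[OF vw])
    qed
    finally show ?thesis unfolding f_comul[OF that(1)] .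
  qed
  have lift_eqI: "tensor_lift V V B (comul a) = z"
    if a: "a \<in> V" and B: "bilinear_on V V B" and B': "bilinear_on V' V' B'"
      and BV: "\<And>v w. \<lbrakk>v \<in> V; w \<in> V\<rbrakk> \<Longrightarrow> B v w \<in> V"
      and fB: "\<And>v w. \<lbrakk>v \<in> V; w \<in> V\<rbrakk> \<Longrightarrow> f (B v w) = B' (f v) (f w)"
      and z: "z \<in> V" "tensor_lift V' V' B' (comul' (f a)) = f z" for a B B' z
  proof (rule inj'[OF _ z(1)])
    show "tensor_lift V V B (comul a) \<in> V"
      by (rule tensor_closedI[OF comul_closed[OF a] tensor_lift_universal(1)[OF V V B] V])
        (simp only: tensor_lift_universal(2)[OF V V B] BV)
    show "f (tensor_lift V V B (comul a)) = f z"
      unfolding z(2)[symmetric] by (rule lift_F[OF a B B' BV fB])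
  qed

  have mul': "bilinear_on V' V' mul'" by (rule H.mul_bilinear)
  have counit'_lin: "linear_form_on V' counit'" by (rule H.counit_linear)
  have counit_lin: "linear_form_on V counit"
    using f counit'_lin fV unfolding counit_def linear_form_on_def linear_on_def by simp
  note bc = bilinear_counit[OF counit_lin] and bc' = bilinear_counit[OF counit'_lin]
  note ba = bilinear_antipode[OF mul antipode_lin antipode]
    and ba' = bilinear_antipode[OF mul' H.antipode_linear H.antipode_closed]
  note id = linear_on_id(2)
  note simps = f_mul f_scale fV closed counit_def f_antipode antipode f_one one fs.subspace_scale[OF V]

  have assoc: "mul (mul a b) c = mul a (mul b c)" if "a \<in> V" "b \<in> V" "c \<in> V" for a b c
    by (rule inj') (use that in \<open>simp_all only: simps H.mul_assoc\<close>)
  have unit: "mul one a = a" "mul a one = a" if "a \<in> V" for a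
    by (rule inj'; use that in \<open>simp only: simps H.one_left H.one_right\<close>)+
  have coassoc: "reassoc (tensor_map V V comul id (comul a)) = tensor_map V V id comul (comul a)"
    if a: "a \<in> V" for a
  proof (rule injF3)
    note ca = comul_closed[OF a]
    have Cl: "tensor_map V V comul id (comul a) \<in> tensor (tensor V V) V"
      by (rule tensor_map_closed[OF V V comul id comul_closed _ ca]) simp_all
    show "reassoc (tensor_map V V comul id (comul a)) \<in> tensor V (tensor V V)"
      by (rule reassoc_closed[OF Cl])
    show Cr: "tensor_map V V id comul (comul a) \<in> tensor V (tensor V V)"
      by (rule tensor_map_closed[OF V V id comul _ comul_closed ca]) simp_all
    have Ff: "linear_on V (\<lambda>v. ?F (comul v))" by (rule linear_on_comp[OF comul F comul_closed])
    have cf: "linear_on V (\<lambda>v. comul' (f v))" by (rule linear_on_comp[OF f H.comul_linear fV])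
    \<comment> \<open>Move \<open>f\<close> inwards past the coproduct on one side, use coassociativity in the target, and move
      \<open>f\<close> outwards again on the other side.\<close>
    have "?F3 (reassoc (tensor_map V V comul id (comul a)))
        = reassoc (tensor_map (tensor V V) V ?F f (tensor_map V V comul id (comul a)))"
      by (rule tensor_map_reassoc[OF V V V f f f Cl])
    also have "tensor_map (tensor V V) V ?F f (tensor_map V V comul id (comul a))
        = tensor_map V V (\<lambda>v. ?F (comul v)) (\<lambda>w. f (id w)) (comul a)"
      by (rule tensor_map_comp[OF V V comul id T V F f comul_closed _ ca]) simp_all
    also have "\<dots> = tensor_map V V (\<lambda>v. comul' (f v)) (\<lambda>w. id (f w)) (comul a)"
      by (rule tensor_map_cong[OF V V Ff _ cf _ _ _ ca]) (simp_all add: f f_comul)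
    also have "\<dots> = tensor_map V' V' comul' id (?F (comul a))"
      by (rule tensor_map_comp[OF V V f f V' V' H.comul_linear id fV fV ca, symmetric])
    also have "reassoc \<dots> = tensor_map V' V' id comul' (?F (comul a))"
      unfolding f_comul[OF a] by (rule H.coassoc[OF fV[OF a]])
    also have "\<dots> = tensor_map V V (\<lambda>v. id (f v)) (\<lambda>w. comul' (f w)) (comul a)"
      by (rule tensor_map_comp[OF V V f f V' V' id H.comul_linear fV fV ca])
    also have "\<dots> = tensor_map V V (\<lambda>v. f (id v)) (\<lambda>w. ?F (comul w)) (comul a)"
      by (rule tensor_map_cong[OF V V _ cf _ Ff _ _ ca]) (simp_all add: f f_comul)
    also have "\<dots> = ?F3 (tensor_map V V id comul (comul a))"
      by (rule tensor_map_comp[OF V V id comul V T f F _ comul_closed ca, symmetric]) simp_all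
    finally show "?F3 (reassoc (tensor_map V V comul id (comul a))) = ?F3 (tensor_map V V id comul (comul a))" .
  qed
  have counit: "tensor_lift V V (\<lambda>v w. fscale (counit v) w) (comul a) = a" if a: "a \<in> V" for a
    by (rule lift_eqI[OF a bc(1) bc'(1)]; simp only: simps a H.counit_left[OF fV[OF a]])
  have counit2: "tensor_lift V V (\<lambda>v w. fscale (counit w) v) (comul a) = a" if a: "a \<in> V" for a
    by (rule lift_eqI[OF a bc(2) bc'(2)]; simp only: simps a H.counit_right[OF fV[OF a]])
  have antipode_inv: "tensor_lift V V (\<lambda>v w. mul (antipode v) w) (comul a) = fscale (counit a) one"
    if a: "a \<in> V" for a
    by (rule lift_eqI[OF a ba(1) ba'(1)]; simp only: simps a H.antipode_left[OF fV[OF a]])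
  have antipode_inv2: "tensor_lift V V (\<lambda>v w. mul v (antipode w)) (comul a) = fscale (counit a) one"
    if a: "a \<in> V" for a
    by (rule lift_eqI[OF a ba(2) ba'(2)]; simp only: simps a H.antipode_right[OF fV[OF a]])
  have comul_mul: "comul (mul a b) = tensor_mul V mul (comul a) (comul b)"
    if ab: "a \<in> V" "b \<in> V" for a b
  proof (rule injF[OF comul_closed[OF closed[OF ab]]
        tensor_mul_closed[OF V mul closed comul_closed[OF ab(1)] comul_closed[OF ab(2)]]])
    have bil': "linear_on (tensor V' V') (\<lambda>s. tensor_mul V' mul' s t)" if "t \<in> tensor V' V'" for t
      unfolding tensor_mul_def
      by (rule tensor_lift_universal(1)[OF V' V' tensor_mul_bilinear[OF V' mul' that]])
    have lin': "linear_on V' (mul' x)" if "x \<in> V'" for x using mul' that by (simp add: bilinear_on_def)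
    note tm_pure = tensor_mul_pure[OF V' mul']
    note lift' = tensor_lift_universal[OF V' V' bilinear_on_pure[OF lin' lin']]
    have "?F (tensor_mul V mul (comul a) (comul b)) = tensor_mul V' mul' (?F (comul a)) (?F (comul b))"
    proof (rule tensor_mul_unique[OF V mul closed comul_closed[OF ab(1)] comul_closed[OF ab(2)] _ _ _ F])
      show "linear_on (tensor V V) (\<lambda>s. tensor_mul V' mul' (?F s) (?F (comul b)))"
        by (rule linear_on_comp[OF F bil'[OF F_closed[OF comul_closed[OF ab(2)]]] F_closed])
      fix c d assume cd: "c \<in> V" "d \<in> V"
      note fcd = fV[OF cd(1)] fV[OF cd(2)]
      have "linear_on (tensor V V) (\<lambda>t. tensor_lift V' V' (\<lambda>x y. mul' (f c) x \<otimes>\<^sub>t mul' (f d) y) (?F t))"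
        by (rule linear_on_comp[OF F lift'(1)[OF fcd] F_closed])
      then show "linear_on (tensor V V) (\<lambda>t. tensor_mul V' mul' (?F (c \<otimes>\<^sub>t d)) (?F t))"
        by (rule linear_on_cong[OF T]) (simp only: F_pure[OF cd] tm_pure[OF fcd F_closed])
      fix x y assume xy: "x \<in> V" "y \<in> V"
      show "tensor_mul V' mul' (?F (c \<otimes>\<^sub>t d)) (?F (x \<otimes>\<^sub>t y)) = ?F (mul c x \<otimes>\<^sub>t mul d y)"
        unfolding F_pure[OF cd] F_pure[OF xy] F_pure[OF closed[OF cd(1) xy(1)] closed[OF cd(2) xy(2)]]
          tm_pure[OF fcd pure_in_tensor[OF fV[OF xy(1)] fV[OF xy(2)]]]
          lift'(2)[OF fcd fV[OF xy(1)] fV[OF xy(2)]]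
        by (simp only: f_mul cd xy)
    qed
    then show "?F (comul (mul a b)) = ?F (tensor_mul V mul (comul a) (comul b))"
      using ab by (simp only: f_comul closed f_mul H.comul_mul fV)
  qed
  have comul_one: "comul one = one \<otimes>\<^sub>t one"
    by (rule injF) (simp_all only: comul_closed one pure_in_tensor f_comul F_pure f_one H.comul_one)

  have "algebra_on V mul one"
    by (rule algebra_on.intro[OF V closed mul assoc one unit])
  moreover have "coalgebra_on V comul counit"
    by (rule coalgebra_on.intro[OF V comul_closed comul counit_lin coassoc counit counit2])
  moreover have "bialgebra_on_axioms V mul one comul counit"
    by (rule bialgebra_on_axioms.intro[OF comul_mul comul_one])
      (simp_all only: simps H.counit_mul H.counit_one)
  ultimately have "bialgebra_on V mul one comul counit" by (rule bialgebra_on.intro)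
  then have "hopf_algebra_on V mul one comul counit antipode"
    by (rule hopf_algebra_on.intro[OF _ hopf_algebra_on_axioms.intro[OF antipode antipode_lin antipode_inv antipode_inv2]])
  moreover have "hopf_iso_on_axioms V mul one comul counit antipode V' mul' one' comul' counit' antipode' f"
    by (rule hopf_iso_on_axioms.intro; (rule f bij f_one | simp only: f_mul f_comul f_antipode counit_def))
  ultimately have "hopf_iso_on V mul one comul counit antipode V' mul' one' comul' counit' antipode' f"
    using H by (intro hopf_iso_on.intro)
  then show ?thesis by blast
qed

section \<open>Monomials and their exponent sequences\<close>

text \<open>Quasisymmetry says that a coefficient depends on nothing but this sequence.\<close>

definition expos :: "(nat \<Rightarrow>\<^sub>0 nat) \<Rightarrow> nat list" where
  "expos m = map (Poly_Mapping.lookup m) (sorted_list_of_set (Poly_Mapping.keys m))"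

lemma expos_composition: "expos m \<in> compositions"
  by (auto simp: expos_def compositions_def in_keys_iff)

lemma lookup_monomial:
  assumes "distinct is" "length is = length \<alpha>"
  shows "j < length \<alpha> \<Longrightarrow> Poly_Mapping.lookup (monomial is \<alpha>) (is ! j) = \<alpha> ! j"
    and "x \<notin> set is \<Longrightarrow> Poly_Mapping.lookup (monomial is \<alpha>) x = 0"
proof -
  have l: "Poly_Mapping.lookup (monomial is \<alpha>) x = (\<Sum>i<length \<alpha>. if is ! i = x then \<alpha> ! i else 0)" for x
    by (simp add: monomial_def lookup_sum lookup_single when_def)
  show "Poly_Mapping.lookup (monomial is \<alpha>) (is ! j) = \<alpha> ! j" if "j < length \<alpha>"
  proof -
    have "(\<Sum>i<length \<alpha>. if is ! i = is ! j then \<alpha> ! i else 0) = (\<Sum>i<length \<alpha>. if i = j then \<alpha> ! i else 0)"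
      using that assms by (intro sum.cong) (auto simp: nth_eq_iff_index_eq)
    then show ?thesis using l that by simp
  qed
  show "Poly_Mapping.lookup (monomial is \<alpha>) x = 0" if "x \<notin> set is"
    using that assms unfolding l by (intro sum.neutral) auto
qed

lemma map_lookup_monomial:
  assumes "distinct is" "length is = length \<alpha>"
  shows "map (Poly_Mapping.lookup (monomial is \<alpha>)) is = \<alpha>"
  using assms by (intro nth_equalityI) (simp_all add: lookup_monomial(1))

lemma monomial_eqI:
  assumes "distinct is" "Poly_Mapping.keys m \<subseteq> set is"
  shows "monomial is (map (Poly_Mapping.lookup m) is) = m"
proof (rule poly_mapping_eqI)
  fix x
  show "Poly_Mapping.lookup (monomial is (map (Poly_Mapping.lookup m) is)) x = Poly_Mapping.lookup m x"
  proof (cases "x \<in> set is")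
    case True
    then obtain j where "j < length is" "is ! j = x" by (auto simp: in_set_conv_nth)
    then show ?thesis using lookup_monomial(1)[OF assms(1), of "map (Poly_Mapping.lookup m) is" j] by auto
  next
    case False
    then show ?thesis using assms lookup_monomial(2)[OF assms(1), of "map (Poly_Mapping.lookup m) is" x]
      by (auto simp: in_keys_iff)
  qed
qed

lemma monomial_expos: "monomial (sorted_list_of_set (Poly_Mapping.keys m)) (expos m) = m"
  unfolding expos_def by (rule monomial_eqI) simp_all

lemma incr_seqs_keys: "sorted_list_of_set (Poly_Mapping.keys m) \<in> incr_seqs (length (expos m))"
  by (simp add: incr_seqs_def expos_def)

lemma expos_eq_filter:
  assumes "sorted_wrt (<) is" "Poly_Mapping.keys m \<subseteq> set is"
  shows "expos m = filter (\<lambda>k. k \<noteq> 0) (map (Poly_Mapping.lookup m) is)"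
proof -
  let ?xs = "filter (\<lambda>i. Poly_Mapping.lookup m i \<noteq> 0) is"
  have "set ?xs = Poly_Mapping.keys m" using assms(2) by (auto simp: in_keys_iff)
  moreover have "sorted ?xs" "distinct ?xs" using assms(1) by (simp_all add: strict_sorted_iff sorted_wrt_filter)
  ultimately have "sorted_list_of_set (Poly_Mapping.keys m) = ?xs"
    by (metis sorted_list_of_set.idem_if_sorted_distinct)
  then show ?thesis by (simp add: expos_def filter_map comp_def)
qed

lemma expos_monomial:
  assumes "is \<in> incr_seqs (length \<alpha>)"
  shows "expos (monomial is \<alpha>) = filter (\<lambda>k. k \<noteq> 0) \<alpha>"
proof -
  have "sorted_wrt (<) is" "length is = length \<alpha>" "distinct is"
    using assms by (auto simp: incr_seqs_def strict_sorted_iff)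
  moreover have "Poly_Mapping.keys (monomial is \<alpha>) \<subseteq> set is"
    using lookup_monomial(2)[OF \<open>distinct is\<close> \<open>length is = length \<alpha>\<close>] by (auto simp: in_keys_iff)
  ultimately show ?thesis by (simp add: expos_eq_filter map_lookup_monomial)
qed

lemma expos_monomial_composition:
  assumes "is \<in> incr_seqs (length \<alpha>)" "\<alpha> \<in> compositions"
  shows "expos (monomial is \<alpha>) = \<alpha>"
  using assms by (auto simp: expos_monomial compositions_def filter_id_conv)

lemma incr_seqs_upt: "[0..<l] \<in> incr_seqs l"
  by (simp add: incr_seqs_def)

lemma total_degree_expos: "total_degree m = sum_list (expos m)"
  by (simp add: total_degree_def expos_def sum_list_distinct_conv_sum_set)

lemma keys_incr_seq:
  assumes "is \<in> incr_seqs (length \<alpha>)" "\<alpha> \<in> compositions"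
  shows "sorted_list_of_set (Poly_Mapping.keys (monomial is \<alpha>)) = is"
proof -
  have s: "sorted_wrt (<) is" "length is = length \<alpha>" "distinct is"
    using assms by (auto simp: incr_seqs_def strict_sorted_iff)
  have "Poly_Mapping.keys (monomial is \<alpha>) = set is"
  proof (rule equalityI; rule subsetI)
    fix x assume "x \<in> Poly_Mapping.keys (monomial is \<alpha>)"
    then show "x \<in> set is" using lookup_monomial(2)[OF s(3,2)] by (metis in_keys_iff)
  next
    fix x assume "x \<in> set is"
    then obtain j where "j < length \<alpha>" "is ! j = x" using s by (auto simp: in_set_conv_nth)
    then show "x \<in> Poly_Mapping.keys (monomial is \<alpha>)"
      using lookup_monomial(1)[OF s(3,2)] assms(2) by (auto simp: in_keys_iff compositions_def)
  qed
  then show ?thesis using s by (simp add: sorted_list_of_set.idem_if_sorted_distinct strict_sorted_iff)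
qed

section \<open>Quasisymmetric functions as functions of exponent sequences\<close>

text \<open>For quasisymmetric \<open>f\<close> the first variables may stand for any other increasing choice, so
  this is the coefficient of \<open>f\<close> at every monomial with exponent sequence \<open>\<alpha>\<close>.\<close>

definition coef :: "series \<Rightarrow> nat list \<Rightarrow> complex" where
  "coef f \<alpha> = f (monomial [0..<length \<alpha>] \<alpha>)"

lemma QSym_coef:
  assumes "f \<in> QSym"
  shows "f m = coef f (expos m)"
  using assms incr_seqs_keys[of m] incr_seqs_upt expos_composition[of m]
  unfolding QSym_def coef_def by (smt (verit) mem_Collect_eq monomial_expos)

lemma QSym_bounded:
  assumes "f \<in> QSym"
  obtains d where "\<And>m. f m \<noteq> 0 \<Longrightarrow> total_degree m \<le> d"
  using assms unfolding QSym_def by blast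

text \<open>The converse of \<open>QSym_coef\<close>: the form in which membership is checked below.\<close>

lemma QSymI:
  assumes "\<And>m. f m \<noteq> 0 \<Longrightarrow> total_degree m \<le> d" "\<And>m. f m = F (expos m)"
  shows "f \<in> QSym"
  unfolding QSym_def mem_Collect_eq
proof (intro conjI ballI)
  show "\<exists>d. \<forall>m. f m \<noteq> 0 \<longrightarrow> total_degree m \<le> d" using assms(1) by blast
  fix \<alpha> "is" js assume "\<alpha> \<in> compositions" "is \<in> incr_seqs (length \<alpha>)" "js \<in> incr_seqs (length \<alpha>)"
  then show "f (monomial is \<alpha>) = f (monomial js \<alpha>)"
    by (simp add: assms(2) expos_monomial_composition)
qed

lemma expos_upt: "\<alpha> \<in> compositions \<Longrightarrow> expos (monomial [0..<length \<alpha>] \<alpha>) = \<alpha>"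
  by (simp add: expos_monomial_composition incr_seqs_upt)

text \<open>There is at most one way to place the exponents \<open>\<alpha>\<close> so as to obtain \<open>m\<close>, namely on the
  variables of \<open>m\<close> in increasing order.\<close>

lemma qsym_M_eq:
  assumes "\<alpha> \<in> compositions"
  shows "qsym_M \<alpha> m = of_bool (expos m = \<alpha>)"
proof -
  have "{is \<in> incr_seqs (length \<alpha>). monomial is \<alpha> = m}
      = (if expos m = \<alpha> then {sorted_list_of_set (Poly_Mapping.keys m)} else {})"
    using keys_incr_seq[OF _ assms] incr_seqs_keys[of m] monomial_expos[of m]
      expos_monomial_composition[OF _ assms]
    by (auto split: if_splits) metis+
  then show ?thesis by (simp add: qsym_M_def)
qed

lemma qsym_M_in_QSym: "\<alpha> \<in> compositions \<Longrightarrow> qsym_M \<alpha> \<in> QSym"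
  by (rule QSymI[of _ "sum_list \<alpha>" "\<lambda>\<beta>. of_bool (\<beta> = \<alpha>)"])
    (auto simp: qsym_M_eq total_degree_expos split: if_splits)

lemma subspace_QSym: "fs.subspace QSym"
proof (rule fs.subspaceI)
  show "0 \<in> QSym" by (rule QSymI[of _ 0 "\<lambda>_. 0"]) auto
  fix f g assume f: "f \<in> QSym" and g: "g \<in> QSym"
  obtain d e where d: "\<And>m. f m \<noteq> 0 \<Longrightarrow> total_degree m \<le> d" and e: "\<And>m. g m \<noteq> 0 \<Longrightarrow> total_degree m \<le> e"
    using QSym_bounded[OF f] QSym_bounded[OF g] by metis
  show "f + g \<in> QSym"
  proof (rule QSymI[of _ "max d e" "\<lambda>\<alpha>. coef f \<alpha> + coef g \<alpha>"])
    show "total_degree m \<le> max d e" if "(f + g) m \<noteq> 0" for m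
    proof -
      have "f m \<noteq> 0 \<or> g m \<noteq> 0" using that by auto
      then show ?thesis using d[of m] e[of m] by (auto simp: le_max_iff_disj)
    qed
  qed (simp add: QSym_coef[OF f, symmetric] QSym_coef[OF g, symmetric])
next
  fix c f assume f: "f \<in> QSym"
  obtain d where d: "\<And>m. f m \<noteq> 0 \<Longrightarrow> total_degree m \<le> d"
    using QSym_bounded[OF f] by metis
  show "fscale c f \<in> QSym"
    by (rule QSymI[of _ d "\<lambda>\<alpha>. c * coef f \<alpha>"])
      (auto simp: fscale_def QSym_coef[OF f, symmetric] dest: d)
qed

lemma indep_qsym_M: "indep_family compositions qsym_M"
  unfolding indep_family_def
proof (intro allI impI ballI)
  fix S c \<alpha> assume S: "finite S" "S \<subseteq> compositions" and 0: "(\<Sum>k\<in>S. fscale (c k) (qsym_M k)) = 0"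
    and \<alpha>: "\<alpha> \<in> S"
  have "0 = (\<Sum>k\<in>S. fscale (c k) (qsym_M k)) (monomial [0..<length \<alpha>] \<alpha>)" unfolding 0 by simp
  also have "\<dots> = (\<Sum>k\<in>S. if k = \<alpha> then c k else 0)"
    unfolding sum_fun_apply fscale_def
    using S \<alpha> by (intro sum.cong) (auto simp: qsym_M_eq expos_upt subset_iff)
  finally show "c \<alpha> = 0" using S \<alpha> by simp
qed

lemma finite_compositions: "finite {\<alpha> \<in> compositions. sum_list \<alpha> \<le> d}"
proof (rule finite_subset)
  show "finite {\<alpha>. set \<alpha> \<subseteq> {..d} \<and> length \<alpha> \<le> d}" by (rule finite_lists_length_le) simp
  have "length \<alpha> \<le> sum_list \<alpha>" if "\<forall>a\<in>set \<alpha>. 0 < a" for \<alpha> :: "nat list"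
    using that by (induction \<alpha>) auto
  then show "{\<alpha> \<in> compositions. sum_list \<alpha> \<le> d} \<subseteq> {\<alpha>. set \<alpha> \<subseteq> {..d} \<and> length \<alpha> \<le> d}"
    unfolding compositions_def using member_le_sum_list by (fastforce intro: order_trans)
qed

text \<open>Bounded degree leaves only finitely many compositions with a nonzero coefficient.\<close>

lemma span_qsym_M: "fs.span (qsym_M ` compositions) = QSym"
proof (intro equalityI subsetI)
  fix f assume "f \<in> fs.span (qsym_M ` compositions)"
  then show "f \<in> QSym" by (rule fs.span_minimal[THEN subsetD, rotated 2])
      (auto simp: qsym_M_in_QSym subspace_QSym)
next
  fix f assume f: "f \<in> QSym"
  obtain d where d: "\<And>m. f m \<noteq> 0 \<Longrightarrow> total_degree m \<le> d"
    using QSym_bounded[OF f] by metis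
  let ?S = "{\<alpha> \<in> compositions. sum_list \<alpha> \<le> d}"
  have "f = (\<Sum>\<alpha>\<in>?S. fscale (coef f \<alpha>) (qsym_M \<alpha>))"
  proof
    fix m
    have "(\<Sum>\<alpha>\<in>?S. fscale (coef f \<alpha>) (qsym_M \<alpha>)) m = (\<Sum>\<alpha>\<in>?S. if \<alpha> = expos m then coef f \<alpha> else 0)"
      unfolding sum_fun_apply fscale_def by (intro sum.cong) (auto simp: qsym_M_eq)
    also have "\<dots> = (if expos m \<in> ?S then coef f (expos m) else 0)"
      using finite_compositions by simp
    also have "\<dots> = f m"
      using d[of m] by (auto simp: expos_composition total_degree_expos QSym_coef[OF f, symmetric])
    finally show "f m = (\<Sum>\<alpha>\<in>?S. fscale (coef f \<alpha>) (qsym_M \<alpha>)) m" ..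
  qed
  also have "\<dots> \<in> fs.span (qsym_M ` compositions)"
    by (intro fs.span_sum fs.span_scale fs.span_base) auto
  finally show "f \<in> fs.span (qsym_M ` compositions)" .
qed

section \<open>The product of quasisymmetric functions\<close>

abbreviation nonzeros :: "nat list \<Rightarrow> nat list" where
  "nonzeros \<equiv> filter (\<lambda>k. k \<noteq> 0)"

text \<open>The exponents of the two factors of a monomial, each listed along the variables of the
  product; a variable that is missing in a factor has exponent 0, so the entries need not be positive.\<close>

definition splittings :: "nat list \<Rightarrow> (nat list \<times> nat list) set" where
  "splittings \<alpha> = {(\<beta>, \<gamma>). length \<beta> = length \<alpha> \<and> length \<gamma> = length \<alpha> \<and> map2 (+) \<beta> \<gamma> = \<alpha>}"

lemma bij_betw_splittings:
  fixes m :: "nat \<Rightarrow>\<^sub>0 nat"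
  defines "ks \<equiv> sorted_list_of_set (Poly_Mapping.keys m)"
  shows "bij_betw (\<lambda>(a, b). (map (Poly_Mapping.lookup a) ks, map (Poly_Mapping.lookup b) ks))
    {(a, b). a + b = m} (splittings (expos m))"
proof (rule bij_betw_byWitness[where f' = "\<lambda>(\<beta>, \<gamma>). (monomial ks \<beta>, monomial ks \<gamma>)"])
  have ks: "distinct ks" "set ks = Poly_Mapping.keys m" "length ks = length (expos m)"
    by (simp_all add: ks_def expos_def)
  have sub: "Poly_Mapping.keys a \<subseteq> set ks" "Poly_Mapping.keys b \<subseteq> set ks" if "a + b = m" for a b
    unfolding ks(2) that[symmetric] by (auto simp: in_keys_iff lookup_add)
  show "\<forall>p\<in>{(a, b). a + b = m}. (case case p of (a, b) \<Rightarrow>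
      (map (Poly_Mapping.lookup a) ks, map (Poly_Mapping.lookup b) ks) of
      (\<beta>, \<gamma>) \<Rightarrow> (monomial ks \<beta>, monomial ks \<gamma>)) = p"
    using sub by (auto simp: monomial_eqI[OF ks(1)])
  show "\<forall>p\<in>splittings (expos m). (case case p of (\<beta>, \<gamma>) \<Rightarrow> (monomial ks \<beta>, monomial ks \<gamma>) of
      (a, b) \<Rightarrow> (map (Poly_Mapping.lookup a) ks, map (Poly_Mapping.lookup b) ks)) = p"
    using ks by (auto simp: splittings_def map_lookup_monomial)
  show "(\<lambda>(a, b). (map (Poly_Mapping.lookup a) ks, map (Poly_Mapping.lookup b) ks)) ` {(a, b). a + b = m}
      \<subseteq> splittings (expos m)"
    by (auto simp: splittings_def ks_def expos_def lookup_add map2_map_map)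
  show "(\<lambda>(\<beta>, \<gamma>). (monomial ks \<beta>, monomial ks \<gamma>)) ` splittings (expos m) \<subseteq> {(a, b). a + b = m}"
  proof (clarify)
    fix \<beta> \<gamma> assume s: "(\<beta>, \<gamma>) \<in> splittings (expos m)"
    then have l: "length ks = length \<beta>" "length ks = length \<gamma>" "map2 (+) \<beta> \<gamma> = expos m"
      by (auto simp: splittings_def ks(3))
    show "monomial ks \<beta> + monomial ks \<gamma> = m"
    proof (rule poly_mapping_eqI)
      fix x
      show "Poly_Mapping.lookup (monomial ks \<beta> + monomial ks \<gamma>) x = Poly_Mapping.lookup m x"
      proof (cases "x \<in> set ks")
        case True
        then obtain j where j: "j < length ks" "ks ! j = x" by (auto simp: in_set_conv_nth)
        have "Poly_Mapping.lookup m x = expos m ! j"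
          using j by (simp add: expos_def ks_def)
        also have "\<dots> = \<beta> ! j + \<gamma> ! j"
        proof -
          have "map2 (+) \<beta> \<gamma> ! j = \<beta> ! j + \<gamma> ! j" using j l(1,2) by simp
          then show ?thesis unfolding l(3) .
        qed
        finally have "Poly_Mapping.lookup m x = \<beta> ! j + \<gamma> ! j" .
        then show ?thesis
          using j lookup_monomial(1)[OF ks(1) l(1), of j] lookup_monomial(1)[OF ks(1) l(2), of j] l
          by (simp add: lookup_add)
      next
        case False
        then show ?thesis
          using lookup_monomial(2)[OF ks(1) l(1)] lookup_monomial(2)[OF ks(1) l(2)] ks(2)
          by (simp add: lookup_add in_keys_iff)
      qed
    qed
  qed
qed

lemma finite_splittings: "finite (splittings \<alpha>)"
proof (rule finite_subset)
  let ?L = "{\<beta>. set \<beta> \<subseteq> {..sum_list \<alpha>} \<and> length \<beta> = length \<alpha>}"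
  show "finite (?L \<times> ?L)" by (intro finite_cartesian_product finite_lists_length_eq) simp_all
  have "set \<beta> \<subseteq> {..sum_list \<alpha>} \<and> set \<gamma> \<subseteq> {..sum_list \<alpha>}"
    if l: "length \<beta> = length \<alpha>" "length \<gamma> = length \<alpha>" "map2 (+) \<beta> \<gamma> = \<alpha>" for \<beta> \<gamma>
  proof -
    have "\<beta> ! j \<le> sum_list \<alpha>" "\<gamma> ! j \<le> sum_list \<alpha>" if "j < length \<alpha>" for j
    proof -
      have "map2 (+) \<beta> \<gamma> ! j = \<beta> ! j + \<gamma> ! j" using that l(1,2) by simp
      then have "\<beta> ! j + \<gamma> ! j = \<alpha> ! j" unfolding l(3) ..
      moreover have "\<alpha> ! j \<le> sum_list \<alpha>" using that by (rule elem_le_sum_list)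
      ultimately show "\<beta> ! j \<le> sum_list \<alpha>" "\<gamma> ! j \<le> sum_list \<alpha>" by linarith+
    qed
    then show ?thesis using l(1,2) by (auto simp: subset_iff in_set_conv_nth)
  qed
  then show "splittings \<alpha> \<subseteq> ?L \<times> ?L" by (auto simp: splittings_def)
qed

lemma finite_factorizations: "finite {(a, b). a + b = (m :: nat \<Rightarrow>\<^sub>0 nat)}"
  using bij_betw_finite[OF bij_betw_splittings] finite_splittings by blast

text \<open>The right-hand side depends on \<open>m\<close> only through its exponents.  This is why a product of
  quasisymmetric functions is quasisymmetric, and it lets the product be computed on sequences.\<close>

lemma sum_factorizations:
  "(\<Sum>(a, b)\<in>{(a, b). a + b = m}. H (expos a) (expos b))
     = (\<Sum>(\<beta>, \<gamma>)\<in>splittings (expos m). H (nonzeros \<beta>) (nonzeros \<gamma>))"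
proof -
  define ks where "ks = sorted_list_of_set (Poly_Mapping.keys m)"
  have ks: "sorted_wrt (<) ks" "set ks = Poly_Mapping.keys m" by (simp_all add: ks_def)
  have sub: "Poly_Mapping.keys a \<subseteq> set ks" "Poly_Mapping.keys b \<subseteq> set ks" if "a + b = m" for a b
    unfolding ks(2) that[symmetric] by (auto simp: in_keys_iff lookup_add)
  have "(\<Sum>(\<beta>, \<gamma>)\<in>splittings (expos m). H (nonzeros \<beta>) (nonzeros \<gamma>))
      = (\<Sum>(a, b)\<in>{(a, b). a + b = m}.
          H (nonzeros (map (Poly_Mapping.lookup a) ks)) (nonzeros (map (Poly_Mapping.lookup b) ks)))"
    unfolding ks_def by (subst sum.reindex_bij_betw[OF bij_betw_splittings, symmetric])
      (simp add: case_prod_unfold)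
  also have "\<dots> = (\<Sum>(a, b)\<in>{(a, b). a + b = m}. H (expos a) (expos b))"
    by (rule sum.cong) (auto simp: expos_eq_filter[OF ks(1) sub(1)] expos_eq_filter[OF ks(1) sub(2)])
  finally show ?thesis ..
qed

lemma qsym_mult_eq:
  assumes "f \<in> QSym" "g \<in> QSym"
  shows "qsym_mult f g m = (\<Sum>(\<beta>, \<gamma>)\<in>splittings (expos m). coef f (nonzeros \<beta>) * coef g (nonzeros \<gamma>))"
  using sum_factorizations[where m = m and H = "\<lambda>\<beta> \<gamma>. coef f \<beta> * coef g \<gamma>"]
  unfolding qsym_mult_def
  by (simp only: QSym_coef[OF assms(1), symmetric] QSym_coef[OF assms(2), symmetric])

lemma total_degree_add: "total_degree (a + b) = total_degree a + total_degree b"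
proof -
  have *: "total_degree c = (\<Sum>i\<in>Poly_Mapping.keys a \<union> Poly_Mapping.keys b. Poly_Mapping.lookup c i)"
    if "Poly_Mapping.keys c \<subseteq> Poly_Mapping.keys a \<union> Poly_Mapping.keys b" for c
    unfolding total_degree_def using that by (intro sum.mono_neutral_left) (auto simp: in_keys_iff)
  show ?thesis
    using keys_add[of a b] by (simp add: * lookup_add sum.distrib)
qed

lemma qsym_mult_closed:
  assumes f: "f \<in> QSym" and g: "g \<in> QSym"
  shows "qsym_mult f g \<in> QSym"
proof -
  obtain d e where d: "\<And>m. f m \<noteq> 0 \<Longrightarrow> total_degree m \<le> d" and e: "\<And>m. g m \<noteq> 0 \<Longrightarrow> total_degree m \<le> e"
    using QSym_bounded[OF f] QSym_bounded[OF g] by metis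
  show ?thesis
  proof (rule QSymI[where F = "\<lambda>\<alpha>. \<Sum>(\<beta>, \<gamma>)\<in>splittings \<alpha>. coef f (nonzeros \<beta>) * coef g (nonzeros \<gamma>)"])
    show "qsym_mult f g m = (\<Sum>(\<beta>, \<gamma>)\<in>splittings (expos m). coef f (nonzeros \<beta>) * coef g (nonzeros \<gamma>))"
      for m by (rule qsym_mult_eq[OF f g])
    fix m assume "qsym_mult f g m \<noteq> 0"
    then obtain a b where "a + b = m" "f a * g b \<noteq> 0"
      unfolding qsym_mult_def by (auto elim!: sum.not_neutral_contains_not_neutral)
    then show "total_degree m \<le> d + e" using d[of a] e[of b] total_degree_add[of a b] by auto
  qed
qed

lemma qsym_mult_bilinear: "bilinear_on V W qsym_mult"
proof -
  have "qsym_mult f (g + g') = qsym_mult f g + qsym_mult f g'"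
    "qsym_mult (g + g') f = qsym_mult g f + qsym_mult g' f" for f g g'
    by (rule ext; simp add: qsym_mult_def case_prod_unfold distrib_left distrib_right sum.distrib)+
  moreover have "qsym_mult f (fscale c g) = fscale c (qsym_mult f g)"
    "qsym_mult (fscale c g) f = fscale c (qsym_mult g f)" for f g c
    by (rule ext; simp add: qsym_mult_def case_prod_unfold fscale_def sum_distrib_left mult_ac)+
  ultimately show ?thesis unfolding bilinear_on_def linear_on_def by (intro conjI ballI allI)
qed

lemma qsym_mult_assoc: "qsym_mult (qsym_mult f g) h = qsym_mult f (qsym_mult g h)"
proof
  fix m
  let ?P = "\<lambda>m :: nat \<Rightarrow>\<^sub>0 nat. {(a, b). a + b = m}"
  have "qsym_mult (qsym_mult f g) h m
      = (\<Sum>p\<in>?P m. \<Sum>q\<in>?P (fst p). f (fst q) * g (snd q) * h (snd p))"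
    by (simp add: qsym_mult_def case_prod_unfold sum_distrib_right)
  also have "\<dots> = (\<Sum>(p, q)\<in>Sigma (?P m) (\<lambda>p. ?P (fst p)). f (fst q) * g (snd q) * h (snd p))"
    by (rule sum.Sigma) (auto intro: finite_factorizations)
  also have "\<dots> = (\<Sum>(p, q)\<in>Sigma (?P m) (\<lambda>p. ?P (snd p)). f (fst p) * g (fst q) * h (snd q))"
    by (rule sum.reindex_bij_witness[where i = "\<lambda>((a, x), (b, c)). ((a + b, c), (a, b))"
          and j = "\<lambda>((x, c), (a, b)). ((a, b + c), (b, c))"]) (auto simp: add.assoc)
  also have "\<dots> = (\<Sum>p\<in>?P m. \<Sum>q\<in>?P (snd p). f (fst p) * g (fst q) * h (snd q))"
    by (rule sum.Sigma[symmetric]) (auto intro: finite_factorizations)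
  also have "\<dots> = qsym_mult f (qsym_mult g h) m"
    by (simp add: qsym_mult_def case_prod_unfold sum_distrib_left mult.assoc)
  finally show "qsym_mult (qsym_mult f g) h m = qsym_mult f (qsym_mult g h) m" .
qed

lemma Nil_composition: "[] \<in> compositions"
  by (simp add: compositions_def)

lemma expos_eq_Nil: "expos m = [] \<longleftrightarrow> m = 0"
  by (auto simp: expos_def)

lemma qsym_one: "qsym_M [] m = of_bool (m = 0)"
  by (simp add: qsym_M_eq Nil_composition expos_eq_Nil)

lemma qsym_mult_one: "qsym_mult (qsym_M []) f = f" "qsym_mult f (qsym_M []) = f"
proof -
  have fin: "finite {(a, b). a + b = (m :: nat \<Rightarrow>\<^sub>0 nat)}" for m by (rule finite_factorizations)
  show "qsym_mult (qsym_M []) f = f"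
  proof
    fix m
    have "qsym_mult (qsym_M []) f m = (\<Sum>p\<in>{(a, b). a + b = m}. if p = (0, m) then f m else 0)"
      unfolding qsym_mult_def by (rule sum.cong) (auto simp: qsym_one)
    then show "qsym_mult (qsym_M []) f m = f m" using fin by simp
  qed
  show "qsym_mult f (qsym_M []) = f"
  proof
    fix m
    have "qsym_mult f (qsym_M []) m = (\<Sum>p\<in>{(a, b). a + b = m}. if p = (m, 0) then f m else 0)"
      unfolding qsym_mult_def by (rule sum.cong) (auto simp: qsym_one)
    then show "qsym_mult f (qsym_M []) m = f m" using fin by simp
  qed
qed

lemma qsym_mult_at_0: "qsym_mult f g 0 = f 0 * g 0"
proof -
  have "{(a, b). a + b = (0 :: nat \<Rightarrow>\<^sub>0 nat)} = {(0, 0)}"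
  proof -
    have "a = 0 \<and> b = 0" if "a + b = (0 :: nat \<Rightarrow>\<^sub>0 nat)" for a b
      using that by (simp add: poly_mapping_eq_iff fun_eq_iff lookup_add)
    then have "{(a, b). a + b = (0 :: nat \<Rightarrow>\<^sub>0 nat)} \<subseteq> {(0, 0)}" by blast
    then show ?thesis by (rule equalityI) simp
  qed
  then show ?thesis by (simp only: qsym_mult_def) simp
qed

lemma algebra_on_QSym: "algebra_on QSym qsym_mult (qsym_M [])"
  by (rule algebra_on.intro)
    (simp_all add: subspace_QSym qsym_mult_closed qsym_mult_bilinear qsym_mult_assoc qsym_M_in_QSym
      Nil_composition qsym_mult_one)

section \<open>The coproduct of quasisymmetric functions\<close>

lemma append_composition: "\<beta> @ \<gamma> \<in> compositions \<longleftrightarrow> \<beta> \<in> compositions \<and> \<gamma> \<in> compositions"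
  by (auto simp: compositions_def)

lemma take_drop_composition:
  "\<alpha> \<in> compositions \<Longrightarrow> take k \<alpha> \<in> compositions" "\<alpha> \<in> compositions \<Longrightarrow> drop k \<alpha> \<in> compositions"
  by (auto simp: compositions_def dest: in_set_takeD in_set_dropD)

lemma bij_betw_deconcatenations:
  "bij_betw (\<lambda>k. (take k \<alpha>, drop k \<alpha>)) {..length \<alpha>} {(\<beta>, \<gamma>). \<beta> @ \<gamma> = \<alpha>}"
  by (rule bij_betw_byWitness[where f' = "\<lambda>(\<beta>, \<gamma>). length \<beta>"]) auto

lemma sum_deconcatenations:
  "(\<Sum>(\<beta>, \<gamma>)\<in>{(\<beta>, \<gamma>). \<beta> @ \<gamma> = \<alpha>}. H \<beta> \<gamma>) = (\<Sum>k\<le>length \<alpha>. H (take k \<alpha>) (drop k \<alpha>))"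
  using sum.reindex_bij_betw[OF bij_betw_deconcatenations, of "\<lambda>(\<beta>, \<gamma>). H \<beta> \<gamma>" \<alpha>] by simp

lemma qsym_comult_linear: "linear_on QSym qsym_comult"
  using lin_ext_linear[OF indep_qsym_M] unfolding qsym_comult_def span_qsym_M .

text \<open>The deconcatenations of \<open>\<alpha>\<close> are indexed here by the length of the first part.\<close>

lemma qsym_comult_M:
  assumes "\<alpha> \<in> compositions"
  shows "qsym_comult (qsym_M \<alpha>) = (\<Sum>k\<le>length \<alpha>. qsym_M (take k \<alpha>) \<otimes>\<^sub>t qsym_M (drop k \<alpha>))"
  unfolding qsym_comult_def lin_ext_basis[OF indep_qsym_M assms] by (rule sum_deconcatenations)

lemma qsym_comult_closed: "f \<in> QSym \<Longrightarrow> qsym_comult f \<in> tensor QSym QSym"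
proof (rule linear_on_span_closed[OF _ subspace_tensor, of "qsym_M ` compositions"])
  fix f assume "f \<in> qsym_M ` compositions"
  then obtain \<alpha> where \<alpha>: "\<alpha> \<in> compositions" "f = qsym_M \<alpha>" by blast
  show "qsym_comult f \<in> tensor QSym QSym"
    unfolding \<alpha>(2) qsym_comult_M[OF \<alpha>(1)]
    by (intro fs.subspace_sum[OF subspace_tensor] pure_in_tensor qsym_M_in_QSym take_drop_composition \<alpha>(1))
qed (simp_all only: span_qsym_M qsym_comult_linear)

text \<open>A product of \<open>a\<close> with a copy of \<open>b\<close> in later variables, normalised to use the first variables.\<close>

definition cat :: "(nat \<Rightarrow>\<^sub>0 nat) \<Rightarrow> (nat \<Rightarrow>\<^sub>0 nat) \<Rightarrow> (nat \<Rightarrow>\<^sub>0 nat)" where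
  "cat a b = monomial [0..<length (expos a @ expos b)] (expos a @ expos b)"

lemma expos_cat: "expos (cat a b) = expos a @ expos b"
  unfolding cat_def by (rule expos_upt) (simp add: append_composition expos_composition)

lemma coef_append: "coef f (expos a @ expos b) = f (cat a b)"
  by (simp only: coef_def cat_def)

text \<open>The coproduct separates the variables into two alphabets, one after the other.  It suffices
  to check this on monomial functions, where exactly one deconcatenation contributes.\<close>

lemma qsym_comult_eq:
  assumes "f \<in> QSym"
  shows "qsym_comult f = (\<lambda>(a, b). f (cat a b))"
proof (rule linear_on_span_eqI[of "qsym_M ` compositions" qsym_comult "\<lambda>f (a, b). f (cat a b)"])
  show "linear_on (fs.span (qsym_M ` compositions)) (\<lambda>f (a, b). f (cat a b))"
    by (auto simp: linear_on_def fscale_def)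
  fix f assume "f \<in> qsym_M ` compositions"
  then obtain \<alpha> where \<alpha>: "\<alpha> \<in> compositions" "f = qsym_M \<alpha>" by blast
  show "qsym_comult f = (\<lambda>(a, b). f (cat a b))"
  proof (rule ext, clarify)
    fix a b
    have "(\<Sum>k\<le>length \<alpha>. qsym_M (take k \<alpha>) \<otimes>\<^sub>t qsym_M (drop k \<alpha>)) (a, b)
        = (\<Sum>k\<le>length \<alpha>. of_bool (expos a = take k \<alpha> \<and> expos b = drop k \<alpha>))"
      unfolding sum_fun_apply
      by (rule sum.cong) (simp_all add: pure_def qsym_M_eq take_drop_composition \<alpha>(1))
    also have "\<dots> = (\<Sum>k\<le>length \<alpha>. if k = length (expos a) then of_bool (expos a @ expos b = \<alpha>) else 0)"
    proof (rule sum.cong[OF refl])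
      fix k assume "k \<in> {..length \<alpha>}"
      then have "expos a = take k \<alpha> \<and> expos b = drop k \<alpha> \<longleftrightarrow> k = length (expos a) \<and> expos a @ expos b = \<alpha>"
        by (metis append_eq_conv_conj append_take_drop_id atMost_iff length_take min.absorb2)
      then show "of_bool (expos a = take k \<alpha> \<and> expos b = drop k \<alpha>)
          = (if k = length (expos a) then of_bool (expos a @ expos b = \<alpha>) else 0 :: complex)"
        by simp
    qed
    also have "\<dots> = of_bool (expos a @ expos b = \<alpha>)" by auto
    also have "\<dots> = qsym_M \<alpha> (cat a b)" by (simp add: qsym_M_eq \<alpha>(1) expos_cat)
    finally show "qsym_comult f (a, b) = f (cat a b)" unfolding \<alpha>(2) qsym_comult_M[OF \<alpha>(1)] .
  qed
qed (simp_all only: span_qsym_M qsym_comult_linear assms)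

lemma QSym_cong: "f \<in> QSym \<Longrightarrow> expos a = expos b \<Longrightarrow> f a = f b"
  using QSym_coef[of f a] QSym_coef[of f b] by simp

text \<open>With the coproduct written as evaluation at \<open>cat a b\<close>, the axioms express that concatenation
  of exponent sequences is associative and that the monomial 0, the empty product, is neutral for it.\<close>

lemma coalgebra_on_QSym: "coalgebra_on QSym qsym_comult (\<lambda>f. f 0)"
proof (rule coalgebra_on.intro[OF subspace_QSym qsym_comult_closed qsym_comult_linear])
  note V = subspace_QSym and D = qsym_comult_linear and id = linear_on_id(2)
  show form: "linear_form_on QSym (\<lambda>f. f 0)" by (simp add: linear_form_on_def fscale_def)
  fix f assume f: "f \<in> QSym"
  note Df = qsym_comult_closed[OF f]
  have 1: "tensor_map QSym QSym qsym_comult id t = (\<lambda>((a, b), c). t (cat a b, c))"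
    if t: "t \<in> tensor QSym QSym" for t
  proof (rule tensor_eqI[OF t tensor_map_linear[OF V V D id]])
    show "linear_on (tensor QSym QSym) (\<lambda>t ((a, b), c). t (cat a b, c))"
      by (auto simp: linear_on_def fscale_def)
    show "tensor_map QSym QSym qsym_comult id (v \<otimes>\<^sub>t w) = (\<lambda>((a, b), c). (v \<otimes>\<^sub>t w) (cat a b, c))"
      if "v \<in> QSym" "w \<in> QSym" for v w
      unfolding tensor_map_pure[OF V V D id that] qsym_comult_eq[OF that(1)] by (auto simp: pure_def)
  qed
  have 2: "tensor_map QSym QSym id qsym_comult t = (\<lambda>(a, b, c). t (a, cat b c))"
    if t: "t \<in> tensor QSym QSym" for t
  proof (rule tensor_eqI[OF t tensor_map_linear[OF V V id D]])
    show "linear_on (tensor QSym QSym) (\<lambda>t (a, b, c). t (a, cat b c))"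
      by (auto simp: linear_on_def fscale_def)
    show "tensor_map QSym QSym id qsym_comult (v \<otimes>\<^sub>t w) = (\<lambda>(a, b, c). (v \<otimes>\<^sub>t w) (a, cat b c))"
      if "v \<in> QSym" "w \<in> QSym" for v w
      unfolding tensor_map_pure[OF V V id D that] qsym_comult_eq[OF that(2)] by (auto simp: pure_def)
  qed
  have "f (cat (cat a b) c) = f (cat a (cat b c))" for a b c
    by (rule QSym_cong[OF f]) (simp add: expos_cat)
  then show "reassoc (tensor_map QSym QSym qsym_comult id (qsym_comult f))
      = tensor_map QSym QSym id qsym_comult (qsym_comult f)"
    unfolding 1[OF Df] 2[OF Df] unfolding qsym_comult_eq[OF f] by (simp add: reassoc_def)
  have 0: "expos 0 = []" by (simp add: expos_eq_Nil)
  have "f (cat 0 a) = f a" "f (cat a 0) = f a" for a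
    by (rule QSym_cong[OF f], simp add: expos_cat 0)+
  note f0 = this
  note bil = bilinear_counit[OF form]
  show "tensor_lift QSym QSym (\<lambda>v w. fscale (v 0) w) (qsym_comult f) = f"
  proof -
    have "tensor_lift QSym QSym (\<lambda>v w. fscale (v 0) w) (qsym_comult f) = (\<lambda>b. qsym_comult f (0, b))"
    proof (rule tensor_eqI[OF Df tensor_lift_universal(1)[OF V V bil(1)]])
      show "linear_on (tensor QSym QSym) (\<lambda>t b. t (0, b))" by (auto simp: linear_on_def fscale_def)
    qed (simp only: tensor_lift_universal(2)[OF V V bil(1)], simp add: fscale_def pure_def)
    then show ?thesis by (simp add: qsym_comult_eq[OF f] f0)
  qed
  show "tensor_lift QSym QSym (\<lambda>v w. fscale (w 0) v) (qsym_comult f) = f"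
  proof -
    have "tensor_lift QSym QSym (\<lambda>v w. fscale (w 0) v) (qsym_comult f) = (\<lambda>a. qsym_comult f (a, 0))"
    proof (rule tensor_eqI[OF Df tensor_lift_universal(1)[OF V V bil(2)]])
      show "linear_on (tensor QSym QSym) (\<lambda>t a. t (a, 0))" by (auto simp: linear_on_def fscale_def)
    qed (simp only: tensor_lift_universal(2)[OF V V bil(2)], simp add: fscale_def pure_def mult.commute)
    then show ?thesis by (simp add: qsym_comult_eq[OF f] f0)
  qed
qed

definition tensor_convolution ::
  "((nat \<Rightarrow>\<^sub>0 nat) \<times> (nat \<Rightarrow>\<^sub>0 nat) \<Rightarrow> complex) \<Rightarrow> ((nat \<Rightarrow>\<^sub>0 nat) \<times> (nat \<Rightarrow>\<^sub>0 nat) \<Rightarrow> complex) \<Rightarrow>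
   ((nat \<Rightarrow>\<^sub>0 nat) \<times> (nat \<Rightarrow>\<^sub>0 nat) \<Rightarrow> complex)" where
  "tensor_convolution s t = (\<lambda>(a, b). \<Sum>p\<in>{(c, d). c + d = a}. \<Sum>q\<in>{(c, d). c + d = b}.
     s (fst p, fst q) * t (snd p, snd q))"

text \<open>The product on the tensor square is the product of power series in two sets of variables.\<close>

lemma tensor_mul_QSym:
  assumes "s \<in> tensor QSym QSym" "t \<in> tensor QSym QSym"
  shows "tensor_mul QSym qsym_mult s t = tensor_convolution s t"
proof (rule tensor_mul_unique[OF subspace_QSym qsym_mult_bilinear qsym_mult_closed assms, of _ "\<lambda>x. x"])
  show "linear_on (tensor QSym QSym) (\<lambda>s. tensor_convolution s t)" for t
    unfolding linear_on_def
  proof (intro conjI ballI allI)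
    show "tensor_convolution (v + w) t = tensor_convolution v t + tensor_convolution w t" for v w
      by (rule ext) (simp add: tensor_convolution_def case_prod_unfold distrib_right sum.distrib)
    show "tensor_convolution (fscale r v) t = fscale r (tensor_convolution v t)" for v r
      by (rule ext) (simp add: tensor_convolution_def case_prod_unfold fscale_def sum_distrib_left mult.assoc)
  qed
  show "linear_on (tensor QSym QSym) (tensor_convolution s)" for s
    unfolding linear_on_def
  proof (intro conjI ballI allI)
    show "tensor_convolution s (v + w) = tensor_convolution s v + tensor_convolution s w" for v w
      by (rule ext) (simp add: tensor_convolution_def case_prod_unfold distrib_left sum.distrib)
    show "tensor_convolution s (fscale r v) = fscale r (tensor_convolution s v)" for v r
      by (rule ext) (simp add: tensor_convolution_def case_prod_unfold fscale_def sum_distrib_left mult_ac)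
  qed
  show "tensor_convolution (a \<otimes>\<^sub>t b) (c \<otimes>\<^sub>t d) = qsym_mult a c \<otimes>\<^sub>t qsym_mult b d" for a b c d
    by (rule ext) (simp add: tensor_convolution_def pure_def qsym_mult_def case_prod_unfold sum_product mult_ac)
qed (assumption+, rule linear_on_id)

text \<open>Cutting both rows at the seam decomposes a splitting of a concatenation.\<close>

lemma bij_betw_splittings_append:
  "bij_betw (\<lambda>((\<beta>, \<gamma>), (\<beta>', \<gamma>')). (\<beta> @ \<beta>', \<gamma> @ \<gamma>')) (splittings \<alpha> \<times> splittings \<alpha>') (splittings (\<alpha> @ \<alpha>'))"
  (is "bij_betw ?f _ _")
proof -
  let ?n = "length \<alpha>"
  let ?g = "\<lambda>(\<beta>, \<gamma>). ((take ?n \<beta>, take ?n \<gamma>), (drop ?n \<beta>, drop ?n \<gamma>))"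
  have len: "length \<beta> = length \<alpha>'' \<and> length \<gamma> = length \<alpha>''" if "(\<beta>, \<gamma>) \<in> splittings \<alpha>''" for \<beta> \<gamma> \<alpha>''
    using that by (simp add: splittings_def)
  have "map2 (+) (take ?n \<beta>) (take ?n \<gamma>) = \<alpha>" "map2 (+) (drop ?n \<beta>) (drop ?n \<gamma>) = \<alpha>'"
    if "map2 (+) \<beta> \<gamma> = \<alpha> @ \<alpha>'" for \<beta> \<gamma>
  proof -
    show "map2 (+) (take ?n \<beta>) (take ?n \<gamma>) = \<alpha>"
      using arg_cong[OF that, of "take ?n"] by (simp add: take_map take_zip)
    show "map2 (+) (drop ?n \<beta>) (drop ?n \<gamma>) = \<alpha>'"
      using arg_cong[OF that, of "drop ?n"] by (simp add: drop_map drop_zip)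
  qed
  then have "?g ` splittings (\<alpha> @ \<alpha>') \<subseteq> splittings \<alpha> \<times> splittings \<alpha>'"
    by (auto simp: splittings_def)
  moreover have "\<forall>p\<in>splittings \<alpha> \<times> splittings \<alpha>'. ?g (?f p) = p"
    by (auto dest!: len)
  moreover have "\<forall>p\<in>splittings (\<alpha> @ \<alpha>'). ?f (?g p) = p" by auto
  moreover have "?f ` (splittings \<alpha> \<times> splittings \<alpha>') \<subseteq> splittings (\<alpha> @ \<alpha>')"
    by (clarify, simp add: splittings_def)
  ultimately show ?thesis by (intro bij_betw_byWitness[where f = ?f and f' = ?g])
qed

text \<open>Both sides, evaluated at \<open>(a, b)\<close>, are sums over the splittings of the exponents of \<open>a\<close> and
  \<open>b\<close>: on the left as splittings of the concatenation, on the right as pairs.  Dropping zeros commutes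
  with concatenation.\<close>

lemma qsym_comult_mult:
  assumes f: "f \<in> QSym" and g: "g \<in> QSym"
  shows "qsym_comult (qsym_mult f g) = tensor_mul QSym qsym_mult (qsym_comult f) (qsym_comult g)"
proof (rule ext, clarify)
  fix a b
  let ?H = "\<lambda>\<beta> \<gamma> \<beta>' \<gamma>'. coef f (\<beta> @ \<beta>') * coef g (\<gamma> @ \<gamma>')"
  have "qsym_comult (qsym_mult f g) (a, b) = qsym_mult f g (cat a b)"
    by (simp add: qsym_comult_eq qsym_mult_closed f g)
  also have "\<dots> = (\<Sum>(\<beta>, \<gamma>)\<in>splittings (expos a @ expos b). coef f (nonzeros \<beta>) * coef g (nonzeros \<gamma>))"
    unfolding qsym_mult_eq[OF f g] expos_cat ..
  also have "\<dots> = (\<Sum>(p, q)\<in>splittings (expos a) \<times> splittings (expos b).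
      ?H (nonzeros (fst p)) (nonzeros (snd p)) (nonzeros (fst q)) (nonzeros (snd q)))"
    by (subst sum.reindex_bij_betw[OF bij_betw_splittings_append, symmetric]) (simp add: case_prod_unfold)
  also have "\<dots> = (\<Sum>(\<beta>, \<gamma>)\<in>splittings (expos a). \<Sum>(\<beta>', \<gamma>')\<in>splittings (expos b).
      ?H (nonzeros \<beta>) (nonzeros \<gamma>) (nonzeros \<beta>') (nonzeros \<gamma>'))"
    by (simp add: sum.cartesian_product case_prod_unfold)
  also have "\<dots> = (\<Sum>(\<beta>, \<gamma>)\<in>splittings (expos a). \<Sum>(c', d')\<in>{(c, d). c + d = b}.
      ?H (nonzeros \<beta>) (nonzeros \<gamma>) (expos c') (expos d'))"
    by (rule sum.cong[OF refl], clarify,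
        rule sum_factorizations[where H = "?H (nonzeros \<beta>) (nonzeros \<gamma>)" for \<beta> \<gamma>, symmetric])
  also have "\<dots> = (\<Sum>(c, d)\<in>{(c, d). c + d = a}. \<Sum>(c', d')\<in>{(c, d). c + d = b}.
      ?H (expos c) (expos d) (expos c') (expos d'))"
    by (rule sum_factorizations[where H = "\<lambda>\<beta> \<gamma>. \<Sum>(c', d')\<in>{(c, d). c + d = b}. ?H \<beta> \<gamma> (expos c') (expos d')",
          symmetric])
  also have "\<dots> = tensor_convolution (qsym_comult f) (qsym_comult g) (a, b)"
    by (simp add: tensor_convolution_def qsym_comult_eq f g coef_append case_prod_unfold)
  finally show "qsym_comult (qsym_mult f g) (a, b)
      = tensor_mul QSym qsym_mult (qsym_comult f) (qsym_comult g) (a, b)"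
    by (simp add: tensor_mul_QSym qsym_comult_closed f g)
qed

lemma bialgebra_on_QSym: "bialgebra_on QSym qsym_mult (qsym_M []) qsym_comult (\<lambda>f. f 0)"
proof (rule bialgebra_on.intro[OF algebra_on_QSym coalgebra_on_QSym], rule bialgebra_on_axioms.intro)
  show "qsym_comult (qsym_M []) = qsym_M [] \<otimes>\<^sub>t qsym_M []"
    using qsym_comult_M[OF Nil_composition] by simp
qed (simp_all only: qsym_comult_mult qsym_mult_at_0, simp add: qsym_one)

section \<open>The antipode of quasisymmetric functions\<close>

text \<open>The two recursions solve the equations \<open>S \<star> id = \<epsilon>\<close> and \<open>id \<star> S = \<epsilon>\<close> for the value at \<open>M\<^sub>\<alpha>\<close>: in the
  deconcatenation sum for \<open>\<alpha>\<close> all other terms involve shorter sequences.\<close>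

function left_antipode :: "nat list \<Rightarrow> series" where
  "left_antipode \<alpha> = (if \<alpha> = [] then qsym_M []
     else fscale (-1) (\<Sum>k<length \<alpha>. qsym_mult (left_antipode (take k \<alpha>)) (qsym_M (drop k \<alpha>))))"
  by auto
termination by (relation "measure length") auto

function right_antipode :: "nat list \<Rightarrow> series" where
  "right_antipode \<alpha> = (if \<alpha> = [] then qsym_M []
     else fscale (-1) (\<Sum>k<length \<alpha>. qsym_mult (qsym_M (take (Suc k) \<alpha>)) (right_antipode (drop (Suc k) \<alpha>))))"
  by auto
termination by (relation "measure length") auto

declare left_antipode.simps [simp del] right_antipode.simps [simp del]

text \<open>The convolution of linear maps, given by their values on the monomial basis.\<close>

definition convolve :: "(nat list \<Rightarrow> series) \<Rightarrow> (nat list \<Rightarrow> series) \<Rightarrow> nat list \<Rightarrow> series" where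
  "convolve u v \<alpha> = (\<Sum>k\<le>length \<alpha>. qsym_mult (u (take k \<alpha>)) (v (drop k \<alpha>)))"

definition convolve_unit :: "nat list \<Rightarrow> series" where
  "convolve_unit \<alpha> = (if \<alpha> = [] then qsym_M [] else 0)"

lemma qsym_mult_sum:
  "qsym_mult (\<Sum>i\<in>I. f i) g = (\<Sum>i\<in>I. qsym_mult (f i) g)"
  "qsym_mult g (\<Sum>i\<in>I. f i) = (\<Sum>i\<in>I. qsym_mult g (f i))"
proof -
  have "qsym_mult (\<Sum>i\<in>I. f i) g m = (\<Sum>i\<in>I. qsym_mult (f i) g m)" for m
    unfolding qsym_mult_def sum_fun_apply case_prod_unfold sum_distrib_right by (rule sum.swap)
  then show "qsym_mult (\<Sum>i\<in>I. f i) g = (\<Sum>i\<in>I. qsym_mult (f i) g)"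
    by (intro ext) (simp only: sum_fun_apply)
  have "qsym_mult g (\<Sum>i\<in>I. f i) m = (\<Sum>i\<in>I. qsym_mult g (f i) m)" for m
    unfolding qsym_mult_def sum_fun_apply case_prod_unfold sum_distrib_left by (rule sum.swap)
  then show "qsym_mult g (\<Sum>i\<in>I. f i) = (\<Sum>i\<in>I. qsym_mult g (f i))"
    by (intro ext) (simp only: sum_fun_apply)
qed

lemma qsym_mult_zero: "qsym_mult 0 f = 0" "qsym_mult f 0 = 0"
  using qsym_mult_sum(1)[of "\<lambda>_. 0" "{}" f] qsym_mult_sum(2)[of f "\<lambda>_. 0" "{}"] by simp_all

text \<open>Both sides sum over the ways to cut \<open>\<alpha>\<close> into three parts.\<close>

lemma convolve_assoc: "convolve (convolve u v) w \<alpha> = convolve u (convolve v w) \<alpha>"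
proof -
  let ?n = "length \<alpha>"
  let ?t = "\<lambda>j k. qsym_mult (u (take j \<alpha>)) (qsym_mult (v (drop j (take k \<alpha>))) (w (drop k \<alpha>)))"
  have "convolve (convolve u v) w \<alpha> = (\<Sum>k\<le>?n. \<Sum>j\<le>k. ?t j k)"
    unfolding convolve_def qsym_mult_sum
    by (rule sum.cong[OF refl], rule sum.cong) (auto simp: qsym_mult_assoc min_def)
  also have "\<dots> = (\<Sum>j\<le>?n. \<Sum>i\<le>?n - j. ?t j (j + i))"
    unfolding sum.Sigma[OF finite_atMost ballI[OF finite_atMost]]
    by (rule sum.reindex_bij_witness[where i = "\<lambda>(j, i). (j + i, j)" and j = "\<lambda>(k, j). (j, k - j)"]) auto
  also have "\<dots> = convolve u (convolve v w) \<alpha>"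
    unfolding convolve_def qsym_mult_sum
    by (rule sum.cong[OF refl], rule sum.cong) (auto simp: take_drop add.commute)
  finally show ?thesis .
qed

lemma convolve_unit: "convolve u convolve_unit \<alpha> = u \<alpha>" "convolve convolve_unit u \<alpha> = u \<alpha>"
proof -
  have "convolve u convolve_unit \<alpha> = (\<Sum>k\<le>length \<alpha>. if k = length \<alpha> then u \<alpha> else 0)"
    unfolding convolve_def
    by (rule sum.cong) (auto simp: convolve_unit_def qsym_mult_one qsym_mult_zero simp del: zero_fun_apply)
  then show "convolve u convolve_unit \<alpha> = u \<alpha>" by simp
  have "convolve convolve_unit u \<alpha> = (\<Sum>k\<le>length \<alpha>. if k = 0 then u \<alpha> else 0)"
    unfolding convolve_def
    by (rule sum.cong) (auto simp: convolve_unit_def qsym_mult_one qsym_mult_zero simp del: zero_fun_apply)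
  then show "convolve convolve_unit u \<alpha> = u \<alpha>" by simp
qed

lemma fscale_neg: "fscale (-1) f + f = 0" "f + fscale (-1) f = 0"
  by (auto simp: fscale_def fun_eq_iff)

lemma convolve_left_antipode: "convolve left_antipode qsym_M = convolve_unit"
proof
  fix \<alpha>
  show "convolve left_antipode qsym_M \<alpha> = convolve_unit \<alpha>"
  proof (cases "\<alpha> = []")
    case True
    have "left_antipode [] = qsym_M []" by (simp add: left_antipode.simps)
    then show ?thesis using True by (simp add: convolve_def convolve_unit_def qsym_mult_one)
  next
    case False
    have "convolve left_antipode qsym_M \<alpha>
        = (\<Sum>k<length \<alpha>. qsym_mult (left_antipode (take k \<alpha>)) (qsym_M (drop k \<alpha>))) + left_antipode \<alpha>"
      unfolding convolve_def lessThan_Suc_atMost[symmetric] sum.lessThan_Suc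
      by (simp only: take_all drop_all order_refl qsym_mult_one)
    also have "\<dots> = 0"
      by (subst (2) left_antipode.simps) (simp only: False if_False fscale_neg)
    finally show ?thesis using False by (simp only: convolve_unit_def if_False)
  qed
qed

lemma convolve_right_antipode: "convolve qsym_M right_antipode = convolve_unit"
proof
  fix \<alpha>
  show "convolve qsym_M right_antipode \<alpha> = convolve_unit \<alpha>"
  proof (cases "\<alpha> = []")
    case True
    have "right_antipode [] = qsym_M []" by (simp add: right_antipode.simps)
    then show ?thesis using True by (simp add: convolve_def convolve_unit_def qsym_mult_one)
  next
    case False
    have "convolve qsym_M right_antipode \<alpha> = right_antipode \<alpha> +
        (\<Sum>k<length \<alpha>. qsym_mult (qsym_M (take (Suc k) \<alpha>)) (right_antipode (drop (Suc k) \<alpha>)))"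
      unfolding convolve_def sum.atMost_shift
      by (simp only: take_0 drop_0 qsym_mult_one)
    also have "\<dots> = 0"
      by (subst right_antipode.simps) (simp only: False if_False fscale_neg)
    finally show ?thesis using False by (simp only: convolve_unit_def if_False)
  qed
qed

text \<open>In a monoid a left inverse and a right inverse of the same element coincide; here the monoid
  is that of maps under convolution, and the element is the identity map, \<open>qsym_M\<close>.\<close>

lemma left_antipode_eq_right: "left_antipode = right_antipode"
proof
  fix \<alpha>
  have "left_antipode \<alpha> = convolve left_antipode (convolve qsym_M right_antipode) \<alpha>"
    by (simp only: convolve_right_antipode convolve_unit)
  also have "\<dots> = convolve (convolve left_antipode qsym_M) right_antipode \<alpha>"
    by (rule convolve_assoc[symmetric])
  also have "\<dots> = right_antipode \<alpha>" by (simp only: convolve_left_antipode convolve_unit)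
  finally show "left_antipode \<alpha> = right_antipode \<alpha>" .
qed

lemma left_antipode_closed: "\<alpha> \<in> compositions \<Longrightarrow> left_antipode \<alpha> \<in> QSym"
proof (induction \<alpha> rule: left_antipode.induct)
  case (1 \<alpha>)
  show ?case
  proof (cases "\<alpha> = []")
    case True
    then show ?thesis by (simp add: left_antipode.simps qsym_M_in_QSym Nil_composition)
  next
    case False
    have S: "(\<Sum>k<length \<alpha>. qsym_mult (left_antipode (take k \<alpha>)) (qsym_M (drop k \<alpha>))) \<in> QSym"
      by (intro fs.subspace_sum[OF subspace_QSym] qsym_mult_closed 1 False qsym_M_in_QSym
          take_drop_composition)
    show ?thesis
      by (subst left_antipode.simps) (simp only: False if_False fs.subspace_scale[OF subspace_QSym S])
  qed
qed

definition qsym_antipode :: "series \<Rightarrow> series" where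
  "qsym_antipode = lin_ext compositions qsym_M left_antipode"

lemma qsym_antipode_linear: "linear_on QSym qsym_antipode"
  using lin_ext_linear[OF indep_qsym_M] unfolding qsym_antipode_def span_qsym_M .

lemma qsym_antipode_M: "\<alpha> \<in> compositions \<Longrightarrow> qsym_antipode (qsym_M \<alpha>) = left_antipode \<alpha>"
  unfolding qsym_antipode_def by (rule lin_ext_basis[OF indep_qsym_M])

lemma qsym_antipode_closed: "f \<in> QSym \<Longrightarrow> qsym_antipode f \<in> QSym"
proof (rule linear_on_span_closed[where f = qsym_antipode and B = "qsym_M ` compositions", OF _ subspace_QSym])
  show "qsym_antipode f \<in> QSym" if "f \<in> qsym_M ` compositions" for f
    using that by (auto simp: qsym_antipode_M left_antipode_closed)
qed (simp_all only: span_qsym_M qsym_antipode_linear)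

lemma qsym_M_at_0: "\<alpha> \<in> compositions \<Longrightarrow> fscale (qsym_M \<alpha> 0) (qsym_M []) = convolve_unit \<alpha>"
  using expos_eq_Nil[of 0] by (auto simp: qsym_M_eq convolve_unit_def)

lemma tensor_lift_comult_M:
  assumes \<alpha>: "\<alpha> \<in> compositions" and B: "bilinear_on QSym QSym B"
  shows "tensor_lift QSym QSym B (qsym_comult (qsym_M \<alpha>))
       = (\<Sum>k\<le>length \<alpha>. B (qsym_M (take k \<alpha>)) (qsym_M (drop k \<alpha>)))"
proof -
  note lift = tensor_lift_universal[OF subspace_QSym subspace_QSym B]
  note in_QSym = qsym_M_in_QSym[OF take_drop_composition(1)[OF \<alpha>]] qsym_M_in_QSym[OF take_drop_composition(2)[OF \<alpha>]]
  show ?thesis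
    using linear_on_sum[OF subspace_tensor lift(1), of "{..length \<alpha>}"
        "\<lambda>k. qsym_M (take k \<alpha>) \<otimes>\<^sub>t qsym_M (drop k \<alpha>)" "\<lambda>_. 1"]
    by (simp add: qsym_comult_M[OF \<alpha>] pure_in_tensor in_QSym lift(2))
qed

text \<open>Each antipode axiom reduces to a statement about convolutions on the monomial basis.\<close>

lemma tensor_lift_comult_unit:
  assumes B: "bilinear_on QSym QSym B"
    and unit: "\<And>\<alpha>. \<alpha> \<in> compositions \<Longrightarrow>
      (\<Sum>k\<le>length \<alpha>. B (qsym_M (take k \<alpha>)) (qsym_M (drop k \<alpha>))) = convolve_unit \<alpha>"
    and f: "f \<in> QSym"
  shows "tensor_lift QSym QSym B (qsym_comult f) = fscale (f 0) (qsym_M [])"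
proof (rule linear_on_span_eqI[where f = "\<lambda>f. tensor_lift QSym QSym B (qsym_comult f)"
      and B = "qsym_M ` compositions", unfolded span_qsym_M])
  note lift = tensor_lift_universal(1)[OF subspace_QSym subspace_QSym B]
  show "linear_on QSym (\<lambda>f. tensor_lift QSym QSym B (qsym_comult f))"
    by (rule linear_on_comp[OF qsym_comult_linear lift qsym_comult_closed])
  show "linear_on QSym (\<lambda>f. fscale (f 0) (qsym_M []))"
    by (auto simp: linear_on_def fscale_def fun_eq_iff algebra_simps)
  fix g assume "g \<in> qsym_M ` compositions"
  then obtain \<alpha> where \<alpha>: "\<alpha> \<in> compositions" "g = qsym_M \<alpha>" by blast
  show "tensor_lift QSym QSym B (qsym_comult g) = fscale (g 0) (qsym_M [])"
    unfolding \<alpha>(2) by (simp only: tensor_lift_comult_M[OF \<alpha>(1) B] unit \<alpha>(1) qsym_M_at_0)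
qed (rule f)

theorem hopf_algebra_on_QSym:
  "hopf_algebra_on QSym qsym_mult (qsym_M []) qsym_comult (\<lambda>f. f 0) qsym_antipode"
proof (rule hopf_algebra_on.intro[OF bialgebra_on_QSym], rule hopf_algebra_on_axioms.intro)
  fix f assume f: "f \<in> QSym"
  have bil: "bilinear_on QSym QSym (\<lambda>v w. qsym_mult (qsym_antipode v) w)"
      "bilinear_on QSym QSym (\<lambda>v w. qsym_mult v (qsym_antipode w))"
    by (rule bilinear_antipode[OF qsym_mult_bilinear qsym_antipode_linear qsym_antipode_closed], assumption)+
  show "tensor_lift QSym QSym (\<lambda>v w. qsym_mult (qsym_antipode v) w) (qsym_comult f) = fscale (f 0) (qsym_M [])"
    by (rule tensor_lift_comult_unit[OF bil(1) _ f])
      (simp only: convolve_left_antipode[symmetric] convolve_def qsym_antipode_M take_drop_composition)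
  show "tensor_lift QSym QSym (\<lambda>v w. qsym_mult v (qsym_antipode w)) (qsym_comult f) = fscale (f 0) (qsym_M [])"
    by (rule tensor_lift_comult_unit[OF bil(2) _ f])
      (simp only: convolve_right_antipode[symmetric] left_antipode_eq_right[symmetric]
        convolve_def qsym_antipode_M take_drop_composition)
qed (simp_all only: qsym_antipode_closed qsym_antipode_linear)

section \<open>Irreducible characters of commutative groups\<close>

text \<open>Homomorphisms into the multiplicative group of complex numbers, extended by 0 outside the
  carrier as in \<open>irr_chars\<close>.  The value 1 at the identity excludes the zero function.\<close>

definition lin_chars :: "('a, 'm) monoid_scheme \<Rightarrow> ('a \<Rightarrow> complex) set" where
  "lin_chars G = {\<chi>. (\<forall>g\<in>carrier G. \<forall>h\<in>carrier G. \<chi> (g \<otimes>\<^bsub>G\<^esub> h) = \<chi> g * \<chi> h) \<and>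
     \<chi> \<one>\<^bsub>G\<^esub> = 1 \<and> (\<forall>g. g \<notin> carrier G \<longrightarrow> \<chi> g = 0)}"

lemma lin_charsD:
  assumes "\<chi> \<in> lin_chars G"
  shows "g \<in> carrier G \<Longrightarrow> h \<in> carrier G \<Longrightarrow> \<chi> (g \<otimes>\<^bsub>G\<^esub> h) = \<chi> g * \<chi> h"
    and "\<chi> \<one>\<^bsub>G\<^esub> = 1" and "g \<notin> carrier G \<Longrightarrow> \<chi> g = 0"
  using assms by (auto simp: lin_chars_def)

text \<open>Every operator of an irreducible representation of a commutative group is a scalar, since its
  eigenspaces are invariant; then every line is invariant, so the dimension is 1.\<close>

lemma irreducible_dim_1:
  fixes G (structure)
  assumes G: "comm_group G" and irr: "is_irreducible G d \<rho>"
  shows "d = 1"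
proof -
  interpret comm_group G by (rule G)
  have \<rho>: "\<rho> g \<in> carrier_mat d d" if "g \<in> carrier G" for g
    using irr that by (simp add: is_irreducible_def is_representation_def)
  have \<rho>_mult: "\<rho> (g \<otimes> h) = \<rho> g * \<rho> h" if "g \<in> carrier G" "h \<in> carrier G" for g h
    using irr that by (simp add: is_irreducible_def is_representation_def)
  have d: "0 < d" using irr by (simp add: is_irreducible_def)
  have irrD: "U = {0\<^sub>v d} \<or> U = carrier_vec d" if "invariant_subspace G d \<rho> U" for U
    using irr that by (simp add: is_irreducible_def)
  have scalar: "\<exists>k. \<forall>u\<in>carrier_vec d. \<rho> g *\<^sub>v u = k \<cdot>\<^sub>v u" if g: "g \<in> carrier G" for g
  proof -
    obtain k where "eigenvalue (\<rho> g) k"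
      using spectrum_non_empty[OF \<rho>[OF g] d] by (auto simp: spectrum_def)
    then obtain v where v: "v \<in> carrier_vec d" "v \<noteq> 0\<^sub>v d" "\<rho> g *\<^sub>v v = k \<cdot>\<^sub>v v"
      using \<rho>[OF g] by (auto simp: eigenvalue_def eigenvector_def)
    \<comment> \<open>The eigenspace is invariant because all operators commute with \<open>\<rho> g\<close>.\<close>
    define U where "U = {u \<in> carrier_vec d. \<rho> g *\<^sub>v u = k \<cdot>\<^sub>v u}"
    have "invariant_subspace G d \<rho> U"
      unfolding invariant_subspace_def
    proof (intro conjI ballI allI)
      show "U \<subseteq> carrier_vec d" by (auto simp: U_def)
      show "0\<^sub>v d \<in> U" using \<rho>[OF g] by (auto simp: U_def)
      show "u + w \<in> U" if "u \<in> U" "w \<in> U" for u w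
        using that \<rho>[OF g] by (auto simp: U_def mult_add_distrib_mat_vec[of _ d d] smult_add_distrib_vec[of _ d])
      show "c \<cdot>\<^sub>v u \<in> U" if "u \<in> U" for c u
        using that \<rho>[OF g] by (auto simp: U_def mult_mat_vec[of _ d d] smult_smult_assoc mult.commute)
      show "\<rho> h *\<^sub>v u \<in> U" if h: "h \<in> carrier G" and u: "u \<in> U" for h u
      proof -
        have "\<rho> g *\<^sub>v (\<rho> h *\<^sub>v u) = \<rho> (g \<otimes> h) *\<^sub>v u"
          using u \<rho>[OF g] \<rho>[OF h] by (simp add: U_def \<rho>_mult[OF g h])
        also have "\<dots> = \<rho> h *\<^sub>v (\<rho> g *\<^sub>v u)"
          using u \<rho>[OF g] \<rho>[OF h] by (simp add: U_def m_comm[OF g h] \<rho>_mult[OF h g])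
        also have "\<dots> = k \<cdot>\<^sub>v (\<rho> h *\<^sub>v u)"
          using u \<rho>[OF h] by (simp add: U_def mult_mat_vec[of _ d d])
        finally show ?thesis using u \<rho>[OF h] by (simp add: U_def)
      qed
    qed
    moreover have "v \<in> U" using v by (simp add: U_def)
    ultimately have "U = carrier_vec d" using irrD v(2) by blast
    then show ?thesis by (auto simp: U_def)
  qed
  \<comment> \<open>Since all operators are scalar, every line is invariant; take the first coordinate axis.\<close>
  define U where "U = {c \<cdot>\<^sub>v (unit_vec d 0 :: complex vec) | c. True}"
  have e: "(unit_vec d 0 :: complex vec) \<in> U"
    unfolding U_def by (auto intro!: exI[of _ 1])
  have "invariant_subspace G d \<rho> U"
    unfolding invariant_subspace_def
  proof (intro conjI ballI allI)
    show "U \<subseteq> carrier_vec d" by (auto simp: U_def)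
    show "0\<^sub>v d \<in> U" unfolding U_def by (rule CollectI, rule exI[of _ 0]) auto
    show "u + w \<in> U" if uw: "u \<in> U" "w \<in> U" for u w
    proof -
      obtain a b where "u = a \<cdot>\<^sub>v unit_vec d 0" "w = b \<cdot>\<^sub>v unit_vec d 0" using uw by (auto simp: U_def)
      then have "u + w = (a + b) \<cdot>\<^sub>v unit_vec d 0" by (simp add: add_smult_distrib_vec)
      then show ?thesis by (auto simp: U_def)
    qed
    show smult: "c \<cdot>\<^sub>v u \<in> U" if "u \<in> U" for c u
      using that by (auto simp: U_def smult_smult_assoc)
    show "\<rho> g *\<^sub>v u \<in> U" if g: "g \<in> carrier G" and u: "u \<in> U" for g u
    proof -
      obtain k where "\<forall>u\<in>carrier_vec d. \<rho> g *\<^sub>v u = k \<cdot>\<^sub>v u" using scalar[OF g] ..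
      moreover have "u \<in> carrier_vec d" using u by (auto simp: U_def)
      ultimately show ?thesis using smult[OF u] by simp
    qed
  qed
  moreover have "(unit_vec d 0 :: complex vec) \<noteq> 0\<^sub>v d"
    using d by (metis index_unit_vec(2) index_zero_vec(1) zero_neq_one)
  ultimately have U: "U = carrier_vec d" using irrD e by blast
  show "d = 1"
  proof (rule ccontr)
    assume "d \<noteq> 1"
    then have d1: "1 < d" using d by simp
    have "unit_vec d 1 \<in> U" unfolding U by simp
    then obtain c where "unit_vec d 1 = c \<cdot>\<^sub>v (unit_vec d 0 :: complex vec)" by (auto simp: U_def)
    then have "(unit_vec d 1 :: complex vec) $ 1 = (c \<cdot>\<^sub>v unit_vec d 0) $ 1" by simp
    then show False using d1 by simp
  qed
qed

lemma irr_chars_comm_group: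
  fixes G (structure)
  assumes G: "comm_group G"
  shows "irr_chars G = lin_chars G"
proof (rule equalityI; rule subsetI)
  interpret comm_group G by (rule G)
  fix \<chi> assume "\<chi> \<in> irr_chars G"
  then obtain d \<rho> where irr: "is_irreducible G d \<rho>"
      and \<chi>: "\<chi> = (\<lambda>g. if g \<in> carrier G then \<Sum>i<d. \<rho> g $$ (i, i) else 0)"
    by (auto simp: irr_chars_def)
  have d: "d = 1" by (rule irreducible_dim_1[OF G irr])
  have rep: "is_representation G 1 \<rho>" using irr by (simp add: is_irreducible_def d)
  have "(\<Sum>i<d. \<rho> g $$ (i, i)) = \<rho> g $$ (0, 0)" for g unfolding d by simp
  then have \<chi>1: "\<chi> = (\<lambda>g. if g \<in> carrier G then \<rho> g $$ (0, 0) else 0)" unfolding \<chi> by metis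
  show "\<chi> \<in> lin_chars G"
    unfolding lin_chars_def \<chi>1 mem_Collect_eq
  proof (intro conjI ballI allI impI)
    fix g h assume gh: "g \<in> carrier G" "h \<in> carrier G"
    then have "\<rho> (g \<otimes> h) = \<rho> g * \<rho> h" "\<rho> g \<in> carrier_mat 1 1" "\<rho> h \<in> carrier_mat 1 1"
      using rep by (simp_all add: is_representation_def)
    then have "\<rho> (g \<otimes> h) $$ (0, 0) = \<rho> g $$ (0, 0) * \<rho> h $$ (0, 0)"
      by (simp add: scalar_prod_def)
    then show "(if g \<otimes> h \<in> carrier G then \<rho> (g \<otimes> h) $$ (0, 0) else 0)
        = (if g \<in> carrier G then \<rho> g $$ (0, 0) else 0) * (if h \<in> carrier G then \<rho> h $$ (0, 0) else 0)"
      using gh by simp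
  next
    have "\<rho> \<one> = 1\<^sub>m 1" using rep by (simp add: is_representation_def)
    then show "(if \<one> \<in> carrier G then \<rho> \<one> $$ (0, 0) else 0) = 1" by simp
  qed simp
next
  interpret comm_group G by (rule G)
  fix \<chi> assume \<chi>: "\<chi> \<in> lin_chars G"
  define \<rho> where "\<rho> g = mat 1 1 (\<lambda>_. \<chi> g)" for g
  have \<rho>_carrier: "\<rho> g \<in> carrier_mat 1 1" for g by (simp add: \<rho>_def)
  have "is_irreducible G 1 \<rho>"
    unfolding is_irreducible_def is_representation_def
  proof (intro conjI ballI allI impI \<rho>_carrier)
    show "\<rho> \<one> = 1\<^sub>m 1" using lin_charsD(2)[OF \<chi>] by (auto simp: \<rho>_def)
    show "\<rho> (g \<otimes> h) = \<rho> g * \<rho> h" if "g \<in> carrier G" "h \<in> carrier G" for g h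
      using lin_charsD(1)[OF \<chi> that] by (auto simp: \<rho>_def scalar_prod_def)
    fix U assume U: "invariant_subspace G 1 \<rho> U"
    show "U = {0\<^sub>v 1} \<or> U = carrier_vec 1"
    proof (cases "U = {0\<^sub>v 1}")
      case False
      have sub: "U \<subseteq> carrier_vec 1" and "0\<^sub>v 1 \<in> U" and smult: "\<And>c u. u \<in> U \<Longrightarrow> c \<cdot>\<^sub>v u \<in> U"
        using U by (auto simp: invariant_subspace_def)
      then obtain u where u: "u \<in> U" "u \<noteq> 0\<^sub>v 1" using False by auto
      have u1: "u \<in> carrier_vec 1" using u sub by blast
      have u0: "u $ 0 \<noteq> 0"
      proof
        assume "u $ 0 = 0"
        then have "u = 0\<^sub>v 1" using u1 by (intro eq_vecI) auto
        then show False using u(2) by simp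
      qed
      have "w \<in> U" if w: "w \<in> carrier_vec 1" for w
      proof -
        have "w = (w $ 0 / u $ 0) \<cdot>\<^sub>v u" using u0 u1 w by (intro eq_vecI) auto
        then show ?thesis using smult[OF u(1)] by metis
      qed
      then show ?thesis using sub by blast
    qed simp
  qed simp
  moreover have "\<chi> = (\<lambda>g. if g \<in> carrier G then \<Sum>i<1. \<rho> g $$ (i, i) else 0)"
    using lin_charsD(3)[OF \<chi>] by (auto simp: \<rho>_def)
  ultimately show "\<chi> \<in> irr_chars G" unfolding irr_chars_def by blast
qed

section \<open>Characters of a cyclic group\<close>

definition triv_char :: "('a, 'm) monoid_scheme \<Rightarrow> 'a \<Rightarrow> complex" where
  "triv_char G = (\<lambda>x. if x \<in> carrier G then 1 else 0)"

lemma lin_chars_pow: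
  assumes "monoid G" "\<chi> \<in> lin_chars G" "a \<in> carrier G"
  shows "\<chi> (a [^]\<^bsub>G\<^esub> (k :: nat)) = \<chi> a ^ k"
proof -
  interpret monoid G by (rule assms(1))
  show ?thesis
    by (induction k) (simp_all add: lin_charsD(1,2)[OF assms(2)] assms(3) mult.commute)
qed

text \<open>Multiplying all roots by a primitive root \<open>\<omega>\<close> permutes them and multiplies the sum by
  \<open>\<omega> ^ k\<close>, so the sum vanishes unless \<open>\<omega> ^ k = 1\<close>.\<close>

lemma sum_powers_roots_unity:
  assumes "\<nu> > 0"
  shows "(\<Sum>z | z ^ \<nu> = 1. z ^ k) = (if \<nu> dvd k then of_nat \<nu> else (0 :: complex))"
proof (cases "\<nu> dvd k")
  case True
  then have "z ^ k = 1" if "z ^ \<nu> = 1" for z :: complex using that by (auto simp: power_mult elim!: dvdE)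
  then show ?thesis using True card_roots_unity_eq[OF assms] by simp
next
  case False
  define \<omega> where "\<omega> = cis (2 * pi / \<nu>)"
  have \<omega>: "\<omega> ^ \<nu> = 1" using assms by (simp add: \<omega>_def DeMoivre)
  define r where "r = k mod \<nu>"
  have r: "0 < r" "r < \<nu>" using False assms by (auto simp: r_def dvd_eq_mod_eq_0)
  have "\<omega> ^ k = \<omega> ^ (\<nu> * (k div \<nu>) + r)" by (simp add: r_def)
  also have "\<dots> = \<omega> ^ r" by (simp only: power_add power_mult \<omega>) simp
  finally have "\<omega> ^ k = \<omega> ^ r" .
  moreover have "\<omega> ^ r \<noteq> 1"
  proof
    assume "\<omega> ^ r = 1"
    then have "cis (2 * pi * real r / real \<nu>) = cis (2 * pi * real 0 / real \<nu>)"
      by (simp add: \<omega>_def DeMoivre mult_ac)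
    moreover have "inj_on (\<lambda>k. cis (2 * pi * real k / real \<nu>)) {..<\<nu>}"
      using bij_betw_roots_unity[OF assms] by (rule bij_betw_imp_inj_on)
    ultimately have "r = 0" using r assms by (auto simp: inj_on_def)
    then show False using r by simp
  qed
  ultimately have \<omega>k: "\<omega> ^ k \<noteq> 1" by simp
  have \<omega>0: "\<omega> \<noteq> 0" by (simp add: \<omega>_def)
  have "(\<Sum>z | z ^ \<nu> = 1. z ^ k) = (\<Sum>z | z ^ \<nu> = 1. (\<omega> * z) ^ k)"
    by (rule sum.reindex_bij_witness[where i = "\<lambda>z. \<omega> * z" and j = "\<lambda>z. z / \<omega>"])
      (use \<omega> \<omega>0 in \<open>auto simp: power_mult_distrib power_divide\<close>)
  also have "\<dots> = \<omega> ^ k * (\<Sum>z | z ^ \<nu> = 1. z ^ k)"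
    by (simp add: power_mult_distrib sum_distrib_left)
  finally have "(1 - \<omega> ^ k) * (\<Sum>z | z ^ \<nu> = 1. z ^ k) = 0" by (simp add: algebra_simps)
  then show ?thesis using \<omega>k False by simp
qed

lemma cyclic_group_generator:
  fixes C (structure)
  assumes "group C" "cyclic_group C" "order C = \<nu>" "\<nu> > 0"
  obtains a where "a \<in> carrier C" "carrier C = range (\<lambda>k :: nat. a [^]\<^bsub>C\<^esub> k)"
    "\<forall>k l :: nat. a [^]\<^bsub>C\<^esub> k = a [^]\<^bsub>C\<^esub> l \<longleftrightarrow> k mod \<nu> = l mod \<nu>"
proof -
  interpret group C by (rule assms(1))
  obtain a where a: "a \<in> carrier C" "subgroup_generated C {a} = C"
    using assms(2) by (auto simp: cyclic_group_def)
  have ord: "ord a = \<nu>" using cyclic_order_is_ord[OF a(1)] a(2) assms(3) by simp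
  have eq: "a [^] k = a [^] l \<longleftrightarrow> k mod \<nu> = l mod \<nu>" for k l :: nat
  proof -
    have "a [^] k = a [^] l \<longleftrightarrow> int \<nu> dvd int l - int k"
      using int_pow_eq[OF a(1), of "int k" "int l"] by (simp add: int_pow_int ord)
    also have "\<dots> \<longleftrightarrow> k mod \<nu> = l mod \<nu>"
      by (metis mod_eq_dvd_iff of_nat_eq_iff zmod_int)
    finally show ?thesis .
  qed
  have carr: "carrier C = range (\<lambda>n :: int. a [^] n)"
    using carrier_subgroup_generated_by_singleton[OF a(1)] a(2) by simp
  have "carrier C \<subseteq> range (\<lambda>k :: nat. a [^] k)"
  proof
    fix x assume "x \<in> carrier C"
    then obtain i :: int where i: "x = a [^] i" using carr by auto
    \<comment> \<open>Negative powers of the generator are also nonnegative ones, as its order is finite.\<close>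
    have "a [^] i = a [^] (int (nat (i mod int \<nu>)))"
      using assms(4) by (subst int_pow_eq[OF a(1)]) (simp add: ord mod_eq_dvd_iff[symmetric])
    then have "x = a [^] (nat (i mod int \<nu>))" using i by (simp only: int_pow_int)
    then show "x \<in> range (\<lambda>k :: nat. a [^] k)" by blast
  qed
  then have "carrier C = range (\<lambda>k :: nat. a [^] k)" using a(1) by auto
  then show thesis using that[OF a(1)] eq by blast
qed

lemma reg_char_eq:
  fixes C (structure)
  assumes "group C" "x \<in> carrier C"
  shows "reg_char C x = (if x = \<one>\<^bsub>C\<^esub> then of_nat (order C) else 0)"
proof -
  interpret group C by (rule assms(1))
  have "{y \<in> carrier C. x \<otimes> y = y} = (if x = \<one> then carrier C else {})"
    using assms(2) by (auto simp: r_cancel_one')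
  then show ?thesis by (simp add: reg_char_def Coset.order_def)
qed

text \<open>A character of a cyclic group of order \<open>\<nu>\<close> is given by the \<open>\<nu>\<close>-th root of unity that is its
  value at a generator.\<close>

lemma bij_betw_cyclic_chars:
  fixes C (structure)
  assumes C: "group C" and \<nu>: "\<nu> > 0"
    and a: "a \<in> carrier C" "carrier C = range (\<lambda>k :: nat. a [^]\<^bsub>C\<^esub> k)"
    and eq: "\<And>k l :: nat. a [^]\<^bsub>C\<^esub> k = a [^]\<^bsub>C\<^esub> l \<longleftrightarrow> k mod \<nu> = l mod \<nu>"
  shows "bij_betw (\<lambda>\<chi>. \<chi> a) (lin_chars C) {z. z ^ \<nu> = 1}"
  unfolding bij_betw_def
proof
  interpret group C by (rule C)
  note pow = lin_chars_pow[OF is_monoid _ a(1)]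
  show "inj_on (\<lambda>\<chi>. \<chi> a) (lin_chars C)"
  proof (rule inj_onI)
    fix \<chi> \<psi> assume \<chi>: "\<chi> \<in> lin_chars C" and \<psi>: "\<psi> \<in> lin_chars C" and "\<chi> a = \<psi> a"
    then have "\<chi> (a [^] k) = \<psi> (a [^] k)" for k :: nat by (simp only: pow \<chi> \<psi>)
    then have "\<chi> x = \<psi> x" if "x \<in> carrier C" for x using that unfolding a(2) by blast
    moreover have "\<chi> x = \<psi> x" if "x \<notin> carrier C" for x
      using that lin_charsD(3)[OF \<chi>] lin_charsD(3)[OF \<psi>] by simp
    ultimately show "\<chi> = \<psi>" by blast
  qed
  have "a [^] \<nu> = \<one>" using eq[of \<nu> 0] by simp
  then have "\<chi> a ^ \<nu> = 1" if "\<chi> \<in> lin_chars C" for \<chi>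
    using pow[OF that, of \<nu>] lin_charsD(2)[OF that] by simp
  moreover have "z \<in> (\<lambda>\<chi>. \<chi> a) ` lin_chars C" if z: "z ^ \<nu> = 1" for z
  proof -
    \<comment> \<open>The choice of the exponent is immaterial because \<open>z ^ \<nu> = 1\<close>.\<close>
    define \<chi> where "\<chi> x = (if x \<in> carrier C then z ^ (SOME k. x = a [^] (k :: nat)) else 0)" for x
    have zk: "z ^ k = z ^ (k mod \<nu>)" for k
    proof -
      have "z ^ k = z ^ (\<nu> * (k div \<nu>) + k mod \<nu>)" by simp
      also have "\<dots> = z ^ (k mod \<nu>)" by (simp only: power_add power_mult z) simp
      finally show ?thesis .
    qed
    have \<chi>: "\<chi> (a [^] k) = z ^ k" for k :: nat
    proof -
      have "a [^] k = a [^] (SOME l. a [^] k = a [^] (l :: nat))" by (rule someI[of _ k]) simp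
      then have "k mod \<nu> = (SOME l. a [^] k = a [^] (l :: nat)) mod \<nu>" using eq by blast
      then show ?thesis using a(1) zk by (simp add: \<chi>_def) metis
    qed
    have "\<chi> \<in> lin_chars C"
      unfolding lin_chars_def mem_Collect_eq
    proof (intro conjI ballI allI impI)
      fix g h assume "g \<in> carrier C" "h \<in> carrier C"
      then obtain k l :: nat where gh: "g = a [^] k" "h = a [^] l" using a(2) by auto
      show "\<chi> (g \<otimes> h) = \<chi> g * \<chi> h" unfolding gh nat_pow_mult[OF a(1)] \<chi> by (rule power_add)
    next
      show "\<chi> \<one> = 1" using \<chi>[of 0] by simp
    qed (simp add: \<chi>_def)
    moreover have "\<chi> a = z" using \<chi>[of 1] a(1) by simp
    ultimately show ?thesis by blast
  qed
  ultimately show "(\<lambda>\<chi>. \<chi> a) ` lin_chars C = {z. z ^ \<nu> = 1}" by blast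
qed

text \<open>Writing \<open>x\<close> as the \<open>k\<close>-th power of a generator turns the sum into one of the \<open>k\<close>-th powers of all
  roots of unity.\<close>

lemma
  fixes C (structure)
  assumes C: "group C" "cyclic_group C" "order C = \<nu>" "\<nu> > 0"
  shows finite_cyclic_chars: "finite (lin_chars C)"
    and sum_cyclic_chars: "x \<in> carrier C \<Longrightarrow> (\<Sum>\<chi>\<in>lin_chars C. \<chi> x) = reg_char C x"
proof -
  interpret group C by (rule C(1))
  obtain a where a: "a \<in> carrier C" "carrier C = range (\<lambda>k :: nat. a [^] k)"
      and eq: "\<forall>k l :: nat. a [^] k = a [^] l \<longleftrightarrow> k mod \<nu> = l mod \<nu>"
    by (rule cyclic_group_generator[OF C])
  note bij = bij_betw_cyclic_chars[OF C(1,4) a eq[rule_format]]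
  show "finite (lin_chars C)"
    using bij_betw_finite[OF bij] finite_roots_unity[of \<nu>] C(4) by (simp add: Suc_le_eq)
  assume x: "x \<in> carrier C"
  then obtain k :: nat where k: "x = a [^] k" using a(2) by auto
  have "(\<Sum>\<chi>\<in>lin_chars C. \<chi> x) = (\<Sum>\<chi>\<in>lin_chars C. \<chi> a ^ k)"
    unfolding k by (rule sum.cong[OF refl]) (rule lin_chars_pow[OF is_monoid _ a(1)])
  also have "\<dots> = (\<Sum>z | z ^ \<nu> = 1. z ^ k)"
    by (rule sum.reindex_bij_betw[OF bij])
  also have "\<dots> = reg_char C x"
    using eq[rule_format, of k 0] reg_char_eq[OF C(1) x]
    by (simp add: sum_powers_roots_unity[OF C(4)] C(3) dvd_eq_mod_eq_0 k)
  finally show "(\<Sum>\<chi>\<in>lin_chars C. \<chi> x) = reg_char C x" .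
qed

section \<open>Supercharacters\<close>

lemma carrier_Q_group: "group C \<Longrightarrow> carrier (Q_group C n) = (\<Pi>\<^sub>E i\<in>{1..<n}. carrier C)"
  by (simp add: Q_group_def carrier_sum_group)

lemma comm_group_Q_group:
  assumes "comm_group C"
  shows "comm_group (Q_group C n)"
proof -
  interpret comm_group C by (rule assms)
  have "group (Q_group C n)" unfolding Q_group_def by (rule sum_group) (rule is_group)
  then show ?thesis
  proof (rule group.group_comm_groupI)
    fix x y assume "x \<in> carrier (Q_group C n)" "y \<in> carrier (Q_group C n)"
    then show "x \<otimes>\<^bsub>Q_group C n\<^esub> y = y \<otimes>\<^bsub>Q_group C n\<^esub> x"
      unfolding carrier_Q_group[OF is_group] by (auto simp: Q_group_def PiE_iff m_comm intro!: restrict_ext)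
  qed
qed

definition prod_char :: "('c, 'm) monoid_scheme \<Rightarrow> nat \<Rightarrow> (nat \<Rightarrow> 'c \<Rightarrow> complex) \<Rightarrow> (nat \<Rightarrow> 'c) \<Rightarrow> complex" where
  "prod_char C n F g = (if g \<in> carrier (Q_group C n) then \<Prod>i\<in>{1..<n}. F i (g i) else 0)"

definition coord_elem :: "('c, 'm) monoid_scheme \<Rightarrow> nat \<Rightarrow> nat \<Rightarrow> 'c \<Rightarrow> nat \<Rightarrow> 'c" where
  "coord_elem C n i x = (\<lambda>j\<in>{1..<n}. if j = i then x else \<one>\<^bsub>C\<^esub>)"

lemma coord_elem_carrier: "group C \<Longrightarrow> x \<in> carrier C \<Longrightarrow> coord_elem C n i x \<in> carrier (Q_group C n)"
  by (auto simp: carrier_Q_group coord_elem_def group.is_monoid)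

lemma prod_char_coord_elem:
  assumes "group C" "F \<in> (\<Pi>\<^sub>E i\<in>{1..<n}. lin_chars C)" "i \<in> {1..<n}" "x \<in> carrier C"
  shows "prod_char C n F (coord_elem C n i x) = F i x"
proof -
  have "prod_char C n F (coord_elem C n i x) = (\<Prod>j\<in>{1..<n}. F j (if j = i then x else \<one>\<^bsub>C\<^esub>))"
    using assms coord_elem_carrier[OF assms(1,4), of n i]
    by (simp add: prod_char_def) (simp add: coord_elem_def)
  also have "\<dots> = (\<Prod>j\<in>{1..<n}. if j = i then F i x else 1)"
    using assms by (intro prod.cong) (auto intro!: lin_charsD(2))
  finally show ?thesis using assms by simp
qed

lemma prod_char_lin_char:
  assumes "group C" "F \<in> (\<Pi>\<^sub>E i\<in>{1..<n}. lin_chars C)"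
  shows "prod_char C n F \<in> lin_chars (Q_group C n)"
proof -
  interpret group C by (rule assms(1))
  have F: "F i \<in> lin_chars C" if "i \<in> {1..<n}" for i using assms(2) that by auto
  have Q: "group (Q_group C n)" unfolding Q_group_def by (rule sum_group) (rule assms(1))
  show ?thesis
    unfolding lin_chars_def mem_Collect_eq
  proof (intro conjI ballI allI impI)
    fix g h assume gh: "g \<in> carrier (Q_group C n)" "h \<in> carrier (Q_group C n)"
    then have c: "g \<otimes>\<^bsub>Q_group C n\<^esub> h \<in> carrier (Q_group C n)"
      using Q by (simp add: group.is_monoid monoid.m_closed)
    have "(\<Prod>i\<in>{1..<n}. F i ((g \<otimes>\<^bsub>Q_group C n\<^esub> h) i)) = (\<Prod>i\<in>{1..<n}. F i (g i) * F i (h i))"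
      using gh unfolding carrier_Q_group[OF assms(1)]
      by (intro prod.cong) (auto simp: Q_group_def lin_charsD(1)[OF F] PiE_iff)
    then show "prod_char C n F (g \<otimes>\<^bsub>Q_group C n\<^esub> h) = prod_char C n F g * prod_char C n F h"
      using gh c by (simp add: prod_char_def prod.distrib)
  next
    have "\<one>\<^bsub>Q_group C n\<^esub> \<in> carrier (Q_group C n)" using Q by (simp add: group.is_monoid)
    then show "prod_char C n F \<one>\<^bsub>Q_group C n\<^esub> = 1"
      by (simp add: prod_char_def) (simp add: Q_group_def lin_charsD(2)[OF F])
  next
    show "prod_char C n F g = 0" if "g \<notin> carrier (Q_group C n)" for g
      using that by (simp add: prod_char_def)
  qed
qed

text \<open>A group element is the product of its coordinate elements.\<close>

lemma lin_char_eq_prod_char: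
  fixes C (structure)
  assumes "group C" "\<chi> \<in> lin_chars (Q_group C n)"
  shows "\<chi> = prod_char C n (\<lambda>i\<in>{1..<n}. \<lambda>x. if x \<in> carrier C then \<chi> (coord_elem C n i x) else 0)"
proof
  interpret group C by (rule assms(1))
  note \<chi> = lin_charsD[OF assms(2)]
  fix g
  show "\<chi> g = prod_char C n (\<lambda>i\<in>{1..<n}. \<lambda>x. if x \<in> carrier C then \<chi> (coord_elem C n i x) else 0) g"
  proof (cases "g \<in> carrier (Q_group C n)")
    case True
    then have g: "g \<in> (\<Pi>\<^sub>E i\<in>{1..<n}. carrier C)" by (simp add: carrier_Q_group assms(1))
    \<comment> \<open>Build up \<open>g\<close> one coordinate at a time.\<close>
    define part where "part J = (\<lambda>j\<in>{1..<n}. if j \<in> J then g j else \<one>)" for J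
    have part: "part J \<in> carrier (Q_group C n)" for J
      using g by (auto simp: carrier_Q_group assms(1) part_def)
    have "\<chi> (part J) = (\<Prod>i\<in>J. \<chi> (coord_elem C n i (g i)))" if "finite J" "J \<subseteq> {1..<n}" for J
      using that
    proof (induction J rule: finite_induct)
      case empty
      have "part {} = \<one>\<^bsub>Q_group C n\<^esub>" by (auto simp: part_def Q_group_def)
      then show ?case using \<chi>(2) by simp
    next
      case (insert i J)
      have i: "i \<in> {1..<n}" "g i \<in> carrier C" using insert g by auto
      have "part (insert i J) = coord_elem C n i (g i) \<otimes>\<^bsub>Q_group C n\<^esub> part J"
        using insert.hyps i g by (auto simp: part_def coord_elem_def Q_group_def PiE_iff intro!: restrict_ext)
      then show ?case
        using insert \<chi>(1)[OF coord_elem_carrier[OF assms(1) i(2)] part] by simp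
    qed
    from this[of "{1..<n}"] have "\<chi> (part {1..<n}) = (\<Prod>i\<in>{1..<n}. \<chi> (coord_elem C n i (g i)))" by simp
    moreover have "part {1..<n} = g" using g by (auto simp: part_def PiE_iff extensional_def)
    ultimately have "\<chi> g = (\<Prod>i\<in>{1..<n}. \<chi> (coord_elem C n i (g i)))" by simp
    also have "\<dots> = prod_char C n (\<lambda>i\<in>{1..<n}. \<lambda>x. if x \<in> carrier C then \<chi> (coord_elem C n i x) else 0) g"
      using True g by (auto simp: prod_char_def intro!: prod.cong)
    finally show ?thesis .
  next
    case False
    then show ?thesis using \<chi>(3) by (simp add: prod_char_def)
  qed
qed

lemma coord_elem_lin_char:
  fixes C (structure)
  assumes "group C" "\<chi> \<in> lin_chars (Q_group C n)" "i \<in> {1..<n}"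
  shows "(\<lambda>x. if x \<in> carrier C then \<chi> (coord_elem C n i x) else 0) \<in> lin_chars C"
  unfolding lin_chars_def mem_Collect_eq
proof (intro conjI ballI allI impI)
  interpret group C by (rule assms(1))
  note \<chi> = lin_charsD[OF assms(2)]
  show "(if g \<otimes>\<^bsub>C\<^esub> h \<in> carrier C then \<chi> (coord_elem C n i (g \<otimes>\<^bsub>C\<^esub> h)) else 0)
      = (if g \<in> carrier C then \<chi> (coord_elem C n i g) else 0) * (if h \<in> carrier C then \<chi> (coord_elem C n i h) else 0)"
    if "g \<in> carrier C" "h \<in> carrier C" for g h
  proof -
    have "coord_elem C n i (g \<otimes> h) = coord_elem C n i g \<otimes>\<^bsub>Q_group C n\<^esub> coord_elem C n i h"
      using that by (auto simp: coord_elem_def Q_group_def intro!: restrict_ext)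
    then show ?thesis
      using that \<chi>(1)[OF coord_elem_carrier[OF assms(1) that(1)] coord_elem_carrier[OF assms(1) that(2)]] by simp
  qed
  have "coord_elem C n i \<one> = \<one>\<^bsub>Q_group C n\<^esub>" by (auto simp: coord_elem_def Q_group_def)
  then show "(if \<one> \<in> carrier C then \<chi> (coord_elem C n i \<one>) else 0) = 1" using \<chi>(2) by simp
qed simp

lemma bij_betw_prod_char:
  assumes "group C"
  shows "bij_betw (prod_char C n) (\<Pi>\<^sub>E i\<in>{1..<n}. lin_chars C) (lin_chars (Q_group C n))"
  unfolding bij_betw_def
proof
  show "inj_on (prod_char C n) (\<Pi>\<^sub>E i\<in>{1..<n}. lin_chars C)"
  proof (rule inj_onI)
    fix F G assume F: "F \<in> (\<Pi>\<^sub>E i\<in>{1..<n}. lin_chars C)" and G: "G \<in> (\<Pi>\<^sub>E i\<in>{1..<n}. lin_chars C)"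
      and eq: "prod_char C n F = prod_char C n G"
    have "F i = G i" if i: "i \<in> {1..<n}" for i
    proof
      fix x
      show "F i x = G i x"
      proof (cases "x \<in> carrier C")
        case True
        then show ?thesis
          using prod_char_coord_elem[OF assms F i] prod_char_coord_elem[OF assms G i] eq by metis
      next
        case False
        have "F i \<in> lin_chars C" "G i \<in> lin_chars C" using F G i by auto
        then show ?thesis using False lin_charsD(3) by metis
      qed
    qed
    then show "F = G" by (rule PiE_ext[OF F G])
  qed
  show "prod_char C n ` (\<Pi>\<^sub>E i\<in>{1..<n}. lin_chars C) = lin_chars (Q_group C n)"
  proof (rule equalityI; rule subsetI)
    fix \<chi> assume "\<chi> \<in> prod_char C n ` (\<Pi>\<^sub>E i\<in>{1..<n}. lin_chars C)"
    then show "\<chi> \<in> lin_chars (Q_group C n)" using prod_char_lin_char[OF assms] by blast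
  next
    fix \<chi> assume \<chi>: "\<chi> \<in> lin_chars (Q_group C n)"
    have "(\<lambda>i\<in>{1..<n}. \<lambda>x. if x \<in> carrier C then \<chi> (coord_elem C n i x) else 0) \<in> (\<Pi>\<^sub>E i\<in>{1..<n}. lin_chars C)"
      unfolding restrict_PiE_iff by (rule ballI) (rule coord_elem_lin_char[OF assms \<chi>])
    from imageI[OF this, of "prod_char C n"] show "\<chi> \<in> prod_char C n ` (\<Pi>\<^sub>E i\<in>{1..<n}. lin_chars C)"
      unfolding lin_char_eq_prod_char[OF assms \<chi>, symmetric] .
  qed
qed

lemma triv_char_lin_char: "monoid C \<Longrightarrow> triv_char C \<in> lin_chars C"
  by (auto simp: triv_char_def lin_chars_def monoid.m_closed monoid.one_closed)

lemma trivial_on_factor_prod_char: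
  fixes C (structure)
  assumes "group C" and F: "F \<in> (\<Pi>\<^sub>E i\<in>{1..<n}. lin_chars C)" and i: "i \<in> {1..<n}"
  shows "trivial_on_factor C n i (prod_char C n F) \<longleftrightarrow> F i = triv_char C"
proof
  interpret group C by (rule assms(1))
  have Fi: "F i \<in> lin_chars C" using F i by auto
  assume t: "trivial_on_factor C n i (prod_char C n F)"
  have "F i x = 1" if x: "x \<in> carrier C" for x
  proof -
    have "\<forall>j\<in>{1..<n} - {i}. coord_elem C n i x j = \<one>" by (simp add: coord_elem_def)
    then have "prod_char C n F (coord_elem C n i x) = 1"
      using t coord_elem_carrier[OF assms(1) x, of n i] unfolding trivial_on_factor_def by blast
    then show ?thesis using prod_char_coord_elem[OF assms x] by simp
  qed
  then show "F i = triv_char C" using lin_charsD(3)[OF Fi] by (intro ext) (simp add: triv_char_def)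
next
  interpret group C by (rule assms(1))
  assume t: "F i = triv_char C"
  show "trivial_on_factor C n i (prod_char C n F)"
    unfolding trivial_on_factor_def
  proof (intro ballI impI)
    fix g assume g: "g \<in> carrier (Q_group C n)" and 1: "\<forall>j\<in>{1..<n} - {i}. g j = \<one>"
    have "g i \<in> carrier C" using g i by (auto simp: carrier_Q_group assms(1))
    then have "F j (g j) = 1" if "j \<in> {1..<n}" for j
    proof (cases "j = i")
      case True
      then show ?thesis using t \<open>g i \<in> carrier C\<close> by (simp add: triv_char_def)
    next
      case False
      have "F j \<in> lin_chars C" using F that by auto
      then show ?thesis using lin_charsD(2) 1 that False by auto
    qed
    then show "prod_char C n F g = 1" using g by (simp add: prod_char_def)
  qed
qed

text \<open>The characters that contribute are the products of a trivial character in each place of \<open>I\<close>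
  and a nontrivial one in each other place.  Expanding a product of sums over the places, their sum
  factorises, and each place outside \<open>I\<close> contributes the sum of all nontrivial characters.\<close>

lemma superchar_eq:
  assumes C: "group C" "cyclic_group C" "order C = \<nu>" "\<nu> > 0" and I: "I \<subseteq> {1..<n}"
    and g: "g \<in> carrier (Q_group C n)"
  shows "superchar C n I g = (\<Prod>i\<in>{1..<n} - I. reg_char C (g i) - 1)"
proof -
  interpret group C by (rule C(1))
  have comm: "comm_group C" using C(1,2) by (rule group.cyclic_imp_abelian_group)
  let ?A = "\<lambda>i. if i \<in> I then {triv_char C} else lin_chars C - {triv_char C}"
  have triv: "triv_char C \<in> lin_chars C" by (rule triv_char_lin_char[OF is_monoid])
  have fin: "finite (?A i)" for i using finite_cyclic_chars[OF C] by simp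
  have gi: "g i \<in> carrier C" if "i \<in> {1..<n}" for i using g that by (auto simp: carrier_Q_group C(1))
  have sub: "PiE {1..<n} ?A \<subseteq> (\<Pi>\<^sub>E i\<in>{1..<n}. lin_chars C)"
    using triv by (intro PiE_mono) auto
  have "bij_betw (prod_char C n) (PiE {1..<n} ?A)
      {\<chi> \<in> lin_chars (Q_group C n). \<forall>i\<in>{1..<n}. trivial_on_factor C n i \<chi> \<longleftrightarrow> i \<in> I}"
  proof (rule bij_betw_subset[OF bij_betw_prod_char[OF C(1)] sub])
    have key: "F \<in> PiE {1..<n} ?A \<longleftrightarrow> (\<forall>i\<in>{1..<n}. trivial_on_factor C n i (prod_char C n F) \<longleftrightarrow> i \<in> I)"
      if F: "F \<in> (\<Pi>\<^sub>E i\<in>{1..<n}. lin_chars C)" for F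
    proof -
      have "F \<in> PiE {1..<n} ?A \<longleftrightarrow> (\<forall>i\<in>{1..<n}. F i = triv_char C \<longleftrightarrow> i \<in> I)"
        using F triv by (auto simp: PiE_iff split: if_splits)
      then show ?thesis using trivial_on_factor_prod_char[OF C(1) F] by simp
    qed
    show "prod_char C n ` PiE {1..<n} ?A
        = {\<chi> \<in> lin_chars (Q_group C n). \<forall>i\<in>{1..<n}. trivial_on_factor C n i \<chi> \<longleftrightarrow> i \<in> I}" (is "?L = ?R")
    proof (rule equalityI; rule subsetI)
      fix \<chi> assume "\<chi> \<in> ?L"
      then obtain F where F: "F \<in> PiE {1..<n} ?A" "\<chi> = prod_char C n F" by (rule imageE)
      have F': "F \<in> (\<Pi>\<^sub>E i\<in>{1..<n}. lin_chars C)" by (rule subsetD[OF sub F(1)])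
      show "\<chi> \<in> ?R"
        unfolding F(2) using prod_char_lin_char[OF C(1) F'] key[OF F'] F(1) by (intro CollectI conjI) blast+
    next
      fix \<chi> assume \<chi>: "\<chi> \<in> ?R"
      then have \<chi>1: "\<chi> \<in> lin_chars (Q_group C n)"
        and \<chi>2: "\<forall>i\<in>{1..<n}. trivial_on_factor C n i \<chi> \<longleftrightarrow> i \<in> I" by blast+
      from \<chi>1 obtain F where F: "F \<in> (\<Pi>\<^sub>E i\<in>{1..<n}. lin_chars C)" "\<chi> = prod_char C n F"
        unfolding bij_betw_imp_surj_on[OF bij_betw_prod_char[OF C(1), of n], symmetric] by (elim imageE)
      have "F \<in> PiE {1..<n} ?A"
        unfolding key[OF F(1)] F(2)[symmetric] by (rule \<chi>2)
      then show "\<chi> \<in> ?L" unfolding F(2) by (rule imageI)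
    qed
  qed
  then have "superchar C n I g = (\<Sum>F\<in>PiE {1..<n} ?A. prod_char C n F g)"
    unfolding superchar_def irr_chars_comm_group[OF comm_group_Q_group[OF comm]] sum_fun_apply
    by (rule sum.reindex_bij_betw[symmetric])
  also have "\<dots> = (\<Prod>i\<in>{1..<n}. \<Sum>\<chi>\<in>?A i. \<chi> (g i))"
    using g by (subst prod_sum_PiE) (simp_all add: fin prod_char_def)
  also have "\<dots> = (\<Prod>i\<in>{1..<n}. if i \<in> I then 1 else reg_char C (g i) - 1)"
  proof (rule prod.cong[OF refl])
    fix i assume i: "i \<in> {1..<n}"
    have "(\<Sum>\<chi>\<in>lin_chars C - {triv_char C}. \<chi> (g i)) = reg_char C (g i) - 1"
      using finite_cyclic_chars[OF C] triv sum_cyclic_chars[OF C gi[OF i]] gi[OF i]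
      by (simp add: sum_diff1 triv_char_def)
    then show "(\<Sum>\<chi>\<in>?A i. \<chi> (g i)) = (if i \<in> I then 1 else reg_char C (g i) - 1)"
      using gi[OF i] by (simp add: triv_char_def)
  qed
  also have "\<dots> = (\<Prod>i\<in>{1..<n} - I. reg_char C (g i) - 1)"
    by (rule prod.mono_neutral_cong_right) auto
  finally show ?thesis .
qed

lemma superchar_dot_eq:
  fixes C (structure)
  assumes C: "group C" "cyclic_group C" "order C = \<nu>" "\<nu> > 1" and I: "I \<subseteq> {1..<n}"
  shows "superchar_dot C n I g = (if g \<in> carrier (Q_group C n) then \<Prod>i\<in>{1..<n} - I. rbar C (g i) else 0)"
proof -
  interpret group C by (rule C(1))
  have comm: "comm_group C" using C(1,2) by (rule group.cyclic_imp_abelian_group)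
  interpret Q: comm_group "Q_group C n" by (rule comm_group_Q_group[OF comm])
  have \<nu>: "\<nu> > 0" using C(4) by simp
  have "\<one>\<^bsub>Q_group C n\<^esub> i = \<one>" if "i \<in> {1..<n}" for i using that by (simp add: Q_group_def)
  then have at_one: "superchar C n I \<one>\<^bsub>Q_group C n\<^esub> = (\<Prod>i\<in>{1..<n} - I. of_nat \<nu> - 1)"
    unfolding superchar_eq[OF C(1-3) \<nu> I Q.one_closed]
    by (intro prod.cong) (simp_all add: reg_char_eq[OF C(1)] C(3))
  show ?thesis
  proof (cases "g \<in> carrier (Q_group C n)")
    case True
    then show ?thesis
      unfolding superchar_dot_def at_one superchar_eq[OF C(1-3) \<nu> I True]
      by (simp add: rbar_def C(3) prod_dividef)
  next
    case False
    have "superchar C n I g = 0"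
      unfolding superchar_def irr_chars_comm_group[OF comm_group_Q_group[OF comm]] sum_fun_apply
      by (rule sum.neutral) (simp add: lin_charsD(3)[OF _ False])
    then show ?thesis using False by (simp add: superchar_dot_def)
  qed
qed

section \<open>The normalised supercharacters form a basis\<close>

locale finite_cyclic = group C for C :: "('c, 'm) monoid_scheme" (structure) +
  fixes \<nu> :: nat
  assumes cyclic: "cyclic_group C" and order_C: "order C = \<nu>" and \<nu>: "\<nu> > 1"

text \<open>The common index set of the two bases: a degree and a set of positions in it.\<close>

definition degree_sets :: "(nat \<times> nat set) set" where
  "degree_sets = {(n, I). I \<subseteq> {1..<n}}"

definition superchar_basis :: "('c, 'm) monoid_scheme \<Rightarrow> nat \<times> nat set \<Rightarrow> nat \<times> (nat \<Rightarrow> 'c) \<Rightarrow> complex" where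
  "superchar_basis C = (\<lambda>(n, I). in_degree n (superchar_dot C n I))"

lemma (in finite_cyclic) superchar_basis_eq:
  assumes "I \<subseteq> {1..<n}"
  shows "superchar_basis C (n, I) (k, g) =
    (if k = n \<and> g \<in> carrier (Q_group C n) then \<Prod>i\<in>{1..<n} - I. rbar C (g i) else 0)"
  using superchar_dot_eq[OF is_group cyclic order_C \<nu> assms, of g]
  by (simp add: superchar_basis_def in_degree_def)

lemma (in finite_cyclic) rbar_eq:
  "x \<in> carrier C \<Longrightarrow> rbar C x = (if x = \<one> then 1 else - 1 / (of_nat \<nu> - 1))"
  using \<nu> by (auto simp: rbar_def reg_char_eq[OF is_group] order_C)

text \<open>By induction on \<open>J\<close>, the terms for proper subsets of \<open>J\<close> vanish, and so does the remaining one.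
  Both bases are shown to be independent by producing such subset sums of the coefficients.\<close>

lemma subset_sums_zero:
  fixes c :: "'a set \<Rightarrow> complex"
  assumes N: "finite N" and zero: "\<And>J. J \<subseteq> N \<Longrightarrow> (\<Sum>I\<in>Pow J. c I) = 0" and J: "J \<subseteq> N"
  shows "c J = 0"
proof -
  have "finite J" using N J by (rule rev_finite_subset)
  then show ?thesis using J
  proof (induction J rule: finite_psubset_induct)
    case (psubset J)
    have "(\<Sum>I\<in>Pow J. c I) = c J + (\<Sum>I\<in>Pow J - {J}. c I)"
      using psubset.hyps by (intro sum.remove) auto
    also have "(\<Sum>I\<in>Pow J - {J}. c I) = 0"
      using psubset by (intro sum.neutral) auto
    finally show ?case using zero[OF psubset.prems] by simp
  qed
qed

text \<open>The alternating sum factorises over the coordinates in \<open>K\<close>: one outside \<open>I\<close> contributes the factor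
  \<open>1 - t\<close>, and one in \<open>I\<close> the factor \<open>0\<close>.  The sum thus detects whether \<open>I\<close> avoids \<open>K\<close>.\<close>

lemma alternating_sum_weights:
  fixes t :: complex
  assumes N: "finite N" and K: "K \<subseteq> N"
  shows "(\<Sum>T\<in>Pow K. (- 1) ^ card T * (\<Prod>i\<in>N - I. if i \<in> T then t else 1))
       = (if K \<inter> I = {} then (1 - t) ^ card K else 0)"
proof -
  have fK: "finite K" using N K by (rule rev_finite_subset)
  let ?w = "\<lambda>i. if i \<in> I then 1 else t"
  have "(\<Sum>T\<in>Pow K. (- 1) ^ card T * (\<Prod>i\<in>N - I. if i \<in> T then t else 1))
      = (\<Sum>T\<in>Pow K. (\<Prod>i\<in>T. - ?w i) * (\<Prod>i\<in>K - T. 1))"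
  proof (rule sum.cong[OF refl])
    fix T assume T: "T \<in> Pow K"
    then have fT: "finite T" using fK finite_subset by auto
    have "(\<Prod>i\<in>N - I. if i \<in> T then t else 1) = (\<Prod>i\<in>T - I. t)"
      using N K T by (intro prod.mono_neutral_cong_right) auto
    also have "\<dots> = (\<Prod>i\<in>T. ?w i)"
      using fT by (intro prod.mono_neutral_cong_left) auto
    finally show "(- 1) ^ card T * (\<Prod>i\<in>N - I. if i \<in> T then t else 1) = (\<Prod>i\<in>T. - ?w i) * (\<Prod>i\<in>K - T. 1)"
      using prod.distrib[of "\<lambda>_. - 1" ?w T] by simp
  qed
  also have "\<dots> = (\<Prod>i\<in>K. - ?w i + 1)" by (rule prod_add[OF fK, symmetric])
  also have "\<dots> = (if K \<inter> I = {} then (1 - t) ^ card K else 0)"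
  proof (cases "K \<inter> I = {}")
    case True
    then have "(\<Prod>i\<in>K. - ?w i + 1) = (\<Prod>i\<in>K. 1 - t)" by (intro prod.cong) auto
    then show ?thesis using True by simp
  next
    case False
    then obtain i where "i \<in> K" "i \<in> I" by auto
    then have "(\<Prod>i\<in>K. - ?w i + 1) = 0" using fK by (intro prod_zero) auto
    then show ?thesis using False by simp
  qed
  finally show ?thesis .
qed

context finite_cyclic begin

definition nontriv :: 'c where
  "nontriv = (SOME x. x \<in> carrier C \<and> x \<noteq> \<one>)"

lemma nontriv: "nontriv \<in> carrier C" "nontriv \<noteq> \<one>"
proof -
  have "\<exists>x. x \<in> carrier C \<and> x \<noteq> \<one>"
  proof (rule ccontr)
    assume "\<nexists>x. x \<in> carrier C \<and> x \<noteq> \<one>"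
    then have "carrier C = {\<one>}" by auto
    then have "order C = 1" by (simp add: Coset.order_def)
    then show False using order_C \<nu> by simp
  qed
  then have "nontriv \<in> carrier C \<and> nontriv \<noteq> \<one>" unfolding nontriv_def by (rule someI_ex)
  then show "nontriv \<in> carrier C" "nontriv \<noteq> \<one>" by auto
qed

definition class_rep :: "nat \<Rightarrow> nat set \<Rightarrow> nat \<Rightarrow> 'c" where
  "class_rep n T = (\<lambda>i\<in>{1..<n}. if i \<in> T then nontriv else \<one>)"

lemma class_rep_carrier: "class_rep n T \<in> carrier (Q_group C n)"
  by (auto simp: carrier_Q_group[OF is_group] class_rep_def nontriv)

lemma superclass_class_rep: "T \<subseteq> {1..<n} \<Longrightarrow> class_rep n T \<in> superclass C n T"
  using class_rep_carrier by (simp add: superclass_def) (auto simp: class_rep_def nontriv)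

text \<open>Values at representatives of the superclasses turn a linear relation into equations between
  weighted sums of the coefficients.  Their alternating sums over the subsets of a set \<open>K\<close> retain the
  coefficients with \<open>I\<close> inside the complement of \<open>K\<close>, so these add up to 0 for every \<open>K\<close>.\<close>

lemma indep_superchar: "indep_family degree_sets (superchar_basis C)"
  unfolding indep_family_def
proof (intro allI impI ballI)
  fix S c p assume S: "finite S" "S \<subseteq> degree_sets"
    and zero: "(\<Sum>k\<in>S. fscale (c k) (superchar_basis C k)) = 0" and p: "p \<in> S"
  \<comment> \<open>The value of \<open>rbar\<close> away from the identity.\<close>
  define t :: complex where "t = - 1 / (of_nat \<nu> - 1)"
  have t: "1 - t \<noteq> 0" using \<nu> by (simp add: t_def field_simps)
  obtain n J where nJ: "p = (n, J)" by (cases p)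
  define N where "N = {1..<n}"
  have N: "finite N" by (simp add: N_def)
  define c' where "c' I = (if (n, I) \<in> S then c (n, I) else 0)" for I
  have at_class: "(\<Sum>I\<in>Pow N. c' I * (\<Prod>i\<in>N - I. if i \<in> T then t else 1)) = 0" if T: "T \<subseteq> N" for T
  proof -
    let ?v = "\<lambda>I. \<Prod>i\<in>N - I. if i \<in> T then t else 1"
    have val: "superchar_basis C k (n, class_rep n T) = (if fst k = n then ?v (snd k) else 0)" if "k \<in> S" for k
    proof (cases k)
      case (Pair m I)
      then have I: "I \<subseteq> {1..<m}" using that S by (auto simp: degree_sets_def)
      have "rbar C (class_rep n T i) = (if i \<in> T then t else 1)" if "i \<in> N" for i
        using that by (simp add: class_rep_def N_def rbar_eq nontriv t_def)
      then have "(\<Prod>i\<in>N - I. rbar C (class_rep n T i)) = ?v I" by (intro prod.cong) auto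
      then show ?thesis
        unfolding Pair superchar_basis_eq[OF I] using class_rep_carrier by (auto simp: N_def)
    qed
    have "0 = (\<Sum>k\<in>S. fscale (c k) (superchar_basis C k)) (n, class_rep n T)" unfolding zero by simp
    also have "\<dots> = (\<Sum>k\<in>S. if fst k = n then c k * ?v (snd k) else 0)"
      unfolding sum_fun_apply fscale_def by (intro sum.cong) (auto simp: val)
    also have "\<dots> = (\<Sum>k\<in>{k \<in> S. fst k = n}. c k * ?v (snd k))"
      using S(1) by (simp add: sum.inter_filter)
    also have "\<dots> = (\<Sum>I\<in>{I. (n, I) \<in> S}. c (n, I) * ?v I)"
      by (rule sum.reindex_bij_witness[of _ "\<lambda>I. (n, I)" snd]) auto
    also have "\<dots> = (\<Sum>I\<in>Pow N. c' I * ?v I)"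
      using S N by (intro sum.mono_neutral_cong_left) (auto simp: c'_def N_def degree_sets_def)
    finally show ?thesis by simp
  qed
  have "(\<Sum>I\<in>Pow L. c' I) = 0" if L: "L \<subseteq> N" for L
  proof -
    define K where "K = N - L"
    have K: "K \<subseteq> N" by (auto simp: K_def)
    have "0 = (\<Sum>T\<in>Pow K. (- 1) ^ card T * (\<Sum>I\<in>Pow N. c' I * (\<Prod>i\<in>N - I. if i \<in> T then t else 1)))"
      using K by (intro sum.neutral[symmetric] ballI) (simp add: at_class subset_trans)
    also have "\<dots> = (\<Sum>I\<in>Pow N. c' I * (\<Sum>T\<in>Pow K. (- 1) ^ card T * (\<Prod>i\<in>N - I. if i \<in> T then t else 1)))"
      unfolding sum_distrib_left by (subst sum.swap) (simp add: mult_ac)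
    also have "\<dots> = (\<Sum>I\<in>Pow N. if K \<inter> I = {} then c' I * (1 - t) ^ card K else 0)"
      unfolding alternating_sum_weights[OF N K] by (intro sum.cong) auto
    also have "\<dots> = (\<Sum>I\<in>Pow L. c' I * (1 - t) ^ card K)"
      using N L by (intro sum.mono_neutral_cong_right) (auto simp: K_def)
    finally have "(\<Sum>I\<in>Pow L. c' I) * (1 - t) ^ card K = 0" by (simp add: sum_distrib_right)
    then show ?thesis using t by simp
  qed
  moreover have "J \<subseteq> N" using p S nJ by (auto simp: degree_sets_def N_def)
  ultimately have "c' J = 0" using subset_sums_zero[OF N] by blast
  then show "c p = 0" using p nJ by (simp add: c'_def)
qed

lemma superchar_in_SCF:
  assumes "p \<in> degree_sets"
  shows "superchar_basis C p \<in> SCF C"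
proof -
  obtain n I where p: "p = (n, I)" and I: "I \<subseteq> {1..<n}" using assms by (auto simp: degree_sets_def)
  have comp: "component (superchar_basis C p) k g = (if k = n \<and> g \<in> carrier (Q_group C n)
      then \<Prod>i\<in>{1..<n} - I. rbar C (g i) else 0)" for k g
    unfolding component_def p by (rule superchar_basis_eq[OF I])
  have "component (superchar_basis C p) k \<in> scf C k" for k
  proof -
    have eq: "component (superchar_basis C p) k g = component (superchar_basis C p) k h"
      if g: "g \<in> superclass C k T" and h: "h \<in> superclass C k T" for g h T
    proof -
      have c: "g \<in> carrier (Q_group C k)" "h \<in> carrier (Q_group C k)"
        using g h by (auto simp: superclass_def)
      have "rbar C (g i) = rbar C (h i)" if "i \<in> {1..<k}" for i
      proof -
        have "g i \<in> carrier C" "h i \<in> carrier C" using c that by (auto simp: carrier_Q_group[OF is_group])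
        moreover have "g i = \<one> \<longleftrightarrow> h i = \<one>" using g h that by (auto simp: superclass_def)
        ultimately show ?thesis by (simp add: rbar_eq)
      qed
      then show ?thesis unfolding comp using c by (auto intro!: prod.cong)
    qed
    show ?thesis
      unfolding scf_def cf_def mem_Collect_eq
    proof (intro conjI allI impI ballI)
      show "component (superchar_basis C p) k g = 0" if "g \<notin> carrier (Q_group C k)" for g
        using that by (auto simp: comp)
    qed (rule eq)
  qed
  moreover have "finite {k. component (superchar_basis C p) k \<noteq> 0}"
    by (rule finite_subset[of _ "{n}"]) (auto simp: comp fun_eq_iff)
  ultimately show ?thesis by (simp add: SCF_def)
qed

lemma subspace_scf: "fs.subspace (scf C n)"
proof (rule fs.subspaceI)
  have scfD: "g \<notin> carrier (Q_group C n) \<Longrightarrow> \<phi> g = 0"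
    "\<lbrakk>I \<subseteq> {1..<n}; g \<in> superclass C n I; h \<in> superclass C n I\<rbrakk> \<Longrightarrow> \<phi> g = \<phi> h"
    if "\<phi> \<in> scf C n" for \<phi> g h I
    using that unfolding scf_def cf_def by blast+
  have scfI: "\<phi> \<in> scf C n" if "\<And>g. g \<notin> carrier (Q_group C n) \<Longrightarrow> \<phi> g = 0"
    "\<And>I g h. \<lbrakk>I \<subseteq> {1..<n}; g \<in> superclass C n I; h \<in> superclass C n I\<rbrakk> \<Longrightarrow> \<phi> g = \<phi> h" for \<phi>
    using that unfolding scf_def cf_def by blast
  show "0 \<in> scf C n" by (rule scfI) simp_all
  show "\<phi> + \<psi> \<in> scf C n" if "\<phi> \<in> scf C n" "\<psi> \<in> scf C n" for \<phi> \<psi>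
  proof (rule scfI)
    show "(\<phi> + \<psi>) g = 0" if "g \<notin> carrier (Q_group C n)" for g
      using scfD(1)[OF \<open>\<phi> \<in> _\<close> that] scfD(1)[OF \<open>\<psi> \<in> _\<close> that] by simp
    show "(\<phi> + \<psi>) g = (\<phi> + \<psi>) h"
      if "I \<subseteq> {1..<n}" "g \<in> superclass C n I" "h \<in> superclass C n I" for I g h
      using scfD(2)[OF \<open>\<phi> \<in> _\<close> that] scfD(2)[OF \<open>\<psi> \<in> _\<close> that] by simp
  qed
  show "fscale r \<phi> \<in> scf C n" if "\<phi> \<in> scf C n" for r \<phi>
  proof (rule scfI)
    show "fscale r \<phi> g = 0" if "g \<notin> carrier (Q_group C n)" for g
      using scfD(1)[OF \<open>\<phi> \<in> _\<close> that] by (simp add: fscale_def)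
    show "fscale r \<phi> g = fscale r \<phi> h"
      if "I \<subseteq> {1..<n}" "g \<in> superclass C n I" "h \<in> superclass C n I" for I g h
      using scfD(2)[OF \<open>\<phi> \<in> _\<close> that] by (simp add: fscale_def)
  qed
qed

lemma subspace_SCF: "fs.subspace (SCF C)"
proof (rule fs.subspaceI)
  have comp: "component (F + G) n = component F n + component G n" "component (fscale r F) n = fscale r (component F n)"
    "component 0 n = 0" for F G :: "nat \<times> (nat \<Rightarrow> 'c) \<Rightarrow> complex" and n r
    by (auto simp: component_def fscale_def)
  show "0 \<in> SCF C" using fs.subspace_0[OF subspace_scf] by (simp add: SCF_def comp del: zero_fun_apply)
  show "F + G \<in> SCF C" if "F \<in> SCF C" "G \<in> SCF C" for F G
    unfolding SCF_def mem_Collect_eq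
  proof (intro conjI allI)
    show "component (F + G) n \<in> scf C n" for n
      unfolding comp by (rule fs.subspace_add[OF subspace_scf]) (use that in \<open>simp_all add: SCF_def\<close>)
    show "finite {n. component (F + G) n \<noteq> 0}"
      by (rule finite_subset[of _ "{n. component F n \<noteq> 0} \<union> {n. component G n \<noteq> 0}"])
        (use that in \<open>auto simp: comp SCF_def\<close>)
  qed
  show "fscale r F \<in> SCF C" if "F \<in> SCF C" for r F
    unfolding SCF_def mem_Collect_eq
  proof (intro conjI allI)
    show "component (fscale r F) n \<in> scf C n" for n
      unfolding comp by (rule fs.subspace_scale[OF subspace_scf]) (use that in \<open>simp add: SCF_def\<close>)
    show "finite {n. component (fscale r F) n \<noteq> 0}"
      by (rule finite_subset[of _ "{n. component F n \<noteq> 0}"]) (use that in \<open>auto simp: comp SCF_def\<close>)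
  qed
qed

text \<open>The indicator of a superclass is a product over the coordinates of indicators of the
  identity or of its complement.  Each of these is affine in \<open>rbar\<close>, and expanding the product gives a
  combination of products of \<open>rbar\<close>, that is, of supercharacters.\<close>

lemma superclass_indicator_in_span:
  assumes T: "T \<subseteq> {1..<n}"
  shows "in_degree n (\<lambda>g. of_bool (g \<in> superclass C n T)) \<in> fs.span (superchar_basis C ` degree_sets)"
proof -
  define t :: complex where "t = - 1 / (of_nat \<nu> - 1)"
  have t: "1 - t \<noteq> 0" using \<nu> by (simp add: t_def field_simps)
  define N where "N = {1..<n}"
  have N: "finite N" by (simp add: N_def)
  \<comment> \<open>The affine function \<open>a * rbar + b\<close> is the indicator of the complement of the identity if \<open>i\<close>
    belongs to \<open>T\<close>, and the indicator of the identity otherwise.\<close>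
  define a where "a i = (if i \<in> T then - 1 / (1 - t) else 1 / (1 - t))" for i
  define b where "b i = (if i \<in> T then 1 / (1 - t) else - t / (1 - t))" for i
  have ind: "of_bool (g \<in> superclass C n T) = (\<Prod>i\<in>N. a i * rbar C (g i) + b i)"
    if g: "g \<in> carrier (Q_group C n)" for g
  proof -
    have f: "a i * rbar C (g i) + b i = (if g i \<noteq> \<one> \<longleftrightarrow> i \<in> T then 1 else 0)" if i: "i \<in> N" for i
    proof -
      have "g i \<in> carrier C" using g i by (auto simp: carrier_Q_group[OF is_group] N_def)
      then have "rbar C (g i) = (if g i = \<one> then 1 else t)" by (simp add: rbar_eq t_def)
      then show ?thesis using t by (auto simp: a_def b_def divide_simps)
    qed
    have "(\<Prod>i\<in>N. a i * rbar C (g i) + b i) = (\<Prod>i\<in>N. if g i \<noteq> \<one> \<longleftrightarrow> i \<in> T then 1 else 0)"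
      by (rule prod.cong[OF refl f])
    also have "\<dots> = of_bool (\<forall>i\<in>N. g i \<noteq> \<one> \<longleftrightarrow> i \<in> T)"
    proof (cases "\<forall>i\<in>N. g i \<noteq> \<one> \<longleftrightarrow> i \<in> T")
      case False
      then have "(\<Prod>i\<in>N. if g i \<noteq> \<one> \<longleftrightarrow> i \<in> T then 1 else 0 :: complex) = 0"
        using N by (intro prod_zero) auto
      then show ?thesis using False by simp
    qed simp
    finally show ?thesis using g by (simp add: superclass_def N_def)
  qed
  have "in_degree n (\<lambda>g. of_bool (g \<in> superclass C n T))
      = (\<Sum>B\<in>Pow N. fscale (prod a B * prod b (N - B)) (superchar_basis C (n, N - B)))"
  proof (rule ext, clarify)
    fix k g
    have sub: "N - B \<subseteq> {1..<n}" for B by (auto simp: N_def)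
    show "in_degree n (\<lambda>g. of_bool (g \<in> superclass C n T)) (k, g)
      = (\<Sum>B\<in>Pow N. fscale (prod a B * prod b (N - B)) (superchar_basis C (n, N - B))) (k, g)"
    proof (cases "k = n \<and> g \<in> carrier (Q_group C n)")
      case True
      then have "in_degree n (\<lambda>g. of_bool (g \<in> superclass C n T)) (k, g) = (\<Prod>i\<in>N. a i * rbar C (g i) + b i)"
        by (simp add: in_degree_def ind)
      also have "\<dots> = (\<Sum>B\<in>Pow N. (\<Prod>i\<in>B. a i * rbar C (g i)) * prod b (N - B))"
        by (rule prod_add[OF N])
      also have "\<dots> = (\<Sum>B\<in>Pow N. fscale (prod a B * prod b (N - B)) (superchar_basis C (n, N - B)) (k, g))"
      proof (rule sum.cong[OF refl])
        fix B assume "B \<in> Pow N"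
        then have "{1..<n} - (N - B) = B" by (auto simp: N_def)
        then show "(\<Prod>i\<in>B. a i * rbar C (g i)) * prod b (N - B)
            = fscale (prod a B * prod b (N - B)) (superchar_basis C (n, N - B)) (k, g)"
          using True by (simp add: fscale_def superchar_basis_eq[OF sub] prod.distrib mult_ac)
      qed
      finally show ?thesis unfolding sum_fun_apply .
    next
      case False
      then show ?thesis unfolding sum_fun_apply fscale_def superchar_basis_eq[OF sub]
        by (auto simp: in_degree_def superclass_def)
    qed
  qed
  also have "\<dots> \<in> fs.span (superchar_basis C ` degree_sets)"
    by (intro fs.span_sum fs.span_scale fs.span_base imageI) (auto simp: degree_sets_def N_def)
  finally show ?thesis .
qed

lemma span_superchar: "fs.span (superchar_basis C ` degree_sets) = SCF C"
proof (rule equalityI; rule subsetI)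
  fix F assume "F \<in> fs.span (superchar_basis C ` degree_sets)"
  then show "F \<in> SCF C"
    by (rule fs.span_minimal[OF _ subspace_SCF, THEN subsetD, rotated]) (auto simp: superchar_in_SCF)
next
  fix F assume F: "F \<in> SCF C"
  define D where "D = {n. component F n \<noteq> 0}"
  have D: "finite D" using F by (simp add: SCF_def D_def)
  have "F = (\<Sum>n\<in>D. \<Sum>T\<in>Pow {1..<n}. fscale (F (n, class_rep n T)) (in_degree n (\<lambda>g. of_bool (g \<in> superclass C n T))))"
  proof (rule ext, clarify)
    fix k g
    have cF: "component F k \<in> scf C k" using F by (simp add: SCF_def)
    define T where "T = {i \<in> {1..<k}. g i \<noteq> \<one>}"
    have "(\<Sum>n\<in>D. \<Sum>T\<in>Pow {1..<n}. fscale (F (n, class_rep n T)) (in_degree n (\<lambda>g. of_bool (g \<in> superclass C n T)))) (k, g)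
        = (\<Sum>n\<in>D. if n = k then \<Sum>T\<in>Pow {1..<k}. F (k, class_rep k T) * of_bool (g \<in> superclass C k T) else 0)"
      unfolding sum_fun_apply by (intro sum.cong) (auto simp: fscale_def in_degree_def)
    also have "\<dots> = (if k \<in> D then \<Sum>T\<in>Pow {1..<k}. F (k, class_rep k T) * of_bool (g \<in> superclass C k T) else 0)"
      using D by simp
    also have "\<dots> = F (k, g)"
    proof (cases "k \<in> D \<and> g \<in> carrier (Q_group C k)")
      case True
      have "(\<Sum>T'\<in>Pow {1..<k}. F (k, class_rep k T') * of_bool (g \<in> superclass C k T'))
          = (\<Sum>T'\<in>Pow {1..<k}. if T' = T then F (k, class_rep k T) else 0)"
        using True by (intro sum.cong) (auto simp: superclass_def T_def)
      also have "\<dots> = F (k, class_rep k T)"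
      proof -
        have "T \<in> Pow {1..<k}" by (auto simp: T_def)
        then show ?thesis by (simp only: sum.delta finite_Pow_iff finite_atLeastLessThan if_True)
      qed
      also have "\<dots> = F (k, g)"
      proof -
        have "g \<in> superclass C k T" "T \<subseteq> {1..<k}" using True by (auto simp: superclass_def T_def)
        then have "component F k (class_rep k T) = component F k g"
          using cF superclass_class_rep unfolding scf_def by blast
        then show ?thesis by (simp add: component_def)
      qed
      finally show ?thesis using True by simp
    next
      case False
      have "F (k, g) = 0"
      proof (cases "k \<in> D")
        case True
        then have "g \<notin> carrier (Q_group C k)" using False by simp
        then have "component F k g = 0" using cF by (auto simp: scf_def cf_def)
        then show ?thesis by (simp add: component_def)
      next
        case False
        then have "component F k g = 0" by (simp add: D_def)
        then show ?thesis by (simp add: component_def)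
      qed
      then show ?thesis using False by (auto simp: superclass_def intro!: sum.neutral)
    qed
    finally show "F (k, g) = (\<Sum>n\<in>D. \<Sum>T\<in>Pow {1..<n}. fscale (F (n, class_rep n T)) (in_degree n (\<lambda>g. of_bool (g \<in> superclass C n T)))) (k, g)" ..
  qed
  also have "\<dots> \<in> fs.span (superchar_basis C ` degree_sets)"
    by (intro fs.span_sum fs.span_scale superclass_indicator_in_span) auto
  finally show "F \<in> fs.span (superchar_basis C ` degree_sets)" .
qed

end

section \<open>Words, ascents and fundamental quasisymmetric functions\<close>

text \<open>A monomial as a weakly increasing word.  In this form the fundamental functions have a simple
  description, and factorisations become colourings of letters.\<close>

definition word :: "(nat \<Rightarrow>\<^sub>0 nat) \<Rightarrow> nat list" where
  "word m = concat (map (\<lambda>i. replicate (Poly_Mapping.lookup m i) i) (sorted_list_of_set (Poly_Mapping.keys m)))"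

text \<open>Positions are counted from 1, so that \<open>k\<close> is the place between the \<open>k\<close>-th and the next letter.\<close>

definition ascents :: "nat list \<Rightarrow> nat set" where
  "ascents w = {k. 0 < k \<and> k < length w \<and> w ! (k - 1) < w ! k}"

text \<open>The proper partial sums, which are the set that corresponds to a composition.  The offset \<open>a\<close>
  makes the recursion go through.\<close>

fun breaks :: "nat \<Rightarrow> nat list \<Rightarrow> nat set" where
  "breaks a [] = {}"
| "breaks a [x] = {}"
| "breaks a (x # y # \<alpha>) = insert (a + x) (breaks (a + x) (y # \<alpha>))"

lemma breaks_bounds:
  assumes "\<alpha> \<in> compositions"
  shows "breaks a \<alpha> \<subseteq> {a<..<a + sum_list \<alpha>}"
  using assms
proof (induction a \<alpha> rule: breaks.induct)
  case (3 a x y \<alpha>)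
  have "breaks (a + x) (y # \<alpha>) \<subseteq> {a + x<..<a + x + sum_list (y # \<alpha>)}"
    using 3 by (auto simp: compositions_def)
  moreover have "0 < x" "0 < y" using 3 by (auto simp: compositions_def)
  ultimately show ?case by auto
qed auto

lemma finite_breaks: "finite (breaks a \<alpha>)"
  by (induction a \<alpha> rule: breaks.induct) auto

lemma breaks_shift: "breaks (a + b) \<alpha> = (+) a ` breaks b \<alpha>"
  by (induction b \<alpha> rule: breaks.induct) (auto simp: add.assoc)

lemma breaks_append:
  "\<alpha> \<noteq> [] \<Longrightarrow> \<beta> \<noteq> [] \<Longrightarrow>
    breaks a (\<alpha> @ \<beta>) = breaks a \<alpha> \<union> insert (a + sum_list \<alpha>) (breaks (a + sum_list \<alpha>) \<beta>)"
proof (induction a \<alpha> rule: breaks.induct)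
  case (2 a x)
  then show ?case by (cases \<beta>) auto
next
  case (3 a x y \<alpha>)
  then show ?case by (simp add: add.assoc) blast
qed simp

lemma differences_breaks:
  assumes "\<alpha> \<in> compositions" "\<alpha> \<noteq> []"
  shows "map2 (-) (sorted_list_of_set (breaks a \<alpha>) @ [a + sum_list \<alpha>]) (a # sorted_list_of_set (breaks a \<alpha>)) = \<alpha>"
  using assms
proof (induction a \<alpha> rule: breaks.induct)
  case (3 a x y \<alpha>)
  have c: "y # \<alpha> \<in> compositions" using 3 by (auto simp: compositions_def)
  have "sorted_list_of_set (insert (a + x) (breaks (a + x) (y # \<alpha>)))
      = (a + x) # sorted_list_of_set (breaks (a + x) (y # \<alpha>))"
  proof -
    let ?B = "breaks (a + x) (y # \<alpha>)"
    have "?B - {a + x} = ?B" "\<forall>b\<in>?B. a + x \<le> b" using breaks_bounds[OF c, of "a + x"] by auto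
    then show ?thesis
      unfolding sorted_list_of_set_insert_remove[OF finite_breaks]
      by (simp add: insort_is_Cons finite_breaks del: breaks.simps)
  qed
  then show ?case using 3 c by (simp add: add.assoc)
qed auto

lemma comp_of_breaks: "\<alpha> \<in> compositions \<Longrightarrow> comp_of (sum_list \<alpha>) (breaks 0 \<alpha>) = \<alpha>"
proof (cases "\<alpha> = []")
  case False
  assume \<alpha>: "\<alpha> \<in> compositions"
  then have "sum_list \<alpha> \<noteq> 0" using False by (cases \<alpha>) (auto simp: compositions_def)
  then show ?thesis
    using differences_breaks[OF \<alpha> False, of 0] by (simp only: comp_of_def Let_def if_False add_0)
qed (simp add: comp_of_def)

lemma differences_sorted:
  assumes "sorted_wrt (<) s" "\<forall>x\<in>set s. a < x \<and> x < n" "a < n"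
  shows "map2 (-) (s @ [n]) (a # s) \<in> compositions \<and> a + sum_list (map2 (-) (s @ [n]) (a # s)) = n
    \<and> breaks a (map2 (-) (s @ [n]) (a # s)) = set s"
  using assms
proof (induction s arbitrary: a)
  case (Cons x s)
  have IH: "map2 (-) (s @ [n]) (x # s) \<in> compositions \<and> x + sum_list (map2 (-) (s @ [n]) (x # s)) = n
    \<and> breaks x (map2 (-) (s @ [n]) (x # s)) = set s"
    using Cons by auto
  have ax: "a + (x - a) = x" "0 < x - a" using Cons by auto
  obtain y \<beta> where y: "map2 (-) (s @ [n]) (x # s) = y # \<beta>" by (cases s) auto
  have "breaks a ((x - a) # map2 (-) (s @ [n]) (x # s)) = insert x (breaks x (map2 (-) (s @ [n]) (x # s)))"
    unfolding y breaks.simps ax(1) ..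
  then show ?case using IH ax by (auto simp: compositions_def)
qed (auto simp: compositions_def)

lemma comp_of_facts:
  assumes "J \<subseteq> {1..<n}"
  shows "comp_of n J \<in> compositions" "sum_list (comp_of n J) = n" "breaks 0 (comp_of n J) = J"
proof -
  have J: "finite J" using assms by (rule finite_subset) simp
  have "comp_of n J \<in> compositions \<and> sum_list (comp_of n J) = n \<and> breaks 0 (comp_of n J) = J"
  proof (cases "n = 0")
    case True
    then show ?thesis using assms by (auto simp: comp_of_def compositions_def)
  next
    case False
    have "sorted_wrt (<) (sorted_list_of_set J)" by (rule strict_sorted_list_of_set)
    moreover have "\<forall>x\<in>set (sorted_list_of_set J). 0 < x \<and> x < n" using J assms by auto
    ultimately show ?thesis
      using differences_sorted[of "sorted_list_of_set J" 0 n] False J by (simp add: comp_of_def Let_def)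
  qed
  then show "comp_of n J \<in> compositions" "sum_list (comp_of n J) = n" "breaks 0 (comp_of n J) = J"
    by blast+
qed

text \<open>Among the sets \<open>J\<close> that contain \<open>I\<close>, only the one belonging to the exponents of \<open>m\<close> contributes.\<close>

lemma qsym_L_eq: "qsym_L n I m = of_bool (total_degree m = n \<and> I \<subseteq> breaks 0 (expos m))"
proof -
  let ?\<alpha> = "expos m"
  have eq: "?\<alpha> = comp_of n J \<longleftrightarrow> total_degree m = n \<and> J = breaks 0 ?\<alpha>" if "J \<subseteq> {1..<n}" for J
    unfolding total_degree_expos
    using comp_of_facts(2,3)[OF that] comp_of_breaks[OF expos_composition[of m]] by metis
  have "qsym_L n I m = (\<Sum>J\<in>{J. I \<subseteq> J \<and> J \<subseteq> {1..<n}}.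
      if J = breaks 0 ?\<alpha> then of_bool (total_degree m = n) else 0)"
    unfolding qsym_L_def sum_fun_apply
    by (rule sum.cong[OF refl]) (simp add: qsym_M_eq comp_of_facts(1) eq)
  also have "\<dots> = (if I \<subseteq> breaks 0 ?\<alpha> \<and> breaks 0 ?\<alpha> \<subseteq> {1..<n} then of_bool (total_degree m = n) else 0)"
    by (subst sum.delta) (auto intro: finite_subset[of _ "Pow {1..<n}"])
  also have "\<dots> = of_bool (total_degree m = n \<and> I \<subseteq> breaks 0 ?\<alpha>)"
  proof -
    have "breaks 0 ?\<alpha> \<subseteq> {1..<n}" if "total_degree m = n"
      using breaks_bounds[OF expos_composition[of m], of 0] that by (auto simp: total_degree_expos)
    then show ?thesis by auto
  qed
  finally show ?thesis .
qed

lemma ascents_replicate_append: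
  assumes "0 < x" "w \<noteq> []" "v < hd w"
  shows "ascents (replicate x v @ w) = insert x ((+) x ` ascents w)"
proof (rule equalityI; rule subsetI)
  fix k assume k: "k \<in> ascents (replicate x v @ w)"
  then have k1: "0 < k" "k < x + length w" "(replicate x v @ w) ! (k - 1) < (replicate x v @ w) ! k"
    by (auto simp: ascents_def)
  consider "k < x" | "k = x" | "x < k" by linarith
  then show "k \<in> insert x ((+) x ` ascents w)"
  proof cases
    case 1
    then have "k - 1 < x" by simp
    then show ?thesis using k1 1 by (simp add: nth_append)
  next
    case 3
    then have "\<not> k - 1 < x" "k - 1 - x = k - x - 1" by auto
    then have "k - x \<in> ascents w" using 3 k1 by (simp add: ascents_def nth_append)
    moreover have "k = x + (k - x)" using 3 by simp
    ultimately show ?thesis by blast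
  qed simp
next
  fix k assume "k \<in> insert x ((+) x ` ascents w)"
  then consider "k = x" | j where "k = x + j" "j \<in> ascents w" by auto
  then show "k \<in> ascents (replicate x v @ w)"
  proof cases
    case 1
    then show ?thesis using assms by (simp add: ascents_def nth_append hd_conv_nth)
  next
    case 2
    then have "\<not> k - 1 < x" "k - 1 - x = j - 1" "0 < j" by (auto simp: ascents_def)
    then show ?thesis using 2 by (simp add: ascents_def nth_append)
  qed
qed

text \<open>A weakly increasing word ascends exactly at the ends of its blocks of equal letters, and the
  ends of blocks are the partial sums of the block lengths.\<close>

lemma ascents_concat_replicate:
  assumes "sorted_wrt (<) ks" "\<forall>i\<in>set ks. 0 < f i"
  shows "ascents (concat (map (\<lambda>i. replicate (f i) i) ks)) = breaks 0 (map f ks)"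
  using assms
proof (induction ks rule: induct_list012)
  case 1
  then show ?case by (simp add: ascents_def)
next
  case (2 i)
  then show ?case by (auto simp: ascents_def)
next
  case (3 i j ks)
  let ?w = "concat (map (\<lambda>i. replicate (f i) i) (j # ks))"
  have j: "0 < f j" using 3 by simp
  then have "?w \<noteq> []" "hd ?w = j" by auto
  then have "ascents (replicate (f i) i @ ?w) = insert (f i) ((+) (f i) ` ascents ?w)"
    using 3 by (intro ascents_replicate_append) auto
  also have "ascents ?w = breaks 0 (map f (j # ks))" using 3 by simp
  also have "(+) (f i) ` breaks 0 (map f (j # ks)) = breaks (f i) (map f (j # ks))"
    using breaks_shift[of "f i" 0] by simp
  finally show ?case by simp
qed

lemma ascents_word: "ascents (word m) = breaks 0 (expos m)"
  unfolding word_def expos_def by (rule ascents_concat_replicate) (auto simp: in_keys_iff)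

lemma length_word: "length (word m) = total_degree m"
  by (simp add: word_def length_concat comp_def total_degree_expos expos_def)

lemma qsym_L_word: "qsym_L n I m = of_bool (length (word m) = n \<and> I \<subseteq> ascents (word m))"
  by (simp add: qsym_L_eq length_word ascents_word)

lemma qsym_L_in_QSym: "qsym_L n I \<in> QSym"
  by (rule QSymI[of _ n "\<lambda>\<alpha>. of_bool (sum_list \<alpha> = n \<and> I \<subseteq> breaks 0 \<alpha>)"])
    (auto simp: qsym_L_eq total_degree_expos split: if_splits)

lemma count_concat_replicate:
  "distinct ks \<Longrightarrow> count (mset (concat (map (\<lambda>i. replicate (f i) i) ks))) x = (if x \<in> set ks then f x else 0)"
  by (induction ks) auto

lemma count_word: "count (mset (word m)) x = Poly_Mapping.lookup m x"
  by (simp add: word_def count_concat_replicate in_keys_iff)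

lemma sorted_word: "sorted (word m)"
proof -
  have *: "sorted (concat (map (\<lambda>i. replicate (f i) i) ks))" if "sorted_wrt (<) ks" for f and ks :: "nat list"
    using that by (induction ks) (auto simp: sorted_append)
  show ?thesis unfolding word_def by (rule *) simp
qed

definition word_monomial :: "nat list \<Rightarrow> (nat \<Rightarrow>\<^sub>0 nat)" where
  "word_monomial w = (\<Sum>x\<leftarrow>w. Poly_Mapping.single x 1)"

lemma lookup_word_monomial: "Poly_Mapping.lookup (word_monomial w) x = count (mset w) x"
  by (induction w) (auto simp: word_monomial_def lookup_add lookup_single when_def)

lemma word_monomial_eq_iff: "word_monomial u = word_monomial v \<longleftrightarrow> mset u = mset v"
  by (auto simp: poly_mapping_eq_iff fun_eq_iff lookup_word_monomial multiset_eq_iff)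

lemma word_monomial_word: "word_monomial (word m) = m"
  by (rule poly_mapping_eqI) (simp add: lookup_word_monomial count_word)

lemma word_word_monomial: "sorted w \<Longrightarrow> word (word_monomial w) = w"
  using word_monomial_eq_iff[of "word (word_monomial w)" w] sorted_word[of "word_monomial w"]
  by (metis word_monomial_word properties_for_sort)

lemma word_monomial_append: "word_monomial (u @ v) = word_monomial u + word_monomial v"
  by (simp add: word_monomial_def)

section \<open>Products of fundamental quasisymmetric functions\<close>

definition subword :: "nat list \<Rightarrow> nat set \<Rightarrow> nat list" where
  "subword w X = map (\<lambda>i. w ! (i - 1)) (sorted_list_of_set X)"

text \<open>A word together with a two-colouring of its positions, as a word of naturals: the letters
  \<open>2 x\<close> and \<open>2 x + 1\<close> stand for the uncoloured and the coloured copy of \<open>x\<close>.\<close>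

definition coloured :: "nat list \<Rightarrow> nat set \<Rightarrow> nat list" where
  "coloured w A = map (\<lambda>i. 2 * w ! (i - 1) + of_bool (i \<in> A)) [1..<Suc (length w)]"

lemma length_coloured: "length (coloured w A) = length w"
  by (simp add: coloured_def del: upt_Suc)

lemma coloured_nth: "i < length w \<Longrightarrow> coloured w A ! i = 2 * w ! i + of_bool (Suc i \<in> A)"
  by (simp add: coloured_def del: upt_Suc)

text \<open>In a weakly increasing word the coloured letters can be out of order only where two equal
  letters follow each other, the first coloured and the second not; such a place is an edge of \<open>A\<close>.\<close>

lemma sorted_coloured:
  assumes "sorted w"
  shows "sorted (coloured w A) \<longleftrightarrow> edge (length w) A \<subseteq> ascents w"
proof -
  have "sorted (coloured w A) \<longleftrightarrow> (\<forall>i. Suc i < length w \<longrightarrow> coloured w A ! i \<le> coloured w A ! Suc i)"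
    unfolding sorted_iff_nth_Suc length_coloured ..
  also have "\<dots> \<longleftrightarrow> (\<forall>i. Suc i < length w \<longrightarrow> Suc i \<in> A \<longrightarrow> Suc (Suc i) \<notin> A \<longrightarrow> w ! i < w ! Suc i)"
  proof (intro all_cong)
    fix i assume i: "Suc i < length w"
    then have "w ! i \<le> w ! Suc i" using assms by (simp add: sorted_iff_nth_Suc)
    then show "coloured w A ! i \<le> coloured w A ! Suc i \<longleftrightarrow>
        (Suc i \<in> A \<longrightarrow> Suc (Suc i) \<notin> A \<longrightarrow> w ! i < w ! Suc i)"
      using i by (auto simp: coloured_nth of_bool_def)
  qed
  also have "\<dots> \<longleftrightarrow> edge (length w) A \<subseteq> ascents w"
  proof
    assume *: "\<forall>i. Suc i < length w \<longrightarrow> Suc i \<in> A \<longrightarrow> Suc (Suc i) \<notin> A \<longrightarrow> w ! i < w ! Suc i"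
    show "edge (length w) A \<subseteq> ascents w"
    proof
      fix k assume k: "k \<in> edge (length w) A"
      then obtain i where "k = Suc i" by (cases k) (auto simp: edge_def)
      then show "k \<in> ascents w" using k * by (auto simp: edge_def ascents_def)
    qed
  next
    assume *: "edge (length w) A \<subseteq> ascents w"
    show "\<forall>i. Suc i < length w \<longrightarrow> Suc i \<in> A \<longrightarrow> Suc (Suc i) \<notin> A \<longrightarrow> w ! i < w ! Suc i"
    proof (intro allI impI)
      fix i assume "Suc i < length w" "Suc i \<in> A" "Suc (Suc i) \<notin> A"
      then have "Suc i \<in> ascents w" using * by (auto simp: edge_def)
      then show "w ! i < w ! Suc i" by (simp add: ascents_def)
    qed
  qed
  finally show ?thesis .
qed

lemma mset_subword: "finite X \<Longrightarrow> mset (subword w X) = image_mset (\<lambda>i. w ! (i - 1)) (mset_set X)"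
  by (simp add: subword_def) (metis mset_sorted_list_of_multiset sorted_list_of_mset_set)

lemma mset_word_positions: "mset w = image_mset (\<lambda>i. w ! (i - 1)) (mset_set {1..length w})"
proof -
  have "w = map (\<lambda>i. w ! (i - 1)) [1..<Suc (length w)]"
    by (rule nth_equalityI) (simp_all del: upt_Suc)
  then have "mset w = image_mset (\<lambda>i. w ! (i - 1)) (mset [1..<Suc (length w)])"
    by (metis mset_map)
  then show ?thesis by (simp add: atLeastLessThanSuc_atLeastAtMost del: upt_Suc)
qed

lemma mset_set_split:
  assumes "A \<subseteq> {1..N}"
  shows "mset_set {1..N :: nat} = mset_set ({1..N} - A) + mset_set A"
proof -
  have "mset_set (({1..N} - A) \<union> A) = mset_set ({1..N} - A) + mset_set A"
    using assms finite_subset[of A "{1..N}"] by (intro mset_set_Union) auto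
  moreover have "({1..N} - A) \<union> A = {1..N}" using assms by auto
  ultimately show ?thesis by simp
qed

lemma mset_subwords:
  assumes "A \<subseteq> {1..length w}"
  shows "mset (subword w ({1..length w} - A)) + mset (subword w A) = mset w"
  using mset_set_split[OF assms] finite_subset[OF assms]
  by (simp add: mset_subword mset_word_positions[of w])

lemma mset_coloured:
  assumes "A \<subseteq> {1..length w}"
  shows "mset (coloured w A) = image_mset (\<lambda>x. 2 * x) (mset (subword w ({1..length w} - A)))
    + image_mset (\<lambda>x. 2 * x + 1) (mset (subword w A))"
proof -
  have fA: "finite A" using assms by (rule finite_subset) simp
  let ?f = "\<lambda>i. 2 * w ! (i - 1) + of_bool (i \<in> A)"
  have "mset (coloured w A) = image_mset ?f (mset_set {1..length w})"
    by (simp add: coloured_def atLeastLessThanSuc_atLeastAtMost del: upt_Suc)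
  also have "\<dots> = image_mset ?f (mset_set ({1..length w} - A)) + image_mset ?f (mset_set A)"
    by (simp only: mset_set_split[OF assms] image_mset_union)
  also have "image_mset ?f (mset_set ({1..length w} - A))
      = image_mset (\<lambda>i. 2 * w ! (i - 1)) (mset_set ({1..length w} - A))"
    by (rule image_mset_cong) auto
  also have "image_mset ?f (mset_set A) = image_mset (\<lambda>i. 2 * w ! (i - 1) + 1) (mset_set A)"
    using fA by (intro image_mset_cong) auto
  finally show ?thesis using fA by (simp add: mset_subword multiset.map_comp comp_def)
qed

lemma sorted_subword:
  assumes "sorted w" "X \<subseteq> {1..length w}"
  shows "sorted (subword w X)"
proof -
  have "finite X" using assms(2) by (rule finite_subset) simp
  then show ?thesis unfolding subword_def sorted_map
    using assms by (intro sorted_wrt_mono_rel[OF _ sorted_sorted_list_of_set])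
      (auto intro!: sorted_nth_mono simp: subset_iff)
qed

lemma length_subword: "length (subword w X) = card X"
  by (simp add: subword_def)

text \<open>The two colours are told apart by parity.\<close>

lemma even_odd_mset_eq:
  fixes M M' P P' :: "nat multiset"
  assumes "image_mset (\<lambda>x. 2 * x) M + image_mset (\<lambda>x. 2 * x + 1) P
    = image_mset (\<lambda>x. 2 * x) M' + image_mset (\<lambda>x. 2 * x + 1) P'"
  shows "M = M'" "P = P'"
proof -
  have "{#x \<in># image_mset (\<lambda>x. 2 * x) M + image_mset (\<lambda>x. 2 * x + 1) P. even x#} = image_mset (\<lambda>x. 2 * x) M"
    "{#x \<in># image_mset (\<lambda>x. 2 * x) M + image_mset (\<lambda>x. 2 * x + 1) P. odd x#} = image_mset (\<lambda>x. 2 * x + 1) P"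
    for M P :: "nat multiset"
    by (auto simp: filter_mset_image_mset)
  then have "image_mset (\<lambda>x. 2 * x) M = image_mset (\<lambda>x. 2 * x) M'"
    "image_mset (\<lambda>x. 2 * x + 1) P = image_mset (\<lambda>x. 2 * x + 1) P'"
    using assms by metis+
  then have "image_mset (\<lambda>x. x div 2) (image_mset (\<lambda>x. 2 * x) M) = image_mset (\<lambda>x. x div 2) (image_mset (\<lambda>x. 2 * x) M')"
    "image_mset (\<lambda>x. x div 2) (image_mset (\<lambda>x. 2 * x + 1) P) = image_mset (\<lambda>x. x div 2) (image_mset (\<lambda>x. 2 * x + 1) P')"
    by simp_all
  then show "M = M'" "P = P'" by (simp_all add: multiset.map_comp comp_def)
qed

text \<open>Factorisations of a monomial as colourings of its word.  A colouring is recovered from the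
  two factors by sorting the coloured letters, with the uncoloured copy of a letter first.\<close>

lemma bij_betw_colourings:
  defines "N \<equiv> \<lambda>m. length (word m)"
  shows "bij_betw (\<lambda>A. (word_monomial (subword (word m) ({1..N m} - A)), word_monomial (subword (word m) A)))
    {A. A \<subseteq> {1..N m} \<and> card A = n \<and> edge (N m) A \<subseteq> ascents (word m)}
    {(a, b). a + b = m \<and> length (word b) = n}"
proof -
  define w where "w = word m"
  have w: "sorted w" by (simp add: w_def sorted_word)
  let ?A = "{A. A \<subseteq> {1..length w} \<and> card A = n \<and> edge (length w) A \<subseteq> ascents w}"
  let ?f = "\<lambda>A. (word_monomial (subword w ({1..length w} - A)), word_monomial (subword w A))"
  have sub: "sorted (subword w X)" if "X \<subseteq> {1..length w}" for X
    by (rule sorted_subword[OF w that])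
  have "bij_betw ?f ?A {(a, b). a + b = m \<and> length (word b) = n}"
    unfolding bij_betw_def
  proof
    show "inj_on ?f ?A"
    proof (rule inj_onI)
      fix A A' assume A: "A \<in> ?A" and A': "A' \<in> ?A" and eq: "?f A = ?f A'"
      have sA: "A \<subseteq> {1..length w}" "A' \<subseteq> {1..length w}" using A A' by auto
      have "mset (coloured w A) = mset (coloured w A')"
        using eq unfolding mset_coloured[OF sA(1)] mset_coloured[OF sA(2)] by (simp add: word_monomial_eq_iff)
      moreover have "sorted (coloured w A)" "sorted (coloured w A')"
        using A A' by (simp_all add: sorted_coloured[OF w])
      ultimately have ceq: "coloured w A = coloured w A'" by (metis properties_for_sort)
      have mem: "i \<in> A \<longleftrightarrow> i \<in> A'" if i: "i \<in> {1..length w}" for i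
      proof -
        obtain j where j: "i = Suc j" "j < length w" using i by (cases i) auto
        have "odd (coloured w A ! j) \<longleftrightarrow> i \<in> A" "odd (coloured w A' ! j) \<longleftrightarrow> i \<in> A'"
          unfolding coloured_nth[OF j(2)] using j(1) by (auto simp: of_bool_def)
        then show ?thesis unfolding ceq by simp
      qed
      show "A = A'" using sA mem by blast
    qed
    show "?f ` ?A = {(a, b). a + b = m \<and> length (word b) = n}"
    proof (rule equalityI; rule subsetI)
      fix p assume "p \<in> ?f ` ?A"
      then obtain A where A: "A \<subseteq> {1..length w}" "card A = n" "p = ?f A" by auto
      have "word_monomial (subword w ({1..length w} - A)) + word_monomial (subword w A) = word_monomial w"
        unfolding word_monomial_append[symmetric] word_monomial_eq_iff using mset_subwords[OF A(1)] by simp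
      moreover have "length (word (word_monomial (subword w A))) = n"
        by (simp add: word_word_monomial[OF sub[OF A(1)]] length_subword A(2))
      ultimately show "p \<in> {(a, b). a + b = m \<and> length (word b) = n}"
        by (simp add: A(3) w_def word_monomial_word)
    next
      fix p assume "p \<in> {(a, b). a + b = m \<and> length (word b) = n}"
      then obtain a b where p: "p = (a, b)" and ab: "a + b = m" "length (word b) = n" by auto
      \<comment> \<open>The colouring for a given factorisation: merge the letters of both factors, tagged by colour.\<close>
      define zs where "zs = sort (map (\<lambda>x. 2 * x) (word a) @ map (\<lambda>x. 2 * x + 1) (word b))"
      have zs_mset: "mset zs = image_mset (\<lambda>x. 2 * x) (mset (word a)) + image_mset (\<lambda>x. 2 * x + 1) (mset (word b))"
        by (simp add: zs_def)
      have ab_w: "mset (word a) + mset (word b) = mset w"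
        by (rule multiset_eqI) (simp add: w_def count_word ab(1)[symmetric] lookup_add)
      have "mset (map (\<lambda>z. z div 2) zs) = mset w"
        unfolding mset_map zs_mset ab_w[symmetric] by (simp add: multiset.map_comp comp_def)
      moreover have "sorted (map (\<lambda>z. z div 2) zs)"
        unfolding sorted_map by (rule sorted_wrt_mono_rel[of _ "(\<le>)"]) (auto simp: zs_def div_le_mono)
      ultimately have zs_w: "map (\<lambda>z. z div 2) zs = w" using w by (metis properties_for_sort)
      then have len: "length zs = length w" by (metis length_map)
      define A where "A = {i \<in> {1..length w}. odd (zs ! (i - 1))}"
      have A: "A \<subseteq> {1..length w}" by (auto simp: A_def)
      have col: "coloured w A = zs"
      proof (rule nth_equalityI)
        show "length (coloured w A) = length zs" by (simp add: length_coloured len)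
        fix i assume "i < length (coloured w A)"
        then have i: "i < length w" by (simp add: length_coloured)
        have "w ! i = zs ! i div 2" using i len by (subst zs_w[symmetric]) simp
        then show "coloured w A ! i = zs ! i"
          unfolding coloured_nth[OF i] using i by (simp add: A_def)
      qed
      have "sorted (coloured w A)" unfolding col by (simp add: zs_def)
      then have edge: "edge (length w) A \<subseteq> ascents w" by (simp add: sorted_coloured[OF w])
      have "mset (subword w ({1..length w} - A)) = mset (word a)" "mset (subword w A) = mset (word b)"
        using even_odd_mset_eq zs_mset mset_coloured[OF A] unfolding col by metis+
      note mm = this
      have "card A = n" using mm(2) ab(2) length_subword[of w A] by (metis size_mset)
      moreover have "?f A = p"
        using mm word_monomial_eq_iff word_monomial_word unfolding p by metis
      ultimately show "p \<in> ?f ` ?A" using A edge by blast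
    qed
  qed
  then show ?thesis unfolding N_def w_def .
qed

text \<open>The descents of a shuffle of two words with descent sets \<open>I\<close> and \<open>J\<close>, where the letters of the
  second word are larger and stand in the positions \<open>A\<close>.  At an edge of \<open>A\<close> a letter of the second word
  is followed by one of the first, a descent; at an edge of the complement it is the other way round.\<close>

definition shuffle_descents :: "nat \<Rightarrow> nat set \<Rightarrow> nat set \<Rightarrow> nat set \<Rightarrow> nat set" where
  "shuffle_descents N A I J = edge N A \<union>
     (nth_elem ({1..N} - A) ` I \<union> nth_elem A ` J - edges N A)"

lemma nth_elem_consecutive:
  assumes "finite X" "0 < k" "k < card X"
  shows "nth_elem X k \<in> X" "nth_elem X (Suc k) \<in> X" "nth_elem X k < nth_elem X (Suc k)"
    and "\<And>z. nth_elem X k < z \<Longrightarrow> z < nth_elem X (Suc k) \<Longrightarrow> z \<notin> X"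
proof -
  define s where "s = sorted_list_of_set X"
  have s: "sorted_wrt (<) s" "set s = X" "length s = card X"
    using assms(1) by (simp_all add: s_def)
  have n: "nth_elem X k = s ! (k - 1)" "nth_elem X (Suc k) = s ! k"
    by (simp_all add: nth_elem_def s_def)
  show "nth_elem X k \<in> X" "nth_elem X (Suc k) \<in> X"
    unfolding n using assms s by (metis diff_less less_imp_diff_less less_one nth_mem)+
  show "nth_elem X k < nth_elem X (Suc k)"
    unfolding n using sorted_wrt_nth_less[OF s(1)] assms s(3) by simp
  fix z assume z: "nth_elem X k < z" "z < nth_elem X (Suc k)"
  show "z \<notin> X"
  proof
    assume "z \<in> X"
    then obtain j where j: "j < length s" "z = s ! j" using s(2) by (auto simp: in_set_conv_nth)
    have mono: "s ! i \<le> s ! i'" if "i \<le> i'" "i' < length s" for i i'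
      using sorted_wrt_nth_less[OF s(1), of i i'] that by (cases "i = i'") auto
    have "k - 1 < length s" using assms s(3) by simp
    then have "\<not> j \<le> k - 1" "\<not> k \<le> j"
      using mono[of j "k - 1"] mono[of k j] z j unfolding n by auto
    then show False by simp
  qed
qed

lemma subword_nth: "j < card X \<Longrightarrow> subword w X ! j = w ! (nth_elem X (Suc j) - 1)"
  by (simp add: subword_def nth_elem_def)

text \<open>Two letters that follow each other in the subword on \<open>X\<close>, but not in \<open>w\<close>, are separated in
  \<open>w\<close> by an edge of \<open>X\<close> and by an edge of its complement; if all edges of one of the two are
  ascents, then the subword ascends there.\<close>

lemma ascents_subword:
  assumes w: "sorted w" and X: "X \<subseteq> {1..length w}" and k: "0 < k" "k < card X"
    and edges: "edge (length w) X \<subseteq> ascents w \<or> edge (length w) ({1..length w} - X) \<subseteq> ascents w"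
  shows "k \<in> ascents (subword w X) \<longleftrightarrow> nth_elem X k \<in> ascents w \<union> edge (length w) X"
proof -
  define x y where "x = nth_elem X k" and "y = nth_elem X (Suc k)"
  have fX: "finite X" using X by (rule finite_subset) simp
  have x: "x \<in> X" and y: "y \<in> X" and xy: "x < y" and gap: "\<And>z. x < z \<Longrightarrow> z < y \<Longrightarrow> z \<notin> X"
    unfolding x_def y_def using nth_elem_consecutive[OF fX k] by blast+
  have bounds: "1 \<le> x" "x < length w" "y \<le> length w" using x y X xy by auto
  have mono: "w ! (i - 1) \<le> w ! (j - 1)" if "i \<le> j" "1 \<le> j" "j \<le> length w" for i j
    using w that by (intro sorted_nth_mono) auto
  have k_asc: "k \<in> ascents (subword w X) \<longleftrightarrow> w ! (x - 1) < w ! (y - 1)"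
    using k subword_nth[of "k - 1" X w] subword_nth[of k X w]
    by (simp add: ascents_def length_subword x_def y_def)
  show ?thesis
  proof (cases "Suc x \<in> X")
    case True
    then have "y = Suc x" using gap[of "Suc x"] xy by (cases "Suc x = y") auto
    moreover have "x \<notin> edge (length w) X" using True by (simp add: edge_def)
    ultimately show ?thesis unfolding k_asc x_def[symmetric] using bounds by (simp add: ascents_def)
  next
    case False
    then have xe: "x \<in> edge (length w) X" using x bounds by (simp add: edge_def)
    have y1: "Suc x < y" using False xy y by (metis Suc_lessI)
    have "w ! (x - 1) < w ! (y - 1)"
      using edges
    proof
      assume "edge (length w) X \<subseteq> ascents w"
      then have "w ! (x - 1) < w ! x" using xe by (auto simp: ascents_def)
      also have "w ! x \<le> w ! (y - 1)" using mono[of "Suc x" y] xy bounds by simp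
      finally show ?thesis .
    next
      assume e: "edge (length w) ({1..length w} - X) \<subseteq> ascents w"
      have "y - 1 \<notin> X" using gap[of "y - 1"] y1 by simp
      then have "y - 1 \<in> edge (length w) ({1..length w} - X)"
        using y y1 bounds by (simp add: edge_def) linarith
      then have "w ! (y - 1 - 1) < w ! (y - 1)" using e by (auto simp: ascents_def)
      moreover have "w ! (x - 1) \<le> w ! (y - 1 - 1)" using mono[of x "y - 1"] y1 bounds by simp
      ultimately show ?thesis by simp
    qed
    then show ?thesis using xe by (simp add: k_asc x_def[symmetric])
  qed
qed

lemma edges_Int:
  "A \<subseteq> {1..N} \<Longrightarrow> x \<in> A \<Longrightarrow> x \<in> edges N A \<longleftrightarrow> x \<in> edge N A"
  "x \<in> {1..N} - A \<Longrightarrow> x \<in> edges N A \<longleftrightarrow> x \<in> edge N ({1..N} - A)"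
  by (auto simp: edges_def edge_def)

text \<open>Once the edges of \<open>A\<close> are ascents, a subword ascends at a letter exactly if \<open>w\<close> ascends there
  or the letter stands at an edge (\<open>ascents_subword\<close>).\<close>

lemma shuffle_descents_ascents:
  assumes w: "sorted w" and A: "A \<subseteq> {1..length w}"
    and I: "I \<subseteq> {1..<length w - card A}" and J: "J \<subseteq> {1..<card A}"
  shows "shuffle_descents (length w) A I J \<subseteq> ascents w \<longleftrightarrow> edge (length w) A \<subseteq> ascents w \<and>
    I \<subseteq> ascents (subword w ({1..length w} - A)) \<and> J \<subseteq> ascents (subword w A)"
proof (cases "edge (length w) A \<subseteq> ascents w")
  case True
  let ?N = "length w" and ?B = "{1..length w} - A"
  have fA: "finite A" using A by (rule finite_subset) simp
  have cB: "card ?B = ?N - card A" using A by (simp add: card_Diff_subset fA)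
  have BB: "{1..?N} - ?B = A" using A by auto
  have 1: "nth_elem ?B i \<in> ascents w \<union> edges ?N A \<longleftrightarrow> i \<in> ascents (subword w ?B)" if "i \<in> I" for i
  proof -
    have i: "0 < i" "i < card ?B" using that I cB by auto
    have "nth_elem ?B i \<in> ?B" by (rule nth_elem_consecutive(1)[OF _ i]) simp
    then show ?thesis
      using ascents_subword[OF w _ i] True edges_Int(2)[of "nth_elem ?B i" ?N A] unfolding BB by auto
  qed
  have 2: "nth_elem A j \<in> ascents w \<union> edges ?N A \<longleftrightarrow> j \<in> ascents (subword w A)" if "j \<in> J" for j
  proof -
    have j: "0 < j" "j < card A" using that J by auto
    have "nth_elem A j \<in> A" by (rule nth_elem_consecutive(1)[OF fA j])
    then show ?thesis
      using ascents_subword[OF w A j] True edges_Int(1)[OF A, of "nth_elem A j"] by auto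
  qed
  have "shuffle_descents ?N A I J \<subseteq> ascents w \<longleftrightarrow>
      (\<forall>i\<in>I. nth_elem ?B i \<in> ascents w \<union> edges ?N A) \<and> (\<forall>j\<in>J. nth_elem A j \<in> ascents w \<union> edges ?N A)"
    using True unfolding shuffle_descents_def by blast
  also have "\<dots> \<longleftrightarrow> I \<subseteq> ascents (subword w ?B) \<and> J \<subseteq> ascents (subword w A)"
    using 1 2 by blast
  finally show ?thesis using True by simp
qed (auto simp: shuffle_descents_def)

lemma length_word_add: "length (word (a + b)) = length (word a) + length (word b)"
  by (simp add: length_word total_degree_add)

text \<open>The coefficient of a monomial on the left counts its factorisations into words that ascend at
  \<open>I\<close> and at \<open>J\<close>.  Factorisations are colourings all of whose edges are ascents, so this is the number
  of sets \<open>A\<close> for which the word ascends at all descents of the shuffle.\<close>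

theorem qsym_L_mult:
  assumes I: "I \<subseteq> {1..<k}" and J: "J \<subseteq> {1..<n}"
  shows "qsym_mult (qsym_L k I) (qsym_L n J)
    = (\<Sum>A\<in>{A. A \<subseteq> {1..k + n} \<and> card A = n}. qsym_L (k + n) (shuffle_descents (k + n) A I J))"
proof
  fix m
  define w where "w = word m"
  have w: "sorted w" by (simp add: w_def sorted_word)
  let ?P = "{A. A \<subseteq> {1..k + n} \<and> card A = n}"
  let ?t = "\<lambda>p. qsym_L k I (fst p) * qsym_L n J (snd p)"
  have finP: "finite ?P" by (rule finite_subset[of _ "Pow {1..k + n}"]) auto
  have lhs: "qsym_mult (qsym_L k I) (qsym_L n J) m = (\<Sum>p\<in>{(a, b). a + b = m}. ?t p)"
    by (simp add: qsym_mult_def case_prod_unfold)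
  show "qsym_mult (qsym_L k I) (qsym_L n J) m
      = (\<Sum>A\<in>?P. qsym_L (k + n) (shuffle_descents (k + n) A I J)) m"
  proof (cases "length w = k + n")
    case False
    have "(\<Sum>p\<in>{(a, b). a + b = m}. ?t p) = 0"
      by (rule sum.neutral) (use False length_word_add in \<open>auto simp: qsym_L_word w_def\<close>)
    moreover have "(\<Sum>A\<in>?P. qsym_L (k + n) (shuffle_descents (k + n) A I J)) m = 0"
      unfolding sum_fun_apply by (rule sum.neutral) (use False in \<open>simp add: qsym_L_word w_def\<close>)
    ultimately show ?thesis unfolding lhs by simp
  next
    case True
    let ?E = "{A. A \<subseteq> {1..length w} \<and> card A = n \<and> edge (length w) A \<subseteq> ascents w}"
    have "(\<Sum>p\<in>{(a, b). a + b = m}. ?t p) = (\<Sum>p\<in>{(a, b). a + b = m \<and> length (word b) = n}. ?t p)"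
      by (rule sum.mono_neutral_right) (auto simp: finite_factorizations qsym_L_word)
    also have "\<dots> = (\<Sum>A\<in>?E. ?t (word_monomial (subword w ({1..length w} - A)), word_monomial (subword w A)))"
      unfolding w_def by (rule sum.reindex_bij_betw[OF bij_betw_colourings, symmetric])
    also have "\<dots> = (\<Sum>A\<in>?E. of_bool (shuffle_descents (k + n) A I J \<subseteq> ascents w))"
    proof (rule sum.cong[OF refl])
      fix A assume "A \<in> ?E"
      then have A: "A \<subseteq> {1..length w}" "card A = n" "edge (length w) A \<subseteq> ascents w" by auto
      have fA: "finite A" using A(1) by (rule finite_subset) simp
      have cB: "card ({1..length w} - A) = k"
        using A True by (simp add: card_Diff_subset fA)
      have "shuffle_descents (length w) A I J \<subseteq> ascents w \<longleftrightarrow>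
          I \<subseteq> ascents (subword w ({1..length w} - A)) \<and> J \<subseteq> ascents (subword w A)"
        using shuffle_descents_ascents[OF w A(1)] I J A True by simp
      moreover have "word (word_monomial (subword w A)) = subword w A"
        "word (word_monomial (subword w ({1..length w} - A))) = subword w ({1..length w} - A)"
        by (intro word_word_monomial sorted_subword[OF w] A(1) Diff_subset)+
      ultimately show "?t (word_monomial (subword w ({1..length w} - A)), word_monomial (subword w A))
          = of_bool (shuffle_descents (k + n) A I J \<subseteq> ascents w)"
        using cB A(2) unfolding True[symmetric] by (simp add: qsym_L_word length_subword)
    qed
    also have "\<dots> = (\<Sum>A\<in>?P. of_bool (shuffle_descents (k + n) A I J \<subseteq> ascents w))"
      using finP by (intro sum.mono_neutral_left) (auto simp: True shuffle_descents_def)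
    also have "\<dots> = (\<Sum>A\<in>?P. qsym_L (k + n) (shuffle_descents (k + n) A I J)) m"
      unfolding sum_fun_apply using True by (simp add: qsym_L_word w_def)
    finally show ?thesis unfolding lhs .
  qed
qed

section \<open>The basis of fundamental quasisymmetric functions and its coproduct\<close>

definition fundamental_basis :: "nat \<times> nat set \<Rightarrow> series" where
  "fundamental_basis = (\<lambda>(n, I). qsym_L n I)"

lemma indep_fundamental: "indep_family degree_sets fundamental_basis"
  unfolding indep_family_def
proof (intro allI impI ballI)
  fix S c p assume S: "finite S" "S \<subseteq> degree_sets"
    and zero: "(\<Sum>k\<in>S. fscale (c k) (fundamental_basis k)) = 0" and p: "p \<in> S"
  obtain n I where nI: "p = (n, I)" by (cases p)
  define c' where "c' I = (if (n, I) \<in> S then c (n, I) else 0)" for I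
  have "(\<Sum>I\<in>Pow J. c' I) = 0" if J: "J \<subseteq> {1..<n}" for J
  proof -
    note cf = comp_of_facts[OF J]
    define m where "m = monomial [0..<length (comp_of n J)] (comp_of n J)"
    have m: "expos m = comp_of n J" unfolding m_def by (rule expos_upt[OF cf(1)])
    have val: "fundamental_basis k m = (if fst k = n \<and> snd k \<subseteq> J then 1 else 0)" for k
      by (cases k) (auto simp: fundamental_basis_def qsym_L_eq total_degree_expos m cf)
    have "0 = (\<Sum>k\<in>S. fscale (c k) (fundamental_basis k)) m" unfolding zero by simp
    also have "\<dots> = (\<Sum>k\<in>S. if fst k = n \<and> snd k \<subseteq> J then c k else 0)"
      unfolding sum_fun_apply fscale_def by (intro sum.cong) (auto simp: val)
    also have "\<dots> = (\<Sum>k\<in>{k \<in> S. fst k = n \<and> snd k \<subseteq> J}. c k)"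
      using S(1) by (simp add: sum.inter_filter)
    also have "\<dots> = (\<Sum>I\<in>{I. (n, I) \<in> S \<and> I \<subseteq> J}. c (n, I))"
      by (rule sum.reindex_bij_witness[of _ "\<lambda>I. (n, I)" snd]) auto
    also have "\<dots> = (\<Sum>I\<in>Pow J. c' I)"
      using finite_subset[OF J] by (intro sum.mono_neutral_cong_left) (auto simp: c'_def)
    finally show ?thesis by simp
  qed
  moreover have "I \<subseteq> {1..<n}" using p S nI by (auto simp: degree_sets_def)
  ultimately have "c' I = 0" using subset_sums_zero[of "{1..<n}"] by blast
  then show "c p = 0" using p nI by (simp add: c'_def)
qed

text \<open>The relation between the two families is unitriangular with respect to inclusion; the
  induction is on the number of elements missing from \<open>J\<close>.\<close>

lemma qsym_M_in_span_fundamental: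
  "J \<subseteq> {1..<n} \<Longrightarrow> qsym_M (comp_of n J) \<in> fs.span (fundamental_basis ` degree_sets)"
proof (induction "card ({1..<n} - J)" arbitrary: J rule: less_induct)
  case less
  let ?U = "{K. J \<subseteq> K \<and> K \<subseteq> {1..<n}}"
  have fin: "finite ?U" by (rule finite_subset[of _ "Pow {1..<n}"]) auto
  have "qsym_L n J = qsym_M (comp_of n J) + (\<Sum>K\<in>?U - {J}. qsym_M (comp_of n K))"
    unfolding qsym_L_def using less.prems fin by (intro sum.remove) auto
  then have eq: "qsym_M (comp_of n J) = qsym_L n J - (\<Sum>K\<in>?U - {J}. qsym_M (comp_of n K))"
    by (simp only: add_diff_cancel_right')
  have "qsym_L n J = fundamental_basis (n, J)" by (simp add: fundamental_basis_def)
  then have "qsym_L n J \<in> fs.span (fundamental_basis ` degree_sets)"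
    using less.prems by (auto simp: degree_sets_def intro!: fs.span_base)
  moreover have "(\<Sum>K\<in>?U - {J}. qsym_M (comp_of n K)) \<in> fs.span (fundamental_basis ` degree_sets)"
  proof (rule fs.span_sum)
    fix K assume K: "K \<in> ?U - {J}"
    then have "card ({1..<n} - K) < card ({1..<n} - J)"
      using less.prems by (intro psubset_card_mono) auto
    then show "qsym_M (comp_of n K) \<in> fs.span (fundamental_basis ` degree_sets)"
      using less.hyps K by blast
  qed
  ultimately show ?case unfolding eq by (rule fs.span_diff)
qed

lemma span_fundamental: "fs.span (fundamental_basis ` degree_sets) = QSym"
proof (rule equalityI)
  show "fs.span (fundamental_basis ` degree_sets) \<subseteq> QSym"
    by (rule fs.span_minimal[OF _ subspace_QSym]) (auto simp: fundamental_basis_def qsym_L_in_QSym)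
  have "qsym_M \<alpha> \<in> fs.span (fundamental_basis ` degree_sets)" if \<alpha>: "\<alpha> \<in> compositions" for \<alpha>
  proof -
    have "breaks 0 \<alpha> \<subseteq> {1..<sum_list \<alpha>}" using breaks_bounds[OF \<alpha>, of 0] by auto
    then show ?thesis using qsym_M_in_span_fundamental comp_of_breaks[OF \<alpha>] by metis
  qed
  then show "QSym \<subseteq> fs.span (fundamental_basis ` degree_sets)"
    unfolding span_qsym_M[symmetric] by (intro fs.span_minimal fs.subspace_span) auto
qed

text \<open>What is left of a set of positions for the second part when a word is cut after its \<open>k\<close>-th
  letter; the position \<open>k\<close> of the cut itself is dropped.\<close>

definition tail_set :: "nat \<Rightarrow> nat \<Rightarrow> nat set \<Rightarrow> nat set" where
  "tail_set k n I = {i \<in> {1..<n - k}. k + i \<in> I}"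

text \<open>The cut is always a partial sum of the concatenation, so membership of \<open>sum_list \<alpha>\<close> in \<open>I\<close>
  imposes no condition.  If one part is empty there is no cut inside.\<close>

lemma breaks_append_subset:
  assumes \<alpha>: "\<alpha> \<in> compositions" and \<beta>: "\<beta> \<in> compositions" and n: "sum_list \<alpha> + sum_list \<beta> = n"
    and I: "I \<subseteq> {1..<n}"
  shows "I \<subseteq> breaks 0 (\<alpha> @ \<beta>) \<longleftrightarrow>
    I \<inter> {1..<sum_list \<alpha>} \<subseteq> breaks 0 \<alpha> \<and> tail_set (sum_list \<alpha>) n I \<subseteq> breaks 0 \<beta>"
proof (cases "\<alpha> = [] \<or> \<beta> = []")
  case True
  then show ?thesis
  proof
    assume "\<alpha> = []"
    moreover have "tail_set 0 n I = I" using I by (auto simp: tail_set_def)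
    ultimately show ?thesis by simp
  next
    assume "\<beta> = []"
    moreover from this have "tail_set (sum_list \<alpha>) n I = {}" "I \<inter> {1..<sum_list \<alpha>} = I"
      using I n by (auto simp: tail_set_def)
    ultimately show ?thesis by simp
  qed
next
  case False
  let ?k = "sum_list \<alpha>"
  have b: "breaks 0 (\<alpha> @ \<beta>) = breaks 0 \<alpha> \<union> insert ?k ((+) ?k ` breaks 0 \<beta>)"
    using False breaks_append[of \<alpha> \<beta> 0] breaks_shift[of ?k 0 \<beta>] by simp
  have B1: "breaks 0 \<alpha> \<subseteq> {0<..<?k}" using breaks_bounds[OF \<alpha>, of 0] by simp
  have B2: "breaks 0 \<beta> \<subseteq> {0<..<sum_list \<beta>}" using breaks_bounds[OF \<beta>, of 0] by simp
  have low: "i \<in> breaks 0 (\<alpha> @ \<beta>) \<longleftrightarrow> i \<in> breaks 0 \<alpha>" if "i < ?k" for i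
    using that unfolding b by auto
  have high: "?k + i \<in> breaks 0 (\<alpha> @ \<beta>) \<longleftrightarrow> i \<in> breaks 0 \<beta>" if "0 < i" for i
    using that B1 unfolding b by auto
  show ?thesis
  proof
    assume L: "I \<subseteq> breaks 0 (\<alpha> @ \<beta>)"
    show "I \<inter> {1..<?k} \<subseteq> breaks 0 \<alpha> \<and> tail_set ?k n I \<subseteq> breaks 0 \<beta>"
      using L low high by (auto simp: tail_set_def)
  next
    assume R: "I \<inter> {1..<?k} \<subseteq> breaks 0 \<alpha> \<and> tail_set ?k n I \<subseteq> breaks 0 \<beta>"
    show "I \<subseteq> breaks 0 (\<alpha> @ \<beta>)"
    proof
      fix i assume i: "i \<in> I"
      then have ib: "1 \<le> i" "i < n" using I by auto
      consider "i < ?k" | "i = ?k" | j where "i = ?k + j" "0 < j"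
        using less_imp_add_positive[of ?k i] by (metis linorder_neqE_nat)
      then show "i \<in> breaks 0 (\<alpha> @ \<beta>)"
      proof cases
        case 1
        then show ?thesis using i ib R low by auto
      next
        case 2
        then show ?thesis unfolding b by simp
      next
        case 3
        then have "j \<in> tail_set ?k n I" using i ib by (auto simp: tail_set_def)
        then show ?thesis using 3 R high by auto
      qed
    qed
  qed
qed

lemma qsym_L_comult:
  assumes I: "I \<subseteq> {1..<n}"
  shows "qsym_comult (qsym_L n I)
    = (\<Sum>k\<le>n. qsym_L k (I \<inter> {1..<k}) \<otimes>\<^sub>t qsym_L (n - k) (tail_set k n I))"
proof (rule ext, clarify)
  fix a b
  let ?k = "sum_list (expos a)"
  have "(\<Sum>k\<le>n. qsym_L k (I \<inter> {1..<k}) \<otimes>\<^sub>t qsym_L (n - k) (tail_set k n I)) (a, b)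
      = (\<Sum>k\<le>n. if k = ?k then of_bool (sum_list (expos b) = n - ?k \<and> I \<inter> {1..<?k} \<subseteq> breaks 0 (expos a)
          \<and> tail_set ?k n I \<subseteq> breaks 0 (expos b)) else 0)"
    unfolding sum_fun_apply by (rule sum.cong) (auto simp: pure_def qsym_L_eq total_degree_expos)
  also have "\<dots> = of_bool (?k + sum_list (expos b) = n \<and> I \<inter> {1..<?k} \<subseteq> breaks 0 (expos a)
          \<and> tail_set ?k n I \<subseteq> breaks 0 (expos b))"
    by (subst sum.delta) auto
  also have "\<dots> = of_bool (?k + sum_list (expos b) = n \<and> I \<subseteq> breaks 0 (expos a @ expos b))"
    using breaks_append_subset[OF expos_composition expos_composition _ I, of a b] by auto
  also have "\<dots> = qsym_L n I (cat a b)"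
    by (simp add: qsym_L_eq total_degree_expos expos_cat)
  finally show "qsym_comult (qsym_L n I) (a, b)
      = (\<Sum>k\<le>n. qsym_L k (I \<inter> {1..<k}) \<otimes>\<^sub>t qsym_L (n - k) (tail_set k n I)) (a, b)"
    by (simp add: qsym_comult_eq qsym_L_in_QSym)
qed

section \<open>The elements of a set of positions\<close>

lemma nth_elem_strict_mono:
  assumes "finite X" "1 \<le> i" "i < j" "j \<le> card X"
  shows "nth_elem X i < nth_elem X j"
  using sorted_wrt_nth_less[OF strict_sorted_list_of_set[of X], of "i - 1" "j - 1"] assms
  by (simp add: nth_elem_def)

lemma bij_betw_nth_elem:
  assumes "finite X"
  shows "bij_betw (nth_elem X) {1..card X} X"
proof -
  have "bij_betw ((!) (sorted_list_of_set X)) {..<card X} X"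
    using assms by (intro bij_betw_nth) auto
  moreover have "bij_betw (\<lambda>i. i - 1) {1..card X} {..<card X}"
    by (rule bij_betw_byWitness[where f' = Suc]) auto
  ultimately have "bij_betw ((!) (sorted_list_of_set X) \<circ> (\<lambda>i. i - 1)) {1..card X} X"
    by (rule bij_betw_trans[rotated])
  moreover have "nth_elem X = (!) (sorted_list_of_set X) \<circ> (\<lambda>i. i - 1)"
    by (rule ext) (simp add: nth_elem_def)
  ultimately show ?thesis by simp
qed

lemma nth_elem_image_butlast:
  assumes "finite X"
  shows "nth_elem X ` {1..<card X} = X - {nth_elem X (card X)}"
proof (cases "card X = 0")
  case False
  then have c: "{1..<card X} = {1..card X} - {card X}" "card X \<in> {1..card X}" by auto
  have b: "inj_on (nth_elem X) {1..card X}" "nth_elem X ` {1..card X} = X"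
    using bij_betw_nth_elem[OF assms] by (auto simp: bij_betw_def)
  show ?thesis unfolding c(1) using inj_on_image_set_diff[OF b(1), of "{1..card X}" "{card X}"] b(2) c(2) by auto
qed (use assms in auto)

lemma nth_elem_last:
  assumes "finite X" "x \<in> X"
  shows "x \<le> nth_elem X (card X)" "nth_elem X (card X) \<in> X"
proof -
  have "x \<in> nth_elem X ` {1..card X}"
    using bij_betw_nth_elem[OF assms(1)] assms(2) by (simp add: bij_betw_def)
  then obtain i where i: "1 \<le> i" "i \<le> card X" "x = nth_elem X i" by auto
  then show "x \<le> nth_elem X (card X)"
    using nth_elem_strict_mono[OF assms(1), of i "card X"] by (cases "i = card X") auto
  show "nth_elem X (card X) \<in> X" using bij_betw_nth_elem[OF assms(1)] i by (auto simp: bij_betw_def)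
qed

lemma nth_elem_atLeastAtMost: "1 \<le> i \<Longrightarrow> i \<le> n \<Longrightarrow> nth_elem {1..n} i = i"
proof -
  assume i: "1 \<le> i" "i \<le> n"
  have "sorted_list_of_set {1..n} = [1..<Suc n]"
    using sorted_list_of_set_range[of 1 "Suc n"] by (simp only: atLeastLessThanSuc_atLeastAtMost)
  then show ?thesis using i by (simp add: nth_elem_def del: upt_Suc)
qed

lemma nth_elem_atLeastAtMost_image:
  assumes "J \<subseteq> {1..<n}"
  shows "nth_elem {1..n} ` J = J"
proof -
  have "nth_elem {1..n} ` J = (\<lambda>i. i) ` J"
    by (rule image_cong[OF refl], rule nth_elem_atLeastAtMost) (use assms in auto)
  then show ?thesis by simp
qed

text \<open>After the largest element of \<open>X\<close> comes either the end or an element of the complement.\<close>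

lemma nth_elem_last_edge:
  assumes "X \<subseteq> {1..N}" "X \<noteq> {}"
  shows "nth_elem X (card X) = N \<or> nth_elem X (card X) \<in> edge N X"
proof -
  have X: "finite X" using assms(1) by (rule finite_subset) simp
  let ?x = "nth_elem X (card X)"
  have x: "?x \<in> X" using nth_elem_last(2)[OF X] assms(2) by blast
  moreover have "Suc ?x \<notin> X" using nth_elem_last(1)[OF X, of "Suc ?x"] by auto
  ultimately show ?thesis using assms(1) by (auto simp: edge_def)
qed

lemma shuffle_descents_subset:
  assumes A: "A \<subseteq> {1..N}" and I: "I \<subseteq> {1..<N - card A}" and J: "J \<subseteq> {1..<card A}"
  shows "shuffle_descents N A I J \<subseteq> {1..<N}"
proof -
  have fA: "finite A" using A by (rule finite_subset) simp
  have cB: "card ({1..N} - A) = N - card A" using A by (simp add: card_Diff_subset fA)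
  have sub: "nth_elem X i \<in> {1..<N}" if X: "X \<subseteq> {1..N}" and i: "i \<in> {1..<card X}" for X i
  proof -
    have "finite X" using X by (rule finite_subset) simp
    then show ?thesis using nth_elem_consecutive(1-3)[of X i] X i by force
  qed
  have "nth_elem ({1..N} - A) ` I \<subseteq> {1..<N}" "nth_elem A ` J \<subseteq> {1..<N}"
    using sub[of "{1..N} - A"] sub[OF A] I J unfolding cB by blast+
  moreover have "edge N A \<subseteq> {1..<N}" by (auto simp: edge_def)
  ultimately show ?thesis unfolding shuffle_descents_def by blast
qed

section \<open>The product and the coproduct on supercharacters\<close>

context finite_cyclic begin

lemmas superchar_dot_prod = superchar_dot_eq[OF is_group cyclic order_C \<nu>]

lemma rbar_one: "rbar C \<one> = 1"
  by (simp add: rbar_eq)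

lemma superchar_dot_0: "superchar_dot C 0 {} g = (if g \<in> carrier (Q_group C 0) then 1 else 0)"
  by (simp add: superchar_dot_prod)

lemma one_Q_group_carrier: "\<one>\<^bsub>Q_group C n\<^esub> \<in> carrier (Q_group C n)"
  by (simp add: carrier_Q_group[OF is_group]) (simp add: Q_group_def)

text \<open>Both sides are products of values \<open>rbar (g i)\<close>, so the sets of positions that occur have to
  be compared.  On the left, the edges of the complement of \<open>A\<close> come from the prefactor; the two
  supercharacters contribute the positions of their letters outside \<open>I\<close> and \<open>J\<close>, except at edges, where
  the argument has been replaced by the identity.  Together these are the positions that are not
  descents of the shuffle.\<close>

lemma m_op_superchar:
  assumes I: "I \<subseteq> {1..<m}" and J: "J \<subseteq> {1..<n}" and A: "A \<subseteq> {1..m + n}" and cA: "card A = n"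
  shows "m_op C m n A (superchar_dot C m I) (superchar_dot C n J) g
    = superchar_dot C (m + n) (shuffle_descents (m + n) A I J) g"
proof -
  have fA: "finite A" using A by (rule finite_subset) simp
  have K: "shuffle_descents (m + n) A I J \<subseteq> {1..<m + n}"
    using I J cA by (intro shuffle_descents_subset[OF A]) auto
  consider "g \<notin> carrier (Q_group C (m + n))" | "g \<in> carrier (Q_group C (m + n))" "m = 0"
    | "g \<in> carrier (Q_group C (m + n))" "m \<noteq> 0" "n = 0"
    | "g \<in> carrier (Q_group C (m + n))" "m \<noteq> 0" "n \<noteq> 0"
    by blast
  then show ?thesis
  proof cases
    case 1
    then show ?thesis by (simp add: m_op_def superchar_dot_prod[OF K])
  next
    case 2
    then have A': "A = {1..n}" using A cA by (intro card_subset_eq) auto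
    have "nth_elem {1..n} ` J = J" by (rule nth_elem_atLeastAtMost_image[OF J])
    moreover have "edge n {1..n} = {}" "edge n {} = {}" by (auto simp: edge_def)
    ultimately have "shuffle_descents (m + n) A I J = J"
      using I 2 by (simp add: shuffle_descents_def edges_def A')
    then show ?thesis
      using 2 I one_Q_group_carrier by (simp add: m_op_def superchar_dot_0)
  next
    case 3
    then have A': "A = {}" using cA fA by simp
    have "nth_elem {1..m} ` I = I" by (rule nth_elem_atLeastAtMost_image[OF I])
    moreover have "edge m {1..m} = {}" "edge m {} = {}" by (auto simp: edge_def)
    ultimately have "shuffle_descents (m + n) A I J = I"
      using J 3 by (simp add: shuffle_descents_def edges_def A')
    then show ?thesis
      using 3 J one_Q_group_carrier by (simp add: m_op_def superchar_dot_0)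
  next
    case 4
    define N B E where "N = m + n" and "B = {1..N} - A" and "E = edges N A"
    define a b where "a = nth_elem A" and "b = nth_elem B"
    have A: "A \<subseteq> {1..N}" and B: "B \<subseteq> {1..N}" "finite B" "card B = m"
      using A cA by (simp_all add: N_def B_def card_Diff_subset fA)
    have ne: "A \<noteq> {}" "B \<noteq> {}" using 4 cA B(3) by auto
    \<comment> \<open>The argument of \<open>s_op\<close> in the definition of \<open>m_op\<close>.\<close>
    define h where "h = (\<lambda>i\<in>{1..N}. if i \<in> {1..<N} - E then g i else \<one>)"
    have g: "g i \<in> carrier C" if "i \<in> {1..<N}" for i
      using 4 that by (auto simp: carrier_Q_group[OF is_group] N_def)
    have h: "h i \<in> carrier C" if "i \<in> {1..N}" for i using g that by (auto simp: h_def)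
    have rh: "rbar C (h i) = (if i \<in> {1..<N} - E then rbar C (g i) else 1)" if "i \<in> {1..N}" for i
      using that by (simp add: h_def rbar_one)
    have EA: "x \<in> E \<longleftrightarrow> x \<in> edge N A" if "x \<in> A" for x
      unfolding E_def by (rule edges_Int(1)[OF A that])
    have EB: "x \<in> E \<longleftrightarrow> x \<in> edge N B" if "x \<in> B" for x
      unfolding E_def B_def by (rule edges_Int(2)) (use that in \<open>simp add: B_def\<close>)
    \<comment> \<open>The last letter of either word stands at an edge or at the end, where \<open>h\<close> is the identity; the
      two factors \<open>rbar (h (b m))\<close> and \<open>rbar (h (a n))\<close> are therefore 1.\<close>
    have last: "nth_elem X (card X) \<in> {1..N} - ({1..<N} - E)"
      if X: "X \<subseteq> {1..N}" "X \<noteq> {}" "\<And>x. x \<in> X \<Longrightarrow> x \<in> E \<longleftrightarrow> x \<in> edge N X" for X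
    proof -
      have "nth_elem X (card X) \<in> X" using X finite_subset[OF X(1)] nth_elem_last(2) by blast
      then show ?thesis using nth_elem_last_edge[OF X(1,2)] X(1,3) by auto
    qed
    have last_a: "a n \<in> {1..N} - ({1..<N} - E)" using last[OF A ne(1) EA] by (simp add: a_def cA)
    have last_b: "b m \<in> {1..N} - ({1..<N} - E)" using last[OF B(1) ne(2) EB] by (simp add: b_def B(3))
    have im_a: "a ` {1..<n} = A - {a n}" using nth_elem_image_butlast[OF fA] by (simp add: a_def cA)
    have im_b: "b ` {1..<m} = B - {b m}" using nth_elem_image_butlast[OF B(2)] by (simp add: b_def B(3))
    have inj_a: "inj_on a {1..<n}"
      using bij_betw_nth_elem[OF fA] by (auto simp: bij_betw_def a_def cA intro: inj_on_subset)
    have inj_b: "inj_on b {1..<m}"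
      using bij_betw_nth_elem[OF B(2)] by (auto simp: bij_betw_def b_def B(3) intro: inj_on_subset)
    \<comment> \<open>The positions that one of the two supercharacters contributes.\<close>
    have part: "superchar_dot C k L (\<lambda>i\<in>{1..<k}. h (c i)) = (\<Prod>x\<in>c ` ({1..<k} - L) - E. rbar C (g x))"
      if L: "L \<subseteq> {1..<k}" and c: "c ` {1..<k} \<subseteq> {1..<N}" and inj: "inj_on c {1..<k}" for k L c
    proof -
      have cN: "c i \<in> {1..<N}" if "i \<in> {1..<k}" for i using c that by blast
      have "(\<lambda>i\<in>{1..<k}. h (c i)) \<in> carrier (Q_group C k)"
        unfolding carrier_Q_group[OF is_group] restrict_PiE_iff
      proof
        fix i assume "i \<in> {1..<k}"
        then show "h (c i) \<in> carrier C" using cN[of i] by (intro h) simp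
      qed
      then have "superchar_dot C k L (\<lambda>i\<in>{1..<k}. h (c i)) = (\<Prod>i\<in>{1..<k} - L. rbar C (h (c i)))"
        by (simp add: superchar_dot_prod[OF L])
      also have "\<dots> = (\<Prod>x\<in>c ` ({1..<k} - L). rbar C (h x))"
        using inj by (subst prod.reindex) (auto intro: inj_on_subset)
      also have "\<dots> = (\<Prod>x\<in>c ` ({1..<k} - L) - E. rbar C (g x))"
      proof (rule prod.mono_neutral_cong_right)
        have r: "rbar C (h x) = (if x \<in> E then 1 else rbar C (g x))" if "x \<in> c ` ({1..<k} - L)" for x
        proof -
          have "x \<in> {1..<N}" using that cN by blast
          then show ?thesis using rh[of x] by simp
        qed
        then show "\<forall>x\<in>c ` ({1..<k} - L) - (c ` ({1..<k} - L) - E). rbar C (h x) = 1" by simp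
        show "rbar C (h x) = rbar C (g x)" if "x \<in> c ` ({1..<k} - L) - E" for x using r[of x] that by simp
      qed auto
      finally show ?thesis .
    qed
    have below: "nth_elem X ` {1..<card X} \<subseteq> {1..<N}" if X: "X \<subseteq> {1..N}" for X
    proof
      fix x assume "x \<in> nth_elem X ` {1..<card X}"
      then obtain i where i: "x = nth_elem X i" "1 \<le> i" "i < card X" by auto
      have "finite X" using X by (rule finite_subset) simp
      from nth_elem_consecutive(1-3)[OF this, of i] show "x \<in> {1..<N}" using i X by force
    qed
    have b_N: "b ` {1..<m} \<subseteq> {1..<N}" using below[OF B(1)] by (simp add: b_def B(3))
    have a_N: "a ` {1..<n} \<subseteq> {1..<N}" using below[OF A] by (simp add: a_def cA)
    have "m_op C m n A (superchar_dot C m I) (superchar_dot C n J) g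
        = (\<Prod>x\<in>edge N B. rbar C (g x)) * (\<Prod>x\<in>b ` ({1..<m} - I) - E. rbar C (g x))
          * (\<Prod>x\<in>a ` ({1..<n} - J) - E. rbar C (g x))"
    proof -
      have "rbar C (h (b m)) = 1" "rbar C (h (a n)) = 1"
        using rh[of "b m"] rh[of "a n"] last_a last_b by auto
      then have "s_op C m n A (superchar_dot C m I) (superchar_dot C n J) h
          = (\<Prod>x\<in>b ` ({1..<m} - I) - E. rbar C (g x)) * (\<Prod>x\<in>a ` ({1..<n} - J) - E. rbar C (g x))"
        unfolding s_op_def Let_def N_def[symmetric] B_def[symmetric] a_def[symmetric] b_def[symmetric]
        by (simp only: part[OF I b_N inj_b] part[OF J a_N inj_a] mult_1_right)
      then show ?thesis
        using 4 unfolding m_op_def N_def[symmetric] B_def[symmetric] E_def[symmetric] h_def[symmetric]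
        by simp
    qed
    also have "\<dots> = (\<Prod>x\<in>edge N B \<union> (b ` ({1..<m} - I) - E) \<union> (a ` ({1..<n} - J) - E). rbar C (g x))"
    proof -
      have d: "b ` ({1..<m} - I) \<subseteq> B" "a ` ({1..<n} - J) \<subseteq> A" "A \<inter> B = {}" "edge N B \<subseteq> B" "edge N B \<subseteq> E"
        using im_a im_b by (auto simp: B_def edge_def E_def edges_def)
      have f: "finite (edge N B)" by (simp add: edge_def)
      show ?thesis
        using d f by (subst prod.union_disjoint; (subst prod.union_disjoint)?) auto
    qed
    also have "edge N B \<union> (b ` ({1..<m} - I) - E) \<union> (a ` ({1..<n} - J) - E)
        = {1..<N} - shuffle_descents N A I J"
    proof (rule equalityI; rule subsetI)
      fix x assume x: "x \<in> edge N B \<union> (b ` ({1..<m} - I) - E) \<union> (a ` ({1..<n} - J) - E)"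
      have bI: "b ` I \<subseteq> B" "a ` J \<subseteq> A" using I J im_a im_b by blast+
      have sd: "shuffle_descents N A I J = edge N A \<union> (b ` I \<union> a ` J - E)"
        by (simp add: shuffle_descents_def B_def a_def b_def E_def)
      have AB: "A \<inter> B = {}" "edge N A \<subseteq> A" "edge N B \<subseteq> B" "edge N B \<subseteq> E" "edge N B \<subseteq> {1..<N}"
        by (auto simp: B_def edge_def E_def edges_def)
      from x consider "x \<in> edge N B" | "x \<in> b ` ({1..<m} - I) - E" | "x \<in> a ` ({1..<n} - J) - E" by blast
      then show "x \<in> {1..<N} - shuffle_descents N A I J"
      proof cases
        case 1
        then show ?thesis unfolding sd using AB by blast
      next
        case 2
        then have "x \<in> {1..<N}" "x \<in> B" using b_N im_b by blast+
        moreover have "x \<notin> b ` I" using 2 I inj_b by (auto dest: inj_onD)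
        ultimately show ?thesis unfolding sd using AB bI by blast
      next
        case 3
        then have "x \<in> {1..<N}" "x \<in> A" "x \<notin> edge N A" using a_N im_a EA by blast+
        moreover have "x \<notin> a ` J" using 3 J inj_a by (auto dest: inj_onD)
        ultimately show ?thesis unfolding sd using AB bI by blast
      qed
    next
      fix x assume x: "x \<in> {1..<N} - shuffle_descents N A I J"
      have sd: "shuffle_descents N A I J = edge N A \<union> (b ` I \<union> a ` J - E)"
        by (simp add: shuffle_descents_def B_def a_def b_def E_def)
      have x1: "x \<notin> edge N A" "x \<in> E \<or> x \<notin> b ` I" "x \<in> E \<or> x \<notin> a ` J" "x \<in> {1..<N}"
        using x unfolding sd by blast+
      show "x \<in> edge N B \<union> (b ` ({1..<m} - I) - E) \<union> (a ` ({1..<n} - J) - E)"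
      proof (cases "x \<in> A")
        case True
        then have xE: "x \<notin> E" using EA x1 by blast
        then have "x \<noteq> a n" using last_a x1 by blast
        then have "x \<in> a ` {1..<n}" using True im_a by blast
        then show ?thesis using x1 xE by blast
      next
        case False
        then have xB: "x \<in> B" using x1 by (simp add: B_def)
        show ?thesis
        proof (cases "x \<in> E")
          case True
          then show ?thesis using EB xB by blast
        next
          case xE: False
          then have "x \<noteq> b m" using last_b x1 by blast
          then have "x \<in> b ` {1..<m}" using xB im_b by blast
          then show ?thesis using x1 xE by blast
        qed
      qed
    qed
    also have "(\<Prod>x\<in>{1..<N} - shuffle_descents N A I J. rbar C (g x))
        = superchar_dot C N (shuffle_descents N A I J) g"
      using 4 K by (simp add: superchar_dot_prod N_def)
    finally show ?thesis unfolding N_def .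
  qed
qed

end

lemma m_op_linear:
  "m_op C m n A (\<phi> + \<phi>') \<psi> g = m_op C m n A \<phi> \<psi> g + m_op C m n A \<phi>' \<psi> g"
  "m_op C m n A \<phi> (\<psi> + \<psi>') g = m_op C m n A \<phi> \<psi> g + m_op C m n A \<phi> \<psi>' g"
  "m_op C m n A (fscale r \<phi>) \<psi> g = r * m_op C m n A \<phi> \<psi> g"
  "m_op C m n A \<phi> (fscale r \<psi>) g = r * m_op C m n A \<phi> \<psi> g"
  by (simp_all add: m_op_def s_op_def Let_def fscale_def algebra_simps)

lemma component_linear:
  "component (F + G) n = component F n + component G n"
  "component (fscale r F) n = fscale r (component F n)"
  by (auto simp: component_def fscale_def)

lemma scf_mult_bilinear: "bilinear_on V W (scf_mult C)"
proof -
  have "scf_mult C (F + F') G = scf_mult C F G + scf_mult C F' G"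
    "scf_mult C G (F + F') = scf_mult C G F + scf_mult C G F'" for F F' G
    by (rule ext; simp add: scf_mult_def case_prod_unfold component_linear m_op_linear sum.distrib
        del: plus_fun_apply; simp)+
  moreover have "scf_mult C (fscale r F) G = fscale r (scf_mult C F G)"
    "scf_mult C G (fscale r F) = fscale r (scf_mult C G F)" for F G r
    by (rule ext; simp add: scf_mult_def case_prod_unfold component_linear m_op_linear sum_distrib_left
        fscale_def[of r "\<lambda>_. _"]; simp add: fscale_def sum_distrib_left m_op_linear[unfolded fscale_def])+
  ultimately show ?thesis unfolding bilinear_on_def linear_on_def by (intro conjI ballI allI)
qed

lemma scf_comult_linear: "linear_on V (scf_comult C)"
  unfolding linear_on_def
proof (intro conjI ballI allI)
  show "scf_comult C (F + G) = scf_comult C F + scf_comult C G" for F G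
    by (rule ext) (simp add: scf_comult_def case_prod_unfold delta_op_def component_def)
  show "scf_comult C (fscale r F) = fscale r (scf_comult C F)" for F r
    by (rule ext) (simp add: scf_comult_def case_prod_unfold delta_op_def component_def fscale_def)
qed

lemma component_superchar_basis:
  "component (superchar_basis C (n, I)) k = (if k = n then superchar_dot C n I else (\<lambda>_. 0))"
  by (auto simp: component_def superchar_basis_def in_degree_def)

lemma m_op_zero: "m_op C m n A (\<lambda>_. 0) \<psi> g = 0" "m_op C m n A \<phi> (\<lambda>_. 0) g = 0"
  by (simp_all add: m_op_def s_op_def Let_def)

context finite_cyclic begin

lemma scf_mult_superchar:
  assumes I: "I \<subseteq> {1..<m}" and J: "J \<subseteq> {1..<n}"
  shows "scf_mult C (superchar_basis C (m, I)) (superchar_basis C (n, J))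
    = (\<Sum>A\<in>{A. A \<subseteq> {1..m + n} \<and> card A = n}. superchar_basis C (m + n, shuffle_descents (m + n) A I J))"
proof (rule ext, clarify)
  fix N :: nat and g
  let ?S = "\<lambda>m n. {A. A \<subseteq> {1..m + n} \<and> card A = n}"
  let ?F = "component (superchar_basis C (m, I))" and ?G = "component (superchar_basis C (n, J))"
  have fin: "finite {(k, l). k + l = N}"
    by (rule finite_subset[of _ "{..N} \<times> {..N}"]) auto
  have "scf_mult C (superchar_basis C (m, I)) (superchar_basis C (n, J)) (N, g)
      = (\<Sum>p\<in>{(k, l). k + l = N}. \<Sum>A\<in>?S (fst p) (snd p). m_op C (fst p) (snd p) A (?F (fst p)) (?G (snd p)) g)"
    by (simp add: scf_mult_def case_prod_unfold)
  also have "\<dots> = (\<Sum>p\<in>{(k, l). k + l = N}. if p = (m, n) then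
      \<Sum>A\<in>?S m n. superchar_dot C (m + n) (shuffle_descents (m + n) A I J) g else 0)"
  proof (rule sum.cong[OF refl])
    fix p :: "nat \<times> nat"
    show "(\<Sum>A\<in>?S (fst p) (snd p). m_op C (fst p) (snd p) A (?F (fst p)) (?G (snd p)) g)
      = (if p = (m, n) then \<Sum>A\<in>?S m n. superchar_dot C (m + n) (shuffle_descents (m + n) A I J) g else 0)"
    proof (cases "p = (m, n)")
      case True
      have "(\<Sum>A\<in>?S m n. m_op C m n A (superchar_dot C m I) (superchar_dot C n J) g)
          = (\<Sum>A\<in>?S m n. superchar_dot C (m + n) (shuffle_descents (m + n) A I J) g)"
        by (intro sum.cong refl m_op_superchar[OF I J]) blast+
      then show ?thesis using True by (simp add: component_superchar_basis)
    next
      case False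
      then have "?F (fst p) = (\<lambda>_. 0) \<or> ?G (snd p) = (\<lambda>_. 0)"
        by (cases p) (auto simp: component_superchar_basis)
      then show ?thesis using False by (auto simp: m_op_zero)
    qed
  qed
  also have "\<dots> = (if N = m + n then \<Sum>A\<in>?S m n. superchar_dot C (m + n) (shuffle_descents (m + n) A I J) g else 0)"
    using fin by auto
  also have "\<dots> = (\<Sum>A\<in>?S m n. superchar_basis C (m + n, shuffle_descents (m + n) A I J)) (N, g)"
    unfolding sum_fun_apply by (simp add: superchar_basis_def in_degree_def)
  finally show "scf_mult C (superchar_basis C (m, I)) (superchar_basis C (n, J)) (N, g)
    = (\<Sum>A\<in>?S m n. superchar_basis C (m + n, shuffle_descents (m + n) A I J)) (N, g)" .
qed

text \<open>The product over the positions of the joined element splits at \<open>k\<close>, where its coordinate is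
  the identity and contributes the factor 1.\<close>

lemma delta_op_superchar:
  assumes I: "I \<subseteq> {1..<k + l}"
  shows "delta_op C k l (superchar_dot C (k + l) I) x y
    = superchar_dot C k (I \<inter> {1..<k}) x * superchar_dot C l (tail_set k (k + l) I) y"
proof -
  let ?T = "tail_set k (k + l) I"
  have T: "?T \<subseteq> {1..<l}" by (auto simp: tail_set_def)
  have I1: "I \<inter> {1..<k} \<subseteq> {1..<k}" by auto
  note dots = superchar_dot_prod[OF I1] superchar_dot_prod[OF T] superchar_dot_prod[OF I]
  consider "x \<notin> carrier (Q_group C k) \<or> y \<notin> carrier (Q_group C l)"
    | "x \<in> carrier (Q_group C k)" "y \<in> carrier (Q_group C l)" "k = 0"
    | "x \<in> carrier (Q_group C k)" "y \<in> carrier (Q_group C l)" "k \<noteq> 0" "l = 0"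
    | "x \<in> carrier (Q_group C k)" "y \<in> carrier (Q_group C l)" "k \<noteq> 0" "l \<noteq> 0"
    by blast
  then show ?thesis
  proof cases
    case 1
    then show ?thesis unfolding delta_op_def dots by auto
  next
    case 2
    then have "?T = I" using I by (auto simp: tail_set_def)
    then show ?thesis using 2 by (simp add: delta_op_def superchar_dot_0)
  next
    case 3
    then have "?T = {}" "I \<inter> {1..<k} = I" using I by (auto simp: tail_set_def)
    then show ?thesis using 3 by (simp add: delta_op_def superchar_dot_0)
  next
    case 4
    define z where "z = (\<lambda>i\<in>{1..<k + l}. if i < k then x i else if i = k then \<one> else y (i - k))"
    have xy: "x i \<in> carrier C" if "i \<in> {1..<k}" for i
      using 4 that by (auto simp: carrier_Q_group[OF is_group])
    have y: "y i \<in> carrier C" if "i \<in> {1..<l}" for i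
      using 4 that by (auto simp: carrier_Q_group[OF is_group])
    have z: "z \<in> carrier (Q_group C (k + l))"
      unfolding z_def carrier_Q_group[OF is_group] restrict_PiE_iff
    proof
      fix i assume "i \<in> {1..<k + l}"
      then have "i - k \<in> {1..<l}" if "\<not> i < k" "i \<noteq> k" using that by auto
      then show "(if i < k then x i else if i = k then \<one> else y (i - k)) \<in> carrier C"
        using xy[of i] y \<open>i \<in> _\<close> by simp
    qed
    have "{1..<k + l} - I = ({1..<k} - I \<inter> {1..<k}) \<union> ((+) k ` ({1..<l} - ?T) \<union> ({k} - I))"
    proof (rule equalityI; rule subsetI)
      fix i assume i: "i \<in> {1..<k + l} - I"
      consider "i < k" | "i = k" | j where "i = k + j" "0 < j"
        using less_imp_add_positive[of k i] by (metis linorder_neqE_nat)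
      then show "i \<in> ({1..<k} - I \<inter> {1..<k}) \<union> ((+) k ` ({1..<l} - ?T) \<union> ({k} - I))"
        using i by cases (auto simp: tail_set_def)
    qed (use 4 in \<open>auto simp: tail_set_def\<close>)
    then have "(\<Prod>i\<in>{1..<k + l} - I. rbar C (z i))
        = (\<Prod>i\<in>({1..<k} - I \<inter> {1..<k}) \<union> ((+) k ` ({1..<l} - ?T) \<union> ({k} - I)). rbar C (z i))"
      by simp
    also have "\<dots> = (\<Prod>i\<in>{1..<k} - I \<inter> {1..<k}. rbar C (z i)) *
        (\<Prod>i\<in>(+) k ` ({1..<l} - ?T) \<union> ({k} - I). rbar C (z i))"
      by (rule prod.union_disjoint) auto
    also have "(\<Prod>i\<in>(+) k ` ({1..<l} - ?T) \<union> ({k} - I). rbar C (z i))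
        = (\<Prod>i\<in>(+) k ` ({1..<l} - ?T). rbar C (z i)) * (\<Prod>i\<in>{k} - I. rbar C (z i))"
      by (rule prod.union_disjoint) auto
    also have "(\<Prod>i\<in>{k} - I. rbar C (z i)) = 1"
      using 4 by (intro prod.neutral) (simp add: z_def rbar_one)
    also have "(\<Prod>i\<in>(+) k ` ({1..<l} - ?T). rbar C (z i)) = (\<Prod>i\<in>{1..<l} - ?T. rbar C (y i))"
      by (subst prod.reindex) (auto simp: z_def intro!: prod.cong)
    also have "(\<Prod>i\<in>{1..<k} - I \<inter> {1..<k}. rbar C (z i)) = (\<Prod>i\<in>{1..<k} - I \<inter> {1..<k}. rbar C (x i))"
      by (rule prod.cong) (auto simp: z_def)
    finally have "superchar_dot C (k + l) I z
        = superchar_dot C k (I \<inter> {1..<k}) x * superchar_dot C l ?T y"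
      unfolding dots using z 4 by simp
    then show ?thesis using 4 by (simp add: delta_op_def z_def)
  qed
qed

lemma scf_comult_superchar:
  assumes I: "I \<subseteq> {1..<n}"
  shows "scf_comult C (superchar_basis C (n, I))
    = (\<Sum>k\<le>n. superchar_basis C (k, I \<inter> {1..<k}) \<otimes>\<^sub>t superchar_basis C (n - k, tail_set k n I))"
proof (rule ext, clarify)
  fix k x l y
  have "(\<Sum>k'\<le>n. superchar_basis C (k', I \<inter> {1..<k'}) \<otimes>\<^sub>t superchar_basis C (n - k', tail_set k' n I)) ((k, x), (l, y))
      = (\<Sum>k'\<le>n. if k' = k then if l = n - k then
          superchar_dot C k (I \<inter> {1..<k}) x * superchar_dot C l (tail_set k n I) y else 0 else 0)"
    unfolding sum_fun_apply
    by (rule sum.cong) (auto simp: pure_def superchar_basis_def in_degree_def)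
  also have "\<dots> = (if k + l = n then superchar_dot C k (I \<inter> {1..<k}) x * superchar_dot C l (tail_set k n I) y else 0)"
    by (subst sum.delta) auto
  also have "\<dots> = scf_comult C (superchar_basis C (n, I)) ((k, x), (l, y))"
  proof (cases "k + l = n")
    case True
    then show ?thesis
      using delta_op_superchar[of I k l x y] I by (simp add: scf_comult_def component_superchar_basis)
  next
    case False
    then show ?thesis by (simp add: scf_comult_def component_superchar_basis delta_op_def)
  qed
  finally show "scf_comult C (superchar_basis C (n, I)) ((k, x), (l, y)) = (\<Sum>k'\<le>n.
      superchar_basis C (k', I \<inter> {1..<k'}) \<otimes>\<^sub>t superchar_basis C (n - k', tail_set k' n I)) ((k, x), (l, y))" ..
qed

section \<open>The characteristic map\<close>

lemma ch_eq_lin_ext: "ch C = lin_ext degree_sets (superchar_basis C) fundamental_basis"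
  unfolding ch_def degree_sets_def superchar_basis_def fundamental_basis_def ..

lemma ch_superchar: "I \<subseteq> {1..<n} \<Longrightarrow> ch C (superchar_basis C (n, I)) = qsym_L n I"
  unfolding ch_eq_lin_ext
  by (subst lin_ext_basis[OF indep_superchar]) (simp_all add: degree_sets_def fundamental_basis_def)

lemma ch_linear: "linear_on (SCF C) (ch C)"
  using lin_ext_linear[OF indep_superchar] unfolding ch_eq_lin_ext span_superchar .

lemma ch_bij: "bij_betw (ch C) (SCF C) QSym"
  using lin_ext_bij[OF indep_superchar indep_fundamental]
  unfolding ch_eq_lin_ext span_superchar span_fundamental .

lemma ch_closed: "F \<in> SCF C \<Longrightarrow> ch C F \<in> QSym"
  using ch_bij by (auto simp: bij_betw_def)

lemma superchar_closed: "I \<subseteq> {1..<n} \<Longrightarrow> superchar_basis C (n, I) \<in> SCF C"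
  by (rule superchar_in_SCF) (simp add: degree_sets_def)

lemma ch_sum:
  assumes "finite S" "\<And>i. i \<in> S \<Longrightarrow> v i \<in> SCF C"
  shows "ch C (\<Sum>i\<in>S. v i) = (\<Sum>i\<in>S. ch C (v i))"
  using linear_on_sum[OF subspace_SCF ch_linear assms, where c = "\<lambda>_. 1"] by simp

text \<open>Statements that are linear in an element of \<open>SCF C\<close> are verified on supercharacters.\<close>

lemma linear_on_SCF_eqI:
  assumes "linear_on (SCF C) f" "linear_on (SCF C) g"
    and "\<And>n I. I \<subseteq> {1..<n} \<Longrightarrow> f (superchar_basis C (n, I)) = g (superchar_basis C (n, I))" and "F \<in> SCF C"
  shows "f F = g F"
  using linear_on_span_eqI[of "superchar_basis C ` degree_sets" f g F] assms
  unfolding span_superchar by (auto simp: degree_sets_def)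

lemma linear_on_SCF_closed:
  assumes "linear_on (SCF C) f" "fs.subspace W"
    and "\<And>n I. I \<subseteq> {1..<n} \<Longrightarrow> f (superchar_basis C (n, I)) \<in> W" and "F \<in> SCF C"
  shows "f F \<in> W"
  using linear_on_span_closed[of "superchar_basis C ` degree_sets" f W F] assms
  unfolding span_superchar by (auto simp: degree_sets_def)

lemma scf_mult_linear: "linear_on V (scf_mult C F)" "linear_on V (\<lambda>F. scf_mult C F G)"
  using scf_mult_bilinear[of UNIV UNIV C] by (auto simp: bilinear_on_def intro: linear_on_subset)

lemma scf_mult_superchar_image:
  assumes I: "I \<subseteq> {1..<m}" and J: "J \<subseteq> {1..<n}"
  shows "scf_mult C (superchar_basis C (m, I)) (superchar_basis C (n, J)) \<in> SCF C"
    and "ch C (scf_mult C (superchar_basis C (m, I)) (superchar_basis C (n, J)))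
      = qsym_mult (qsym_L m I) (qsym_L n J)"
proof -
  let ?S = "{A. A \<subseteq> {1..m + n} \<and> card A = n}"
  have fin: "finite ?S" by (rule finite_subset[of _ "Pow {1..m + n}"]) auto
  have K: "shuffle_descents (m + n) A I J \<subseteq> {1..<m + n}" if "A \<in> ?S" for A
    using that I J by (intro shuffle_descents_subset) auto
  show "scf_mult C (superchar_basis C (m, I)) (superchar_basis C (n, J)) \<in> SCF C"
    unfolding scf_mult_superchar[OF I J]
    by (rule fs.subspace_sum[OF subspace_SCF]) (rule superchar_closed[OF K])
  have "ch C (scf_mult C (superchar_basis C (m, I)) (superchar_basis C (n, J)))
      = (\<Sum>A\<in>?S. ch C (superchar_basis C (m + n, shuffle_descents (m + n) A I J)))"
    unfolding scf_mult_superchar[OF I J] by (rule ch_sum[OF fin]) (rule superchar_closed[OF K])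
  also have "\<dots> = (\<Sum>A\<in>?S. qsym_L (m + n) (shuffle_descents (m + n) A I J))"
    by (rule sum.cong[OF refl]) (rule ch_superchar[OF K])
  also have "\<dots> = qsym_mult (qsym_L m I) (qsym_L n J)"
    by (rule qsym_L_mult[OF I J, symmetric])
  finally show "ch C (scf_mult C (superchar_basis C (m, I)) (superchar_basis C (n, J)))
      = qsym_mult (qsym_L m I) (qsym_L n J)" .
qed

lemma scf_mult_closed:
  assumes F: "F \<in> SCF C" and G: "G \<in> SCF C"
  shows "scf_mult C F G \<in> SCF C"
proof (rule linear_on_SCF_closed[OF scf_mult_linear(2) subspace_SCF _ F])
  fix m :: nat and I assume I: "I \<subseteq> {1..<m}"
  show "scf_mult C (superchar_basis C (m, I)) G \<in> SCF C"
    by (rule linear_on_SCF_closed[OF scf_mult_linear(1) subspace_SCF scf_mult_superchar_image(1)[OF I] G])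
qed

lemma ch_mult:
  assumes F: "F \<in> SCF C" and G: "G \<in> SCF C"
  shows "ch C (scf_mult C F G) = qsym_mult (ch C F) (ch C G)"
proof -
  have L1: "linear_on UNIV (\<lambda>f. qsym_mult f g)" and L2: "linear_on UNIV (qsym_mult g)" for g
    using qsym_mult_bilinear[of UNIV UNIV] by (auto simp: bilinear_on_def)
  show ?thesis
  proof (rule linear_on_SCF_eqI[OF _ _ _ F])
    show "linear_on (SCF C) (\<lambda>F. ch C (scf_mult C F G))"
      by (rule linear_on_comp[OF scf_mult_linear(2) ch_linear scf_mult_closed[OF _ G]])
    show "linear_on (SCF C) (\<lambda>F. qsym_mult (ch C F) (ch C G))"
      by (rule linear_on_comp[OF ch_linear L1 UNIV_I])
    fix m :: nat and I assume I: "I \<subseteq> {1..<m}"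
    show "ch C (scf_mult C (superchar_basis C (m, I)) G) = qsym_mult (ch C (superchar_basis C (m, I))) (ch C G)"
    proof (rule linear_on_SCF_eqI[OF _ _ _ G])
      show "linear_on (SCF C) (\<lambda>G. ch C (scf_mult C (superchar_basis C (m, I)) G))"
        by (rule linear_on_comp[OF scf_mult_linear(1) ch_linear scf_mult_closed[OF superchar_closed[OF I]]])
      show "linear_on (SCF C) (\<lambda>G. qsym_mult (ch C (superchar_basis C (m, I))) (ch C G))"
        by (rule linear_on_comp[OF ch_linear L2 UNIV_I])
      show "ch C (scf_mult C (superchar_basis C (m, I)) (superchar_basis C (n, J)))
          = qsym_mult (ch C (superchar_basis C (m, I))) (ch C (superchar_basis C (n, J)))" if "J \<subseteq> {1..<n}" for n J
        unfolding ch_superchar[OF I] ch_superchar[OF that] by (rule scf_mult_superchar_image(2)[OF I that])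
    qed
  qed
qed

lemma comult_part_closed:
  "superchar_basis C (k, I \<inter> {1..<k}) \<in> SCF C" "superchar_basis C (n - k, tail_set k n I) \<in> SCF C"
  by (rule superchar_closed, auto simp: tail_set_def)+

lemma scf_comult_closed: "F \<in> SCF C \<Longrightarrow> scf_comult C F \<in> tensor (SCF C) (SCF C)"
proof (rule linear_on_SCF_closed[OF scf_comult_linear subspace_tensor])
  fix n :: nat and I assume I: "I \<subseteq> {1..<n}"
  show "scf_comult C (superchar_basis C (n, I)) \<in> tensor (SCF C) (SCF C)"
    unfolding scf_comult_superchar[OF I]
    by (intro fs.subspace_sum[OF subspace_tensor] pure_in_tensor comult_part_closed)
qed

lemma ch_comult:
  assumes "F \<in> SCF C"
  shows "tensor_map (SCF C) (SCF C) (ch C) (ch C) (scf_comult C F) = qsym_comult (ch C F)"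
proof (rule linear_on_SCF_eqI[OF _ _ _ assms])
  note V = subspace_SCF
  note map = tensor_map_linear[OF V V ch_linear ch_linear]
  show "linear_on (SCF C) (\<lambda>F. tensor_map (SCF C) (SCF C) (ch C) (ch C) (scf_comult C F))"
    by (rule linear_on_comp[OF scf_comult_linear map scf_comult_closed])
  show "linear_on (SCF C) (\<lambda>F. qsym_comult (ch C F))"
    by (rule linear_on_comp[OF ch_linear qsym_comult_linear ch_closed])
  fix n :: nat and I assume I: "I \<subseteq> {1..<n}"
  let ?l = "\<lambda>k. superchar_basis C (k, I \<inter> {1..<k})" and ?r = "\<lambda>k. superchar_basis C (n - k, tail_set k n I)"
  have "tensor_map (SCF C) (SCF C) (ch C) (ch C) (\<Sum>k\<le>n. ?l k \<otimes>\<^sub>t ?r k)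
      = (\<Sum>k\<le>n. tensor_map (SCF C) (SCF C) (ch C) (ch C) (?l k \<otimes>\<^sub>t ?r k))"
    using linear_on_sum[where c = "\<lambda>_. 1" and S = "{..n}" and v = "\<lambda>k. ?l k \<otimes>\<^sub>t ?r k",
        OF subspace_tensor map finite_atMost pure_in_tensor[OF comult_part_closed]]
    by (simp only: fs.scale_one)
  also have "\<dots> = (\<Sum>k\<le>n. qsym_L k (I \<inter> {1..<k}) \<otimes>\<^sub>t qsym_L (n - k) (tail_set k n I))"
  proof (rule sum.cong[OF refl])
    fix k :: nat
    have "I \<inter> {1..<k} \<subseteq> {1..<k}" "tail_set k n I \<subseteq> {1..<n - k}" by (auto simp: tail_set_def)
    then show "tensor_map (SCF C) (SCF C) (ch C) (ch C) (?l k \<otimes>\<^sub>t ?r k)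
        = qsym_L k (I \<inter> {1..<k}) \<otimes>\<^sub>t qsym_L (n - k) (tail_set k n I)"
      by (simp only: tensor_map_pure[OF V V ch_linear ch_linear comult_part_closed] ch_superchar)
  qed
  also have "\<dots> = qsym_comult (ch C (superchar_basis C (n, I)))"
    unfolding ch_superchar[OF I] by (rule qsym_L_comult[OF I, symmetric])
  finally show "tensor_map (SCF C) (SCF C) (ch C) (ch C) (scf_comult C (superchar_basis C (n, I)))
      = qsym_comult (ch C (superchar_basis C (n, I)))"
    unfolding scf_comult_superchar[OF I] .
qed

end

theorem theorem3p12:
  fixes C :: "'c monoid" and \<nu> :: nat
  assumes "group C" and "cyclic_group C" and "order C = \<nu>" and "\<nu> > 1"
  shows "(\<exists>one counit antipode.
            hopf_algebra_on (SCF C) (scf_mult C) one (scf_comult C) counit antipode)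
       \<and> (\<exists>one counit antipode one' counit' antipode'.
            hopf_iso_on (SCF C) (scf_mult C) one (scf_comult C) counit antipode
                        QSym qsym_mult one' qsym_comult counit' antipode' (ch C))"
proof -
  interpret finite_cyclic C \<nu>
    by (rule finite_cyclic.intro[OF assms(1)], rule finite_cyclic_axioms.intro) (rule assms)+
  have "\<exists>one counit antipode. hopf_iso_on (SCF C) (scf_mult C) one (scf_comult C) counit antipode
      QSym qsym_mult (qsym_M []) qsym_comult (\<lambda>f. f 0) qsym_antipode (ch C)"
    by (rule hopf_transport[OF hopf_algebra_on_QSym subspace_SCF ch_linear ch_bij scf_mult_bilinear
        scf_mult_closed ch_mult scf_comult_linear scf_comult_closed ch_comult])
  then obtain one counit antipode where iso: "hopf_iso_on (SCF C) (scf_mult C) one (scf_comult C)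
      counit antipode QSym qsym_mult (qsym_M []) qsym_comult (\<lambda>f. f 0) qsym_antipode (ch C)"
    by (elim exE)
  then have "hopf_algebra_on (SCF C) (scf_mult C) one (scf_comult C) counit antipode"
    by (rule hopf_iso_on.axioms(1))
  with iso show ?thesis by blast
qed

end
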